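(* Let $p \ge 5$ be a prime. Then $$\limsup_{N \to \infty} \frac{g^*(p,N)}{\log N} = \frac{p-1}{\varphi(p-1)},$$ where $N$ ranges over positive integers and $g^*(p,N)$ is the least prime primitive root modulo $p$ that does not divide $N$.
   Context: $\varphi$ is the Euler totient function. A prime primitive root modulo $p$ is a prime number that is also a primitive root modulo $p$. *)

theory Defs
  imports
    "HOL-Analysis.Extended_Real_Limits"
    "HOL-Number_Theory.Residue_Primitive_Roots"
begin

definition prime_primroot :: "nat \<Rightarrow> nat \<Rightarrow> bool" where
  "prime_primroot p q \<longleftrightarrow> prime q \<and> residue_primroot p q"

(* For prime p and N > 0 the least element exists: by Dirichlet's theorem there are infinitely
   many prime primitive roots modulo p (they are not required to be smaller than p). *)
definition gstar :: "nat \<Rightarrow> nat \<Rightarrow> nat" where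
  "gstar p N = (LEAST q. prime_primroot p q \<and> \<not> q dvd N)"

end

theory Submission
  imports
    Defs
    "HOL-Complex_Analysis.Complex_Analysis"
    "HOL-Number_Theory.Prime_Powers"
    "HOL-Real_Asymp.Real_Asymp"
begin

text \<open>
  If \<open>q < g*(p,N)\<close> is a prime primitive root then \<open>q\<close> divides \<open>N\<close>, so \<open>\<theta>(g*(p,N) - 1) \<le> log N\<close>,
  where \<open>\<theta>(x)\<close> is the sum of \<open>log q\<close> over the prime primitive roots \<open>q \<le> x\<close>; the product of
  these \<open>q\<close> is a number \<open>N\<close> with \<open>log N = \<theta>(x)\<close> and \<open>g*(p,N) > x\<close>. The theorem thus amounts to
  \<open>\<theta>(x) \<sim> x \<phi>(p-1)/(p-1)\<close>, the prime number theorem for the residue classes of primitive roots.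

  The indicator of these classes is a combination of the powers of one faithful character modulo
  \<open>p\<close>. Dirichlet series of non-principal characters have bounded coefficient sums and extend to
  \<open>Re s > 0\<close>; they do not vanish for \<open>Re s \<ge> 1\<close> by the inequality \<open>3 + 4 cos + cos 2 \<ge> 0\<close> and, for
  a real character at \<open>s = 1\<close>, by Monsky's Lambert series argument. The asymptotics then follow from
  a Wiener-Ikehara theorem, proved with the Fejer kernel: the series under study is compared with
  the zeta function, so that only sums over the integers, and no improper integrals, occur.
\<close>

subsection \<open>Dirichlet series\<close>

text \<open>The limsup is an exact constant, so order-of-magnitude bounds for theta would leave it
  undetermined; a true asymptotic formula has to come out of the analysis. The Tauberian step asks
  for a continuous extension to the closed half-plane \<open>Re s >= 1\<close> once the pole is
  removed. The Fourier transform of the Fejer kernel has compact support, so only a bounded segment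
  of the line is seen, whatever the growth of L in the vertical direction; and since the kernel is
  nonnegative, the line is reached from the right by one-sided comparisons.

  The inequality \<open>3 + 4 cos + cos 2 >= 0\<close> weighs the pole of the principal character,
  counted 3 times, against 4 times the order of a zero. It loses its force exactly when the square
  of the character brings in a pole of its own, that is for a real character at s = 1; hence the
  arithmetic argument for that case. The role of the Euler product is played by the relation L' = -
  P L, with P the series weighted by the Mangoldt function: it gives the logarithmic derivative and
  also the non-vanishing for \<open>Re s > 1\<close>.\<close>

definition dirichlet_series :: "(nat \<Rightarrow> complex) \<Rightarrow> complex \<Rightarrow> complex" where
  "dirichlet_series a s = (\<Sum>n. a n * of_nat n powr (-s))"

section \<open>Differences of the powers n^(-s)\<close>

lemma norm_nat_powr: "norm (of_nat n powr s :: complex) = real n powr Re s"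
  by (cases "n = 0") (simp_all add: norm_powr_real_powr)

lemma closed_segment_Suc:
  assumes "z \<in> closed_segment (of_nat m) (of_nat (Suc m))" "m > 0"
  obtains x where "z = complex_of_real x" "x \<ge> real m" "x > 0"
proof -
  from assms(1) obtain u where u: "0 \<le> u" "u \<le> 1"
    and z: "z = (1 - u) *\<^sub>R of_nat m + u *\<^sub>R of_nat (Suc m)"
    by (auto simp: closed_segment_def)
  have "z = complex_of_real (real m + u)"
    unfolding z by (simp add: scaleR_conv_of_real algebra_simps)
  with that[of "real m + u"] u assms(2) show ?thesis by auto
qed

text \<open>Mean value estimate on a segment that avoids the branch cut; the condition on Re s makes
  the derivative largest at m. The gain of one power of m is what lets partial summation reach Re s
  > 0.\<close>

lemma norm_powr_diff_le:
  assumes "m > 0" "Re s \<ge> -1"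
  shows "norm (of_nat m powr (-s) - of_nat (Suc m) powr (-s) :: complex)
           \<le> norm s * real m powr (- Re s - 1)"
proof -
  let ?S = "closed_segment (of_nat m) (of_nat (Suc m)) :: complex set"
  have "norm ((of_nat (Suc m)) powr (-s) - (of_nat m) powr (-s) :: complex)
     \<le> (norm s * real m powr (- Re s - 1)) * norm (of_nat (Suc m) - of_nat m :: complex)"
  proof (rule field_differentiable_bound[of ?S "\<lambda>z. z powr (-s)" "\<lambda>z. -s * z powr (-s-1)"])
    fix z assume "z \<in> ?S"
    then obtain x where x: "z = complex_of_real x" "x \<ge> real m" "x > 0"
      using assms(1) by (rule closed_segment_Suc)
    have z: "z \<notin> \<real>\<^sub>\<le>\<^sub>0" using x by auto
    show "((\<lambda>z. z powr (-s)) has_field_derivative -s * z powr (-s-1)) (at z within ?S)"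
      using z by (auto intro!: derivative_eq_intros)
    have "x powr (- Re s - 1) \<le> real m powr (- Re s - 1)"
      using x assms by (intro powr_mono2') auto
    thus "norm (-s * z powr (-s-1)) \<le> norm s * real m powr (- Re s - 1)"
      using x by (auto simp: norm_mult norm_powr_real_powr intro!: mult_left_mono)
  qed auto
  thus ?thesis by (simp add: norm_minus_commute)
qed

text \<open>Second-order Taylor remainder at m over a unit step. It compares n^(-s-1) with a
  telescoping series, both in the continuation of zeta and in the passage from a summatory function
  to its mean.\<close>

lemma norm_powr_diff_deriv_le:
  assumes "m > 0" "Re s \<ge> -2"
  shows "norm (s * of_nat m powr (-s-1) - (of_nat m powr (-s) - of_nat (Suc m) powr (-s)) :: complex)
           \<le> norm s * norm (s + 1) * real m powr (- Re s - 2)"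
proof -
  let ?S = "closed_segment (of_nat m) (of_nat (Suc m)) :: complex set"
  define f where "f = (\<lambda>(i::nat) (z::complex). if i = 0 then z powr (-s) else if i = 1 then -s * z powr (-s-1)
      else s * (s+1) * z powr (-s-2))"
  have "norm (f 0 (of_nat (Suc m)) - (\<Sum>i\<le>1. f i (of_nat m) * (of_nat (Suc m) - of_nat m) ^ i / fact i))
      \<le> (norm s * norm (s + 1) * real m powr (- Re s - 2)) * norm (of_nat (Suc m) - of_nat m :: complex) ^ Suc 1 / fact 1"
  proof (rule complex_Taylor[of ?S])
    fix i :: nat and z assume "z \<in> ?S" and i: "i \<le> 1"
    obtain x where x: "z = complex_of_real x" "x \<ge> real m" "x > 0"
      by (rule closed_segment_Suc[OF \<open>z \<in> ?S\<close> assms(1)])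
    have z: "z \<notin> \<real>\<^sub>\<le>\<^sub>0" using x by auto
    show "(f i has_field_derivative f (Suc i) z) (at z within ?S)"
    proof (cases "i = 0")
      case True
      thus ?thesis using z by (auto simp: f_def intro!: derivative_eq_intros)
    next
      case False
      with i have "i = 1" by simp
      thus ?thesis using z
        by (auto simp: f_def algebra_simps intro!: derivative_eq_intros)
    qed
  next
    fix z assume "z \<in> ?S"
    obtain x where x: "z = complex_of_real x" "x \<ge> real m" "x > 0"
      by (rule closed_segment_Suc[OF \<open>z \<in> ?S\<close> assms(1)])
    have "x powr (- Re s - 2) \<le> real m powr (- Re s - 2)"
      using x assms by (intro powr_mono2') auto
    thus "norm (f (Suc 1) z) \<le> norm s * norm (s + 1) * real m powr (- Re s - 2)"
      using x by (auto simp: f_def norm_mult norm_powr_real_powr mult.assoc intro!: mult_left_mono)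
  qed auto
  thus ?thesis by (simp add: f_def norm_minus_commute algebra_simps)
qed

text \<open>Weierstrass test with local majorants. They may depend on a bound R for the modulus of
  s, because the estimates obtained from differences of powers grow with
  \<open>norm s\<close>.\<close>

lemma holomorphic_on_suminf_halfplane:
  fixes f :: "nat \<Rightarrow> complex \<Rightarrow> complex"
  assumes holo: "\<And>n. f n holomorphic_on {s. Re s > x}"
  assumes bound: "\<And>y R. y > x \<Longrightarrow> \<exists>h. summable h \<and> (\<forall>n s. Re s \<ge> y \<longrightarrow> norm s \<le> R \<longrightarrow> norm (f n s) \<le> h n)"
  shows "(\<lambda>s. \<Sum>n. f n s) holomorphic_on {s. Re s > x}"
    and "\<And>s. Re s > x \<Longrightarrow> summable (\<lambda>n. f n s)"
    and "\<And>s. Re s > x \<Longrightarrow> ((\<lambda>s. \<Sum>n. f n s) has_field_derivative (\<Sum>n. deriv (f n) s)) (at s)"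
proof -
  let ?S = "{s. Re s > x}"
  have op: "open ?S" by (rule open_halfspace_Re_gt)
  have "\<exists>g g'. \<forall>s\<in>?S. ((\<lambda>n. f n s) sums g s) \<and> ((\<lambda>n. deriv (f n) s) sums g' s) \<and> (g has_field_derivative g' s) (at s)"
  proof (rule series_and_derivative_comparison_local[OF op])
    fix n s assume "s \<in> ?S"
    thus "(f n has_field_derivative deriv (f n) s) (at s)"
      using holo op holomorphic_derivI by blast
  next
    fix s assume "s \<in> ?S"
    \<comment> \<open>Half the distance to the boundary line: the ball around s stays in a region
      with a single majorant.\<close>
    define d where "d = (Re s - x) / 2"
    have d: "d > 0" using \<open>s \<in> ?S\<close> by (simp add: d_def)
    obtain h where h: "summable h" "\<And>n s'. Re s' \<ge> Re s - d \<Longrightarrow> norm s' \<le> norm s + d \<Longrightarrow> norm (f n s') \<le> h n"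
      using bound[of "Re s - d" "norm s + d"] d by (auto simp: d_def field_simps)
    have "norm (f n y) \<le> h n" if "y \<in> ball s d" for n y
    proof (rule h(2))
      have "norm (s - y) < d" using that by (simp add: dist_norm)
      moreover have "\<bar>Re (s - y)\<bar> \<le> norm (s - y)" by (rule abs_Re_le_cmod)
      ultimately show "Re y \<ge> Re s - d" by simp
      have "norm y \<le> norm s + norm (s - y)"
        by (metis norm_minus_commute norm_triangle_sub)
      thus "norm y \<le> norm s + d" using \<open>norm (s - y) < d\<close> by simp
    qed
    thus "\<exists>d h. 0 < d \<and> summable h \<and> (\<forall>\<^sub>F n in sequentially. \<forall>y\<in>ball s d \<inter> ?S. norm (f n y) \<le> h n)"
      using d h(1) by (intro exI[of _ d] exI[of _ h]) auto
  qed
  then obtain g g' where g: "\<And>s. s \<in> ?S \<Longrightarrow> (\<lambda>n. f n s) sums g s"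
    "\<And>s. s \<in> ?S \<Longrightarrow> (\<lambda>n. deriv (f n) s) sums g' s"
    "\<And>s. s \<in> ?S \<Longrightarrow> (g has_field_derivative g' s) (at s)" by blast
  show "\<And>s. Re s > x \<Longrightarrow> summable (\<lambda>n. f n s)" using g(1) by (auto simp: sums_iff)
  show *: "((\<lambda>s. \<Sum>n. f n s) has_field_derivative (\<Sum>n. deriv (f n) s)) (at s)" if "Re s > x" for s
  proof -
    have "((\<lambda>s. \<Sum>n. f n s) has_field_derivative g' s) (at s)"
      using g(3)[of s] that
      by (rule_tac has_field_derivative_transform_within_open[OF _ op]) (use g(1) in \<open>auto simp: sums_iff\<close>)
    thus ?thesis using g(2)[of s] that by (simp add: sums_iff)
  qed
  show "(\<lambda>s. \<Sum>n. f n s) holomorphic_on ?S"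
    using * op by (auto simp: holomorphic_on_open)
qed

lemma summable_nat_powr_minus: "x > 1 \<Longrightarrow> summable (\<lambda>n. real n powr (-x))"
  by (simp add: summable_real_powr_iff)

lemma abs_summable_dirichlet:
  assumes "summable (\<lambda>n. norm (a n) * real n powr (-x))" "Re s \<ge> x"
  shows "summable (\<lambda>n. norm (a n * of_nat n powr (-s) :: complex))"
proof (rule summable_comparison_test'[OF assms(1), of 1])
  fix n :: nat assume "n \<ge> 1"
  thus "norm (norm (a n * of_nat n powr (-s))) \<le> norm (a n) * real n powr (-x)"
    using assms(2) by (auto simp: norm_mult norm_nat_powr intro!: mult_left_mono powr_mono)
qed

lemma dirichlet_series_holomorphic:
  assumes "\<And>y. y > x \<Longrightarrow> summable (\<lambda>n. norm (a n) * real n powr (-y))"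
  shows "dirichlet_series a holomorphic_on {s. Re s > x}"
    and "\<And>s. Re s > x \<Longrightarrow> summable (\<lambda>n. a n * of_nat n powr (-s))"
    and "\<And>s. Re s > x \<Longrightarrow> (dirichlet_series a has_field_derivative
            - dirichlet_series (\<lambda>n. a n * ln (real n)) s) (at s)"
proof -
  define f where "f = (\<lambda>n s. a n * of_nat n powr (-s))"
  have der: "(f n has_field_derivative - (a n * of_real (ln (real n)) * of_nat n powr (-s))) (at s)" for n s
  proof (cases "n = 0")
    case False
    hence "ln (of_nat n :: complex) = of_real (ln (real n))"
      by (metis Ln_of_real of_nat_0_less_iff of_real_of_nat_eq zero_less_iff_neq_zero)
    moreover have "((\<lambda>s. of_nat n powr (-s)) has_field_derivative
        - (ln (of_nat n) * of_nat n powr (-s))) (at s)" for s :: complex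
      using False unfolding powr_def by (auto intro!: derivative_eq_intros)
    ultimately show ?thesis unfolding f_def
      by (auto intro!: derivative_eq_intros)
  qed (auto simp: f_def)
  have f1: "f n holomorphic_on {s. Re s > x}" for n
    using der by (auto simp: holomorphic_on_open open_halfspace_Re_gt)
  have f2: "\<exists>h. summable h \<and> (\<forall>n s. Re s \<ge> y \<longrightarrow> norm s \<le> R \<longrightarrow> norm (f n s) \<le> h n)" if "y > x" for y R
  proof (intro exI[of _ "\<lambda>n. norm (a n) * real n powr (-y)"] conjI allI impI assms that)
    fix n s assume "Re s \<ge> y"
    thus "norm (f n s) \<le> norm (a n) * real n powr (-y)"
      by (cases "n = 0") (auto simp: f_def norm_mult norm_nat_powr intro!: mult_left_mono powr_mono)
  qed
  have eq: "dirichlet_series a = (\<lambda>s. \<Sum>n. f n s)"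
    by (auto simp: dirichlet_series_def f_def)
  show "dirichlet_series a holomorphic_on {s. Re s > x}"
    unfolding eq by (rule holomorphic_on_suminf_halfplane[OF f1 f2])
  show "\<And>s. Re s > x \<Longrightarrow> summable (\<lambda>n. a n * of_nat n powr (-s))"
    using holomorphic_on_suminf_halfplane(2)[OF f1 f2] by (simp add: f_def)
  fix s assume s: "Re s > x"
  \<comment> \<open>Half of the slack beyond x is spent on absorbing the factor ln n.\<close>
  define e where "e = (Re s - x) / 2"
  have "deriv (f n) s = - (a n * of_real (ln (real n)) * of_nat n powr (-s))" for n
    using der by (rule DERIV_imp_deriv)
  moreover have "(dirichlet_series a has_field_derivative (\<Sum>n. deriv (f n) s)) (at s)"
    unfolding eq by (rule holomorphic_on_suminf_halfplane(3)[OF f1 f2 s])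
  moreover have "summable (\<lambda>n. a n * of_real (ln (real n)) * of_nat n powr (-s))"
  proof (rule summable_norm_cancel, rule summable_comparison_test_ev)
    have e: "e > 0" "Re s - e > x" using s by (auto simp: e_def field_simps)
    show "summable (\<lambda>n. norm (a n) * real n powr (-(Re s - e)))" by (rule assms) fact
    have "\<forall>\<^sub>F n in sequentially. ln (real n) \<le> real n powr e"
      using e(1) by real_asymp
    thus "\<forall>\<^sub>F n in sequentially. norm (norm (a n * complex_of_real (ln (real n)) * of_nat n powr (-s)))
            \<le> norm (a n) * real n powr (-(Re s - e))"
      using eventually_gt_at_top[of 0]
    proof eventually_elim
      case (elim n)
      have "norm (a n * complex_of_real (ln (real n)) * of_nat n powr (-s)) = norm (a n) * (ln (real n) * real n powr (- Re s))"
        using elim by (simp add: norm_mult norm_nat_powr)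
      also have "\<dots> \<le> norm (a n) * (real n powr e * real n powr (- Re s))"
        using elim by (intro mult_left_mono mult_right_mono) auto
      also have "\<dots> = norm (a n) * real n powr (-(Re s - e))"
        by (simp flip: powr_add)
      finally show ?case by simp
    qed
  qed
  ultimately show "(dirichlet_series a has_field_derivative - dirichlet_series (\<lambda>n. a n * ln (real n)) s) (at s)"
    by (simp add: dirichlet_series_def suminf_minus)
qed

section \<open>Partial summation and continuation to Re s > 0\<close>

lemma sum_by_parts:
  fixes a g :: "nat \<Rightarrow> 'a :: comm_ring"
  shows "(\<Sum>n\<le>N. a n * g n) = (\<Sum>m\<le>N. a m) * g (Suc N) + (\<Sum>n\<le>N. (\<Sum>m\<le>n. a m) * (g n - g (Suc n)))"
  by (induction N) (simp_all add: algebra_simps)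

lemma sums_by_parts:
  fixes a g :: "nat \<Rightarrow> 'a :: real_normed_field"
  assumes "(\<lambda>N. (\<Sum>m\<le>N. a m) * g (Suc N)) \<longlonglongrightarrow> 0"
    and "summable (\<lambda>n. (\<Sum>m\<le>n. a m) * (g n - g (Suc n)))"
  shows "(\<lambda>n. a n * g n) sums (\<Sum>n. (\<Sum>m\<le>n. a m) * (g n - g (Suc n)))"
proof -
  have "(\<lambda>N. (\<Sum>n\<le>N. a n * g n)) \<longlonglongrightarrow> 0 + (\<Sum>n. (\<Sum>m\<le>n. a m) * (g n - g (Suc n)))"
    unfolding sum_by_parts[of a g]
    by (intro tendsto_add assms summable_LIMSEQ')
  thus ?thesis by (simp add: sums_def_le)
qed

text \<open>Summation by parts moves the work to the differences of powers, which are O(n^(-Re s -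
  1)), so the transformed series converges absolutely although the original one may not.\<close>

lemma dirichlet_series_bounded_partial_sums:
  assumes C: "\<And>n. norm (\<Sum>m\<le>n. a m) \<le> C"
  shows "dirichlet_series a holomorphic_on {s. Re s > 0}"
    and "\<And>s. Re s > 0 \<Longrightarrow> summable (\<lambda>n. a n * of_nat n powr (-s))"
proof -
  define f where "f = (\<lambda>n s. (\<Sum>m\<le>n. a m) * (of_nat n powr (-s) - of_nat (Suc n) powr (-s)) :: complex)"
  have C0: "C \<ge> 0" using C[of 0] norm_ge_zero order_trans by blast
  have holo: "f n holomorphic_on {s. Re s > 0}" for n
  proof -
    have "(\<lambda>s. of_nat k powr (-s) :: complex) holomorphic_on A" for k A
      by (cases "k = 0") (auto intro!: holomorphic_intros)
    thus ?thesis unfolding f_def by (intro holomorphic_intros)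
  qed
  have bound: "\<exists>h. summable h \<and> (\<forall>n s. Re s \<ge> y \<longrightarrow> norm s \<le> R \<longrightarrow> norm (f n s) \<le> h n)"
    if y: "y > 0" for y R
  \<comment> \<open>At n = 0 the difference of powers is 0 - 1, because \<open>0 powr z = 0\<close>;
    this single term is bounded by C.\<close>
  proof (intro exI[of _ "\<lambda>n. if n = 0 then C else C * (R * real n powr (-y-1))"] conjI allI impI)
    have "summable (\<lambda>n. C * (R * real n powr (-y-1)))"
      using summable_nat_powr_minus[of "y+1"] y by (intro summable_mult) simp
    thus "summable (\<lambda>n. if n = 0 then C else C * (R * real n powr (-y-1)))"
      by (rule summable_cong[THEN iffD1, rotated]) (rule eventually_mono[OF eventually_gt_at_top[of 0]], simp)
  next
    fix n s assume s: "Re s \<ge> y" "norm s \<le> R"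
    show "norm (f n s) \<le> (if n = 0 then C else C * (R * real n powr (-y-1)))"
    proof (cases "n = 0")
      case True thus ?thesis using C[of 0] by (simp add: f_def)
    next
      case False
      have "norm (of_nat n powr (-s) - of_nat (Suc n) powr (-s) :: complex) \<le> norm s * real n powr (- Re s - 1)"
        using False s y by (intro norm_powr_diff_le) auto
      also have "\<dots> \<le> R * real n powr (-y-1)"
        using s False by (intro mult_mono powr_mono) (auto intro: order_trans[OF norm_ge_zero])
      finally show ?thesis using C[of n] C0 False unfolding f_def norm_mult
        by (auto intro!: mult_mono)
    qed
  qed
  have sums: "(\<lambda>n. a n * of_nat n powr (-s)) sums (\<Sum>n. f n s)" if s: "Re s > 0" for s
    unfolding f_def
  proof (rule sums_by_parts)
    show "summable (\<lambda>n. (\<Sum>m\<le>n. a m) * (of_nat n powr (-s) - of_nat (Suc n) powr (-s) :: complex))"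
      using holomorphic_on_suminf_halfplane(2)[OF holo bound s] by (simp add: f_def)
    have "(\<lambda>N. C * real (Suc N) powr (- Re s)) \<longlonglongrightarrow> 0"
      using s by real_asymp
    thus "(\<lambda>N. (\<Sum>m\<le>N. a m) * of_nat (Suc N) powr (-s)) \<longlonglongrightarrow> 0"
      by (rule Lim_null_comparison[rotated])
         (use C in \<open>auto simp: norm_mult norm_nat_powr simp del: of_nat_Suc intro!: always_eventually mult_right_mono\<close>)
  qed
  show "\<And>s. Re s > 0 \<Longrightarrow> summable (\<lambda>n. a n * of_nat n powr (-s))"
    using sums by (auto simp: sums_iff)
  have "dirichlet_series a s = (\<Sum>n. f n s)" if "Re s > 0" for s
    using sums[OF that] by (simp add: dirichlet_series_def sums_iff)
  thus "dirichlet_series a holomorphic_on {s. Re s > 0}"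
    using holomorphic_on_suminf_halfplane(1)[OF holo bound] by (subst holomorphic_cong[OF refl]) auto
qed

text \<open>
  The terms \<open>n \<ge> 1\<close> of the series \<open>f\<close> below are \<open>(s-1) n^{-s}\<close> minus a telescoping approximation.
  Since \<open>0 powr z = 0\<close> for every \<open>z\<close>, the term \<open>n = 0\<close> is the constant 1 that balances the telescope.
\<close>
lemma zeta_times_s_minus_1_holomorphic:
  obtains Z where "Z holomorphic_on {s. Re s > 0}" "Z 1 = 1"
    "\<And>s. Re s > 1 \<Longrightarrow> Z s = (s - 1) * dirichlet_series (\<lambda>_. 1) s"
proof -
  define f where "f = (\<lambda>n s. (s - 1) * of_nat n powr (-s) - (of_nat n powr (1-s) - of_nat (Suc n) powr (1-s)) :: complex)"
  have holo: "f n holomorphic_on {s. Re s > 0}" for n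
  proof -
    have "(\<lambda>s. of_nat k powr (-s) :: complex) holomorphic_on A" 
         "(\<lambda>s. of_nat k powr (1-s) :: complex) holomorphic_on A" for k A
      by (cases "k = 0"; auto intro!: holomorphic_intros)+
    thus ?thesis unfolding f_def by (intro holomorphic_intros)
  qed
  have bound: "\<exists>h. summable h \<and> (\<forall>n s. Re s \<ge> y \<longrightarrow> norm s \<le> R \<longrightarrow> norm (f n s) \<le> h n)"
    if y: "y > 0" for y R
  proof (intro exI[of _ "\<lambda>n. if n = 0 then 1 else (R + 1) * R * real n powr (-y-1)"] conjI allI impI)
    have "summable (\<lambda>n. ((R + 1) * R) * real n powr (-y-1))"
      using summable_nat_powr_minus[of "y+1"] y by (intro summable_mult) simp
    thus "summable (\<lambda>n. if n = 0 then 1 else (R + 1) * R * real n powr (-y-1))"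
      by (rule summable_cong[THEN iffD1, rotated]) (rule eventually_mono[OF eventually_gt_at_top[of 0]], simp)
  next
    fix n s assume s: "Re s \<ge> y" "norm s \<le> R"
    show "norm (f n s) \<le> (if n = 0 then 1 else (R + 1) * R * real n powr (-y-1))"
    proof (cases "n = 0")
      case True thus ?thesis by (simp add: f_def)
    next
      case False
      have "norm (f n s) \<le> norm (s - 1) * norm s * real n powr (- 1 - Re s)"
        using norm_powr_diff_deriv_le[of n "s-1"] False s y by (simp add: f_def)
      also have "\<dots> \<le> (R + 1) * R * real n powr (-y-1)"
        using s False norm_triangle_ineq4[of s 1] norm_ge_zero[of s]
        by (intro mult_mono powr_mono mult_nonneg_nonneg) (auto simp del: norm_ge_zero)
      finally show ?thesis using False by simp
    qed
  qed
  show ?thesis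
  proof (rule that)
    show "(\<lambda>s. \<Sum>n. f n s) holomorphic_on {s. Re s > 0}"
      by (rule holomorphic_on_suminf_halfplane[OF holo bound])
    \<comment> \<open>At s = 1 the terms with n >= 1 cancel and the term n = 0 survives, since
      \<open>0 powr 0 = 0\<close>. Its value is the residue of zeta.\<close>
    have "f n 1 = (if n = 0 then 1 else 0)" for n
      by (simp add: f_def del: of_nat_Suc)
    thus "(\<Sum>n. f n 1) = 1" using sums_single[of 0 "\<lambda>_. 1 :: complex"] by (simp add: sums_iff)
  next
    fix s :: complex assume s: "Re s > 1"
    have "(\<lambda>n. of_nat n powr (1-s) :: complex) \<longlonglongrightarrow> 0"
    proof (rule Lim_null_comparison)
      show "(\<lambda>n. real n powr (1 - Re s)) \<longlonglongrightarrow> 0" using s by real_asymp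
    qed (auto simp: norm_nat_powr)
    hence "(\<lambda>n. of_nat n powr (1-s) - of_nat (Suc n) powr (1-s) :: complex) sums (of_nat 0 powr (1-s) - 0)"
      by (rule telescope_sums')
    moreover have "summable (\<lambda>n. of_nat n powr (-s) :: complex)"
      using dirichlet_series_holomorphic(2)[of 1 "\<lambda>_. 1" s] s summable_nat_powr_minus by simp
    hence "(\<lambda>n. of_nat n powr (-s) :: complex) sums dirichlet_series (\<lambda>_. 1) s"
      by (simp add: dirichlet_series_def summable_sums)
    hence "(\<lambda>n. (s - 1) * of_nat n powr (-s) :: complex) sums ((s - 1) * dirichlet_series (\<lambda>_. 1) s)"
      by (rule sums_mult)
    ultimately have "(\<lambda>n. f n s) sums ((s - 1) * dirichlet_series (\<lambda>_. 1) s - (of_nat 0 powr (1-s) - 0))"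
      unfolding f_def by (rule sums_diff[rotated])
    thus "(\<Sum>n. f n s) = (s - 1) * dirichlet_series (\<lambda>_. 1) s"
      by (simp add: sums_iff)
  qed
qed

lemma zeta_minus_pole_holomorphic:
  obtains R where "R holomorphic_on {s. Re s > 0}"
    "\<And>s. Re s > 1 \<Longrightarrow> dirichlet_series (\<lambda>_. 1) s = 1 / (s - 1) + R s"
proof -
  obtain Z where Z: "Z holomorphic_on {s. Re s > 0}" "Z 1 = 1"
    "\<And>s. Re s > 1 \<Longrightarrow> Z s = (s - 1) * dirichlet_series (\<lambda>_. 1) s"
    by (rule zeta_times_s_minus_1_holomorphic) blast
  show ?thesis
  proof (rule that)
    show "(\<lambda>s. if s = 1 then deriv Z 1 else (Z s - Z 1) / (s - 1)) holomorphic_on {s. Re s > 0}"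
      by (rule pole_lemma_open[OF Z(1) open_halfspace_Re_gt])
    fix s :: complex assume s: "Re s > 1"
    hence "s \<noteq> 1" by auto
    thus "dirichlet_series (\<lambda>_. 1) s = 1 / (s - 1) + (if s = 1 then deriv Z 1 else (Z s - Z 1) / (s - 1))"
      using Z(2) Z(3)[OF s] by (simp add: field_simps)
  qed
qed

text \<open>Full periods cancel, so only an incomplete last period contributes.\<close>

lemma norm_partial_sums_periodic_le:
  fixes a :: "nat \<Rightarrow> complex"
  assumes per: "\<And>n. a (n + p) = a n" and zero: "(\<Sum>m<p. a m) = 0" and "p > 0"
  shows "norm (\<Sum>m\<le>n. a m) \<le> (\<Sum>m<p. norm (a m))"
proof -
  have "norm (\<Sum>m<n. a m) \<le> (\<Sum>m<p. norm (a m))" for n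
  proof (induction n rule: less_induct)
    case (less n)
    show ?case
    proof (cases "n \<le> p")
      case True
      have "norm (\<Sum>m<n. a m) \<le> (\<Sum>m<n. norm (a m))" by (rule norm_sum)
      also have "\<dots> \<le> (\<Sum>m<p. norm (a m))" using True by (intro sum_mono2) auto
      finally show ?thesis .
    next
      case False
      have "(\<Sum>m<n. a m) = (\<Sum>m<p. a m) + (\<Sum>m=p..<p+(n-p). a m)"
        using False sum.atLeastLessThan_concat[of 0 p n a] by (simp add: lessThan_atLeast0)
      also have "(\<Sum>m=p..<p+(n-p). a m) = (\<Sum>m<n-p. a m)"
        using sum.shift_bounds_nat_ivl[of a 0 p "n-p"] per by (simp add: lessThan_atLeast0 add.commute)
      finally show ?thesis using less[of "n-p"] False \<open>p > 0\<close> zero by simp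
    qed
  qed
  from this[of "Suc n"] show ?thesis by (simp add: lessThan_Suc_atMost)
qed

text \<open>The pairs (d, m) are grouped by their product. This serves both for products of
  Dirichlet series and for turning a Lambert series into a power series.\<close>

lemma infsum_pairs_eq_divisor_sum:
  fixes f :: "nat \<Rightarrow> nat \<Rightarrow> 'a :: banach"
  assumes "(\<lambda>(d, m). f d m) summable_on ({0<..} \<times> {0<..})"
  shows "((\<lambda>n. \<Sum>d | d dvd n. f d (n div d)) has_sum (\<Sum>\<^sub>\<infinity>(d, m)\<in>{0<..} \<times> {0<..}. f d m)) {0<..}"
proof -
  let ?A = "{0<..} :: nat set"
  let ?B = "SIGMA n:?A. {d. d dvd n}"
  have bij: "bij_betw (\<lambda>(n, d). (d, n div d)) ?B (?A \<times> ?A)"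
    by (rule bij_betwI[of _ _ _ "\<lambda>(d, m). (d * m, d)"]) (auto intro: dvd_pos_nat elim!: dvdE)
  have "((\<lambda>(d, m). f d m) has_sum (\<Sum>\<^sub>\<infinity>(d, m)\<in>?A \<times> ?A. f d m)) (?A \<times> ?A)"
    using assms by (rule has_sum_infsum)
  hence *: "((\<lambda>x. (\<lambda>(d, m). f d m) ((\<lambda>(n, d). (d, n div d)) x)) has_sum (\<Sum>\<^sub>\<infinity>(d, m)\<in>?A \<times> ?A. f d m)) ?B"
    using has_sum_reindex_bij_betw[OF bij] by blast
  hence "((\<lambda>(n, d). f d (n div d)) has_sum (\<Sum>\<^sub>\<infinity>(d, m)\<in>?A \<times> ?A. f d m)) ?B"
    by (simp add: case_prod_unfold)
  thus ?thesis
    by (rule has_sum_SigmaD) (auto intro!: has_sum_finiteI finite_divisors_nat)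
qed

text \<open>The convolution is prescribed at positive n only: the index 0 contributes nothing to the
  series, and 0 has infinitely many divisors.\<close>

lemma dirichlet_series_mult:
  assumes "summable (\<lambda>n. norm (a n) * real n powr (- Re s))"
    and "summable (\<lambda>n. norm (b n) * real n powr (- Re s))"
    and "\<And>n. n > 0 \<Longrightarrow> c n = (\<Sum>d | d dvd n. a d * b (n div d))"
  shows "dirichlet_series a s * dirichlet_series b s = dirichlet_series c s"
proof -
  have nsum: "(\<lambda>n. norm (a n * of_nat n powr (-s))) summable_on {0<..}"
       and sum: "((\<lambda>n. a n * of_nat n powr (-s)) has_sum dirichlet_series a s) {0<..}"
    if "summable (\<lambda>n. norm (a n) * real n powr (- Re s))" for a
  proof -
    have *: "summable (\<lambda>n. norm (a n * of_nat n powr (-s)))"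
      by (rule abs_summable_dirichlet[OF that]) simp
    show "(\<lambda>n. norm (a n * of_nat n powr (-s))) summable_on {0<..}"
      by (rule summable_on_subset_banach[OF norm_summable_imp_summable_on[of "\<lambda>n. norm (a n * of_nat n powr (-s))"]])
         (use * in simp_all)
    have "((\<lambda>n. a n * of_nat n powr (-s)) has_sum dirichlet_series a s) UNIV"
      using norm_summable_imp_has_sum[OF *] summable_norm_cancel[OF *]
      by (simp add: dirichlet_series_def summable_sums)
    thus "((\<lambda>n. a n * of_nat n powr (-s)) has_sum dirichlet_series a s) {0<..}"
      by (rule has_sum_cong_neutral[THEN iffD1, rotated -1]) auto
  qed
  define f where "f = (\<lambda>d m. (a d * of_nat d powr (-s)) * (b m * of_nat m powr (-s)))"
  have abs: "(\<lambda>x. norm ((\<lambda>(d, m). f d m) x)) summable_on ({0<..} \<times> {0<..})"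
  proof (rule summable_on_SigmaI)
    fix d :: nat assume "d \<in> {0<..}"
    show "((\<lambda>m. norm ((\<lambda>(d, m). f d m) (d, m))) has_sum
        (norm (a d * of_nat d powr (-s)) * (\<Sum>\<^sub>\<infinity>m\<in>{0<..}. norm (b m * of_nat m powr (-s))))) {0<..}"
      using has_sum_cmult_right[OF has_sum_infsum[OF nsum[OF assms(2)]], of "norm (a d * of_nat d powr (-s))"]
      by (simp add: f_def norm_mult)
  next
    show "(\<lambda>d. norm (a d * of_nat d powr (-s)) * (\<Sum>\<^sub>\<infinity>m\<in>{0<..}. norm (b m * of_nat m powr (-s)))) summable_on {0<..}"
      by (rule summable_on_cmult_left[OF nsum[OF assms(1)]])
  qed auto
  hence fsum: "(\<lambda>(d, m). f d m) summable_on ({0<..} \<times> {0<..})"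
    by (rule abs_summable_summable)
  have "(\<Sum>\<^sub>\<infinity>(d, m)\<in>{0<..} \<times> {0<..}. f d m) = (\<Sum>\<^sub>\<infinity>d\<in>{0<..}. \<Sum>\<^sub>\<infinity>m\<in>{0<..}. f d m)"
    using infsum_Sigma'_banach[OF fsum] by simp
  also have "\<dots> = dirichlet_series a s * dirichlet_series b s"
    unfolding f_def infsum_cmult_right' infsum_cmult_left'
    using sum[OF assms(1)] sum[OF assms(2)] by (simp add: infsumI)
  finally have "(\<Sum>\<^sub>\<infinity>(d, m)\<in>{0<..} \<times> {0<..}. f d m) = dirichlet_series a s * dirichlet_series b s" .
  with infsum_pairs_eq_divisor_sum[OF fsum]
  have "((\<lambda>n. \<Sum>d | d dvd n. f d (n div d)) has_sum (dirichlet_series a s * dirichlet_series b s)) {0<..}"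
    by simp
  also have "?this \<longleftrightarrow> ((\<lambda>n. c n * of_nat n powr (-s)) has_sum (dirichlet_series a s * dirichlet_series b s)) UNIV"
  proof (rule has_sum_cong_neutral)
    fix n :: nat assume "n \<in> {0<..} \<inter> UNIV"
    hence n: "n > 0" by simp
    have "f d (n div d) = a d * b (n div d) * of_nat n powr (-s)" if "d dvd n" for d
    proof -
      have "(of_nat d * of_nat (n div d)) powr (-s) = of_nat d powr (-s) * (of_nat (n div d) powr (-s) :: complex)"
        by (rule powr_times_real) auto
      moreover have "of_nat d * of_nat (n div d) = (of_nat n :: complex)"
        using that by (metis dvd_mult_div_cancel of_nat_mult)
      ultimately show ?thesis by (simp add: f_def)
    qed
    thus "(\<Sum>d | d dvd n. f d (n div d)) = c n * of_nat n powr (-s)"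
      using assms(3)[OF n] by (simp add: sum_distrib_right)
  qed auto
  finally show ?thesis
    using has_sum_imp_sums by (force simp: dirichlet_series_def sums_iff)
qed

subsection \<open>Non-vanishing at 1 for real characters\<close>

text \<open>The n terms on the right have geometric mean y^(n-1). Used with sqrt y for y, it bounds
  1 + y + ... + y^(n-1) from below by n y^((n-1)/2), the estimate behind the monotonicity of the
  Lambert weights.\<close>

lemma geometric_sum_ge:
  fixes y :: real
  assumes "0 \<le> y" "y \<le> 1"
  shows "real n * y ^ (n - 1) \<le> (\<Sum>i<n. (y\<^sup>2) ^ i)"
proof -
  \<comment> \<open>The inequality of arithmetic and geometric means for 1 and n copies of
    y^(n+1).\<close>
  have aux: "1 + real n * y ^ Suc n \<ge> (real n + 1) * y ^ n" for n
  proof (induction n)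
    case (Suc n)
    have "0 \<le> (1 - y) * (1 - y ^ Suc n)"
      using assms by (intro mult_nonneg_nonneg) (auto intro: power_le_one simp del: power_Suc)
    moreover have "y * ((real n + 1) * y ^ n) \<le> y * (1 + real n * y ^ Suc n)"
      by (rule mult_left_mono[OF Suc.IH assms(1)])
    ultimately show ?case by (simp add: algebra_simps)
  qed auto
  show ?thesis
  proof (induction n)
    case (Suc n)
    show ?case
    proof (cases "n = 0")
      case False
      have "(real n + 1) * y ^ n \<le> 1 + real n * y ^ Suc n" by (rule aux)
      also have "\<dots> = 1 + y\<^sup>2 * (real n * y ^ (n - 1))"
        using False by (cases n) (simp_all add: power2_eq_square algebra_simps)
      also have "\<dots> \<le> 1 + y\<^sup>2 * (\<Sum>i<n. (y\<^sup>2) ^ i)"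
        using Suc.IH by (intro add_left_mono mult_left_mono) auto
      also have "\<dots> = (\<Sum>i<Suc n. (y\<^sup>2) ^ i)"
        unfolding sum.lessThan_Suc_shift by (simp add: sum_distrib_left)
      finally show ?thesis by (simp add: add.commute)
    qed simp
  qed simp
qed

text \<open>Abel's inequality: for decreasing nonnegative weights the total variation up to the last
  weight, plus that weight, is \<open>B 0\<close>.\<close>

lemma abs_sum_by_parts_le:
  fixes x B :: "nat \<Rightarrow> real"
  assumes C: "\<And>n. \<bar>\<Sum>m\<le>n. x m\<bar> \<le> C" and dec: "\<And>n. B (Suc n) \<le> B n" and nn: "\<And>n. B n \<ge> 0"
  shows "\<bar>\<Sum>n\<le>N. x n * B n\<bar> \<le> C * B 0"
proof -
  have "\<bar>\<Sum>n\<le>N. x n * B n\<bar> \<le> \<bar>(\<Sum>m\<le>N. x m) * B (Suc N)\<bar> + \<bar>\<Sum>n\<le>N. (\<Sum>m\<le>n. x m) * (B n - B (Suc n))\<bar>"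
    unfolding sum_by_parts[of x B N] by (rule abs_triangle_ineq)
  also have "\<dots> \<le> C * B (Suc N) + (\<Sum>n\<le>N. C * (B n - B (Suc n)))"
  proof (rule add_mono)
    show "\<bar>(\<Sum>m\<le>N. x m) * B (Suc N)\<bar> \<le> C * B (Suc N)"
      using C nn by (auto simp: abs_mult intro!: mult_right_mono)
    show "\<bar>\<Sum>n\<le>N. (\<Sum>m\<le>n. x m) * (B n - B (Suc n))\<bar> \<le> (\<Sum>n\<le>N. C * (B n - B (Suc n)))"
      by (rule order_trans[OF sum_abs sum_mono])
         (use C dec in \<open>auto simp: abs_mult intro!: mult_right_mono\<close>)
  qed
  also have "(\<Sum>n\<le>N. C * (B n - B (Suc n))) = C * (B 0 - B (Suc N))"
    using sum_telescope[of B N] by (simp flip: sum_distrib_left)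
  finally show ?thesis by (simp add: algebra_simps)
qed

text \<open>A divisor of q^(k+1) m is either q times a divisor of q^k m or, being coprime to q, a
  divisor of m. This is a geometric recursion in k.\<close>

lemma divisor_sum_prime_power_mult:
  fixes x :: "nat \<Rightarrow> real"
  assumes mult: "\<And>m n. x (m * n) = x m * x n"
  assumes q: "prime q" "\<not> q dvd m" "m > 0"
  shows "(\<Sum>d | d dvd q ^ k * m. x d) = (\<Sum>i\<le>k. x q ^ i) * (\<Sum>d | d dvd m. x d)"
proof (induction k)
  case (Suc k)
  have fin: "finite {d. d dvd q ^ k * m}" "finite {d. d dvd m}"
    using q by (auto intro!: finite_divisors_nat simp: prime_gt_0_nat)
  have eq: "{d. d dvd q ^ Suc k * m} = (*) q ` {d. d dvd q ^ k * m} \<union> {d. d dvd m}"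
  proof (intro equalityI subsetI)
    fix d assume d: "d \<in> {d. d dvd q ^ Suc k * m}"
    show "d \<in> (*) q ` {d. d dvd q ^ k * m} \<union> {d. d dvd m}"
    proof (cases "q dvd d")
      case True
      then obtain e where "d = q * e" by (elim dvdE)
      with d q(1) have "e dvd q ^ k * m" by (simp add: mult.assoc prime_gt_0_nat)
      thus ?thesis using \<open>d = q * e\<close> by auto
    next
      case False
      hence "coprime d (q ^ Suc k)"
        using q(1) prime_imp_coprime coprime_commute coprime_power_right_iff by blast
      thus ?thesis using d by (simp add: coprime_dvd_mult_right_iff del: power_Suc)
    qed
  qed (auto simp: mult.assoc)
  have "(\<Sum>d | d dvd q ^ Suc k * m. x d) = (\<Sum>d\<in>(*) q ` {d. d dvd q ^ k * m}. x d) + (\<Sum>d | d dvd m. x d)"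
    unfolding eq by (rule sum.union_disjoint) (use q fin in \<open>auto dest: dvd_mult_left\<close>)
  also have "(\<Sum>d\<in>(*) q ` {d. d dvd q ^ k * m}. x d) = x q * (\<Sum>d | d dvd q ^ k * m. x d)"
    using q(1) by (subst sum.reindex) (auto simp: inj_on_def mult sum_distrib_left prime_gt_0_nat)
  also have "x q * (\<Sum>d | d dvd q ^ k * m. x d) + (\<Sum>d | d dvd m. x d)
      = (\<Sum>i\<le>Suc k. x q ^ i) * (\<Sum>d | d dvd m. x d)"
  proof -
    have "(\<Sum>i\<le>Suc k. x q ^ i) = 1 + x q * (\<Sum>i\<le>k. x q ^ i)"
      unfolding sum.atMost_Suc_shift by (simp add: sum_distrib_left)
    thus ?thesis unfolding Suc.IH by (simp add: algebra_simps)
  qed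
  finally show ?case .
qed (use assms in auto)

text \<open>Prime powers are split off one at a time. The local factor 1 + x(q) + ... + x(q)^k is k
  + 1, 1, or alternately 1 and 0 with the parity of k; in a square all exponents are even, so no
  factor vanishes.\<close>

lemma divisor_sum_real_character:
  fixes x :: "nat \<Rightarrow> real"
  assumes mult: "\<And>m n. x (m * n) = x m * x n" and one: "x (Suc 0) = 1"
    and val: "\<And>n. x n \<in> {-1, 0, 1}"
  shows "n > 0 \<Longrightarrow> (\<Sum>d | d dvd n. x d) \<ge> 0"
    and "n > 0 \<Longrightarrow> (\<Sum>d | d dvd n\<^sup>2. x d) \<ge> 1"
proof -
  have minus: "(\<Sum>i\<le>k. (-1 :: real) ^ i) = (if even k then 1 else 0)" for k
    by (induction k) auto
  have geo: "(\<Sum>i\<le>k. x q ^ i) \<ge> (if even k then 1 else 0)" for q k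
    using val[of q] by (auto simp: minus power_0_left)
  have split: "\<exists>q k m. prime q \<and> \<not> q dvd m \<and> 0 < m \<and> m < n \<and> n = q ^ k * m" if "n > 1" for n :: nat
  proof -
    have "n \<noteq> 1" using that by simp
    then obtain q where q: "prime q" "q dvd n" using prime_factor_nat by blast
    have "n \<noteq> 0" "\<not> is_unit q" using that q by (auto dest: not_prime_unit)
    then obtain m where m: "n = q ^ multiplicity q n * m" "\<not> q dvd m"
      using multiplicity_decompose' by blast
    have k: "multiplicity q n > 0" using q that by (simp add: prime_multiplicity_gt_zero_iff)
    have "m > 0" using m that by (cases m) auto
    moreover have "q ^ multiplicity q n > 1" using k prime_gt_1_nat[OF q(1)] one_less_power by blast
    hence "1 * m < q ^ multiplicity q n * m" using \<open>m > 0\<close> by (rule mult_strict_right_mono)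
    hence "m < n" using m(1) by simp
    ultimately show ?thesis using q m by blast
  qed
  show "n > 0 \<Longrightarrow> (\<Sum>d | d dvd n. x d) \<ge> 0"
  proof (induction n rule: less_induct)
    case (less n)
    show ?case
    proof (cases "n > 1")
      case True
      then obtain q k m where *: "prime q" "\<not> q dvd m" "0 < m" "m < n" "n = q ^ k * m"
        using split by blast
      have "0 \<le> (\<Sum>i\<le>k. x q ^ i)" using geo[of k q] by (auto split: if_splits)
      with less.IH[of m] * show ?thesis
        using divisor_sum_prime_power_mult[of x q m k, OF mult] by simp
    next
      case False
      hence "n = 1" using less.prems by simp
      thus ?thesis using one by simp
    qed
  qed
  show "n > 0 \<Longrightarrow> (\<Sum>d | d dvd n\<^sup>2. x d) \<ge> 1"
  proof (induction n rule: less_induct)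
    case (less n)
    show ?case
    proof (cases "n > 1")
      case True
      then obtain q k m where *: "prime q" "\<not> q dvd m" "0 < m" "m < n" "n = q ^ k * m"
        using split by blast
      have "1 * 1 \<le> (\<Sum>i\<le>2*k. x q ^ i) * (\<Sum>d | d dvd m\<^sup>2. x d)"
        using geo[of "2*k" q] less.IH[of m] * by (intro mult_mono) auto
      also have "\<dots> = (\<Sum>d | d dvd q ^ (2*k) * m\<^sup>2. x d)"
        using * by (intro divisor_sum_prime_power_mult[symmetric] mult) (auto dest: prime_dvd_power)
      also have "q ^ (2*k) * m\<^sup>2 = n\<^sup>2" using * by (simp add: power_mult_distrib power_mult[symmetric] mult.commute)
      finally show ?thesis by simp
    next
      case False
      hence "n = 1" using less.prems by simp
      thus ?thesis using one by simp
    qed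
  qed
qed

text \<open>
  The Lambert series \<open>\<Sum>n x(n) y^n / (1 - y^n)\<close> has coefficients \<open>\<Sum>d|n x(d)\<close>,
  which are at least 1 at squares, so it is unbounded as \<open>y\<close> tends to 1. If \<open>\<Sum>n x(n)/n\<close>
  were 0, subtracting \<open>1/(1-y)\<close> times this sum would show by partial summation that it is bounded.
\<close>
lemma real_character_sum_nonzero:
  fixes x :: "nat \<Rightarrow> real"
  assumes mult: "\<And>m n. x (m * n) = x m * x n" and one: "x (Suc 0) = 1" and x0: "x 0 = 0"
    and val: "\<And>n. x n \<in> {-1, 0, 1}"
    and C: "\<And>n. \<bar>\<Sum>m\<le>n. x m\<bar> \<le> C"
  shows "\<not> (\<lambda>n. x n / real n) sums 0"
proof
  assume sums0: "(\<lambda>n. x n / real n) sums 0"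
  define R where "R = (\<lambda>n. \<Sum>d | d dvd n. x d)"
  have abs_x: "\<bar>x n\<bar> \<le> 1" for n using val[of n] by auto
  \<comment> \<open>The bound is uniform in y, while the left side tends to M as y tends to
    1.\<close>
  have main: "(\<Sum>m=1..M. y ^ m\<^sup>2) \<le> C" if y: "0 < y" "y < 1" for y :: real and M :: nat
  proof -
    define f where "f = (\<lambda>d m. x d * y ^ (d * m))"
    have geo: "((\<lambda>m. y ^ (d * m)) has_sum (y ^ d / (1 - y ^ d))) {0<..}" if "d > 0" for d
    proof -
      have yd: "y ^ d < 1" "0 < y ^ d" using y that by (auto simp: power_less_one_iff)
      have "(\<lambda>m. (y ^ d) ^ m) sums (1 / (1 - y ^ d))" using yd by (intro geometric_sums) auto
      hence "(\<lambda>m. (y ^ d) ^ Suc m) sums (1 / (1 - y ^ d) - (y ^ d) ^ 0)"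
        by (subst sums_Suc_iff) simp
      also have "1 / (1 - y ^ d) - (y ^ d) ^ 0 = y ^ d / (1 - y ^ d)" using yd by (simp add: field_simps)
      finally have "((\<lambda>m. (y ^ d) ^ Suc m) has_sum (y ^ d / (1 - y ^ d))) UNIV"
        using yd y by (intro sums_nonneg_imp_has_sum) auto
      also have "?this \<longleftrightarrow> ((\<lambda>m. (y ^ d) ^ m) has_sum (y ^ d / (1 - y ^ d))) {0<..}"
        by (rule has_sum_reindex_bij_betw[of Suc UNIV "{0<..}" "\<lambda>m. (y ^ d) ^ m"])
           (auto simp: bij_betw_def gr0_conv_Suc)
      finally show ?thesis by (simp add: power_mult)
    qed
    have "(\<lambda>z. norm ((\<lambda>(d, m). f d m) z)) summable_on ({0<..} \<times> {0<..})"
    proof (rule summable_on_SigmaI)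
      fix d :: nat assume "d \<in> {0<..}"
      thus "((\<lambda>m. norm ((\<lambda>(d, m). f d m) (d, m))) has_sum (\<bar>x d\<bar> * (y ^ d / (1 - y ^ d)))) {0<..}"
        using has_sum_cmult_right[OF geo[of d], of "\<bar>x d\<bar>"] y by (simp add: f_def abs_mult)
    next
      have "summable (\<lambda>d. y ^ d / (1 - y))" using y by (intro summable_divide summable_geometric) auto
      hence "(\<lambda>d. y ^ d / (1 - y)) summable_on UNIV"
        using y by (intro summable_nonneg_imp_summable_on) auto
      hence *: "(\<lambda>d. y ^ d / (1 - y)) summable_on {0<..}"
        by (rule summable_on_subset_banach) auto
      have "\<bar>x d\<bar> * (y ^ d / (1 - y ^ d)) \<le> y ^ d / (1 - y)" if "d > 0" for d
      proof -
        have "y ^ d \<le> y" using power_decreasing[of 1 d y] y that by simp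
        hence "\<bar>x d\<bar> * (y ^ d / (1 - y ^ d)) \<le> 1 * (y ^ d / (1 - y))"
          using abs_x[of d] y by (intro mult_mono divide_left_mono mult_pos_pos) auto
        thus ?thesis by simp
      qed
      thus "(\<lambda>d. \<bar>x d\<bar> * (y ^ d / (1 - y ^ d))) summable_on {0<..}"
        using y by (intro summable_on_comparison_test[OF *]) (auto simp: power_le_one)
    qed auto
    hence fsum: "(\<lambda>(d, m). f d m) summable_on ({0<..} \<times> {0<..})"
      by (rule abs_summable_summable)
    define T where "T = (\<Sum>\<^sub>\<infinity>(d, m)\<in>{0<..} \<times> {0<..}. f d m)"
    have "((\<lambda>n. \<Sum>d | d dvd n. f d (n div d)) has_sum T) {0<..}"
      unfolding T_def by (rule infsum_pairs_eq_divisor_sum[OF fsum])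
    also have "?this \<longleftrightarrow> ((\<lambda>n. R n * y ^ n) has_sum T) {0<..}"
      by (rule has_sum_cong) (auto simp: f_def R_def sum_distrib_right intro!: sum.cong)
    finally have T1: "((\<lambda>n. R n * y ^ n) has_sum T) {0<..}" .
    have "((\<lambda>(d, m). f d m) has_sum T) ({0<..} \<times> {0<..})"
      unfolding T_def using fsum by (rule has_sum_infsum)
    hence "((\<lambda>d. x d * (y ^ d / (1 - y ^ d))) has_sum T) {0<..}"
    proof (rule has_sum_SigmaD)
      fix d :: nat assume "d \<in> {0<..}"
      thus "((\<lambda>m. (\<lambda>(d, m). f d m) (d, m)) has_sum (x d * (y ^ d / (1 - y ^ d)))) {0<..}"
        using has_sum_cmult_right[OF geo[of d], of "x d"] by (simp add: f_def)
    qed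
    also have "?this \<longleftrightarrow> ((\<lambda>d. x d * (y ^ d / (1 - y ^ d))) has_sum T) UNIV"
      by (rule has_sum_cong_neutral) auto
    finally have T2: "(\<lambda>d. x d * (y ^ d / (1 - y ^ d))) sums T"
      by (rule has_sum_imp_sums)
    \<comment> \<open>The value at 0 is free because \<open>x 0 = 0\<close>. It is set to 1, which
      is also \<open>B 1\<close>, so that the sequence decreases from index 0 on and Abel's
      inequality gives exactly C.\<close>
    define B where "B = (\<lambda>n. if n = 0 then 1 else 1 / (1 - y) / real n - y ^ n / (1 - y ^ n))"
    \<comment> \<open>Writing 1 - y^n = (1 - y) S(n) isolates the singular factor. For n >= 1 the
      decrease of B becomes n (n+1) y^n <= S(n) S(n+1), and its nonnegativity becomes n y^n <=
      S(n).\<close>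
    define S where "S = (\<lambda>n. \<Sum>i<n. y ^ i)"
    have S: "1 - y ^ n = (1 - y) * S n" for n
      unfolding S_def by (rule one_diff_power_eq)
    have S_pos: "S n > 0" if "n > 0" for n
      unfolding S_def using that y by (intro sum_pos) auto
    have B_eq: "(1 - y) * B n = 1 / real n - y ^ n / S n" if "n > 0" for n
    proof -
      have "1 - y \<noteq> 0" using y by simp
      thus ?thesis using that unfolding B_def S by (simp add: right_diff_distrib)
    qed
    have "(\<lambda>N. \<Sum>n\<le>N. (1 / (1 - y)) * (x n / real n) - x n * (y ^ n / (1 - y ^ n))) \<longlonglongrightarrow> (1 / (1 - y)) * 0 - T"
      using sums_diff[OF sums_mult[OF sums0, of "1 / (1 - y)"] T2] by (simp add: sums_def_le)
    moreover have "(1 / (1 - y)) * (x n / real n) - x n * (y ^ n / (1 - y ^ n)) = x n * B n" for n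
      using x0 by (simp add: B_def algebra_simps)
    ultimately have lim: "(\<lambda>N. \<bar>\<Sum>n\<le>N. x n * B n\<bar>) \<longlonglongrightarrow> \<bar>- T\<bar>"
      by (intro tendsto_rabs) simp
    have S_ge: "real n * sqrt y ^ (n - 1) \<le> S n" for n
      using geometric_sum_ge[of "sqrt y" n] y by (simp add: S_def)
    have dec: "B (Suc n) \<le> B n" for n
    proof (cases "n = 0")
      case True
      have "y / (1 - y) = 1 / (1 - y) - 1" using y by (simp add: field_simps)
      thus ?thesis using True y by (simp add: B_def)
    next
      case False
      have "real n * real (Suc n) * y ^ n \<le> S n * S (Suc n)"
      proof -
        have "real n * real (Suc n) * y ^ n = real n * real (Suc n) * sqrt y ^ (2 * n)"
          using y by (simp add: power_mult)
        also have "\<dots> \<le> real n * real (Suc n) * sqrt y ^ ((n - 1) + n)"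
          using y by (intro mult_left_mono power_decreasing) auto
        also have "\<dots> = (real n * sqrt y ^ (n - 1)) * (real (Suc n) * sqrt y ^ (Suc n - 1))"
          by (simp add: power_add)
        also have "\<dots> \<le> S n * S (Suc n)"
          using y S_pos[of n] False by (intro mult_mono S_ge) auto
        finally show ?thesis .
      qed
      hence "y ^ n / (S n * S (Suc n)) \<le> 1 / (real n * real (Suc n))"
        using S_pos[of n] S_pos[of "Suc n"] False by (simp add: field_simps del: of_nat_Suc)
      also have "\<dots> = 1 / real n - 1 / real (Suc n)" using False by (simp add: field_simps)
      also have "y ^ n / (S n * S (Suc n)) = y ^ n / S n - y ^ Suc n / S (Suc n)"
      proof -
        have "S (Suc n) - y * S n = 1"
          unfolding S_def sum.lessThan_Suc_shift by (simp add: sum_distrib_left)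
        moreover have "y ^ n * S (Suc n) - y ^ Suc n * S n = y ^ n * (S (Suc n) - y * S n)"
          by (simp add: algebra_simps)
        ultimately have "y ^ n * S (Suc n) - y ^ Suc n * S n = y ^ n" by simp
        thus ?thesis using S_pos[of n] S_pos[of "Suc n"] False
          by (simp add: field_simps del: power_Suc)
      qed
      finally have "(1 - y) * B (Suc n) \<le> (1 - y) * B n"
        using False by (simp add: B_eq del: of_nat_Suc power_Suc)
      thus ?thesis using y by simp
    qed
    have nn: "B n \<ge> 0" for n
    proof (cases "n = 0")
      case False
      have "real n * y ^ n = (\<Sum>i<n. y ^ n)" by simp
      also have "\<dots> \<le> S n" unfolding S_def using y by (intro sum_mono power_decreasing) auto
      finally have "0 \<le> 1 / real n - y ^ n / S n"
        using S_pos[of n] False by (simp add: field_simps)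
      hence "0 \<le> (1 - y) * B n" using B_eq[of n] False by simp
      thus ?thesis using y by (simp add: zero_le_mult_iff)
    qed (auto simp: B_def)
    have "\<bar>- T\<bar> \<le> C * B 0"
      by (rule LIMSEQ_le_const2[OF lim]) (use abs_sum_by_parts_le[of x C B, OF C dec nn] in auto)
    hence "T \<le> C" by (simp add: B_def)
    \<comment> \<open>Only square indices are kept: their coefficients are at least 1, and the
      discarded ones are nonnegative.\<close>
    have "(\<Sum>m=1..M. y ^ m\<^sup>2) \<le> (\<Sum>m=1..M. R (m\<^sup>2) * y ^ m\<^sup>2)"
      using divisor_sum_real_character(2)[OF mult one val] y
      by (intro sum_mono) (auto simp: R_def)
    also have "\<dots> = (\<Sum>n\<in>(\<lambda>m. m\<^sup>2) ` {1..M}. R n * y ^ n)"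
      by (subst sum.reindex) (auto simp: inj_on_def)
    also have "\<dots> \<le> T"
      by (rule finite_sum_le_has_sum[OF T1])
         (use divisor_sum_real_character(1)[OF mult one val] y in \<open>auto simp: R_def\<close>)
    finally show ?thesis using \<open>T \<le> C\<close> by simp
  qed
  have "real M \<le> C" for M
  proof -
    have "((\<lambda>y::real. \<Sum>m=1..M. y ^ m\<^sup>2) \<longlongrightarrow> (\<Sum>m=1..M. 1 ^ m\<^sup>2)) (at_left 1)"
      by (intro tendsto_intros)
    moreover have "eventually (\<lambda>y::real. (\<Sum>m=1..M. y ^ m\<^sup>2) \<le> C) (at_left 1)"
      by (rule eventually_mono[OF eventually_at_left_real[of 0 1]]) (use main in auto)
    ultimately have "(\<Sum>m=1..M. 1 ^ m\<^sup>2) \<le> C" by (rule tendsto_upperbound) auto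
    thus ?thesis by simp
  qed
  from this[of "nat \<lceil>C\<rceil> + 1"] show False by linarith
qed

section \<open>Orders of zeros by logarithmic derivatives\<close>

lemma dirichlet_series_3_nonzero:
  assumes "a 1 = 1" "\<And>n. norm (a n) \<le> 1"
  shows "dirichlet_series a 3 \<noteq> 0"
proof -
  define b where "b = (\<lambda>n. a n * of_nat n powr (-3 :: complex))"
  have nb: "norm (b n) \<le> real n powr (-3)" for n
    using mult_right_mono[OF assms(2)[of n], of "real n powr (-3)"]
    by (simp add: b_def norm_mult norm_nat_powr)
  have b: "summable b"
    by (rule summable_norm_cancel, rule summable_comparison_test'[OF summable_nat_powr_minus[of 3], of 0])
       (use nb in auto)
  \<comment> \<open>A telescoping majorant 1 / (2 (n+1) (n+2)) for the tail from index 2 on. Its sum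
    1/2 is too small to cancel the first term 1.\<close>
  define t where "t = (\<lambda>n. 1/2 * (1 / (real n + 1) - 1 / (real (Suc n) + 1)))"
  have "(\<lambda>n. 1 / (real n + 1)) \<longlonglongrightarrow> 0" by real_asymp
  hence t: "t sums (1/2 * (1 / (real 0 + 1) - 0))"
    unfolding t_def by (intro sums_mult telescope_sums')
  have le: "norm (b (n + 2)) \<le> t n" for n
  proof -
    have "norm (b (n + 2)) \<le> 1 / real (n + 2) ^ 3"
      using nb[of "n+2"] by (simp add: powr_minus divide_inverse)
    also have "\<dots> \<le> 1 / (2 * (real n + 1) * (real n + 2))"
    proof (rule divide_left_mono)
      have "(2 * (real n + 1)) * (real n + 2) \<le> ((real n + 2) * (real n + 2)) * (real n + 2)"
        by (rule mult_right_mono) (simp_all add: algebra_simps)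
      thus "2 * (real n + 1) * (real n + 2) \<le> real (n + 2) ^ 3"
        by (simp add: power3_eq_cube add.commute)
    qed (auto intro!: mult_pos_pos)
    also have "\<dots> = t n" by (simp add: t_def field_simps)
    finally show ?thesis .
  qed
  have sn: "summable (\<lambda>n. norm (b (n + 2)))"
    by (rule summable_comparison_test'[OF sums_summable[OF t], of 0]) (use le in auto)
  have "dirichlet_series a 3 = (\<Sum>n. b (n + 2)) + (b 0 + b 1)"
    using suminf_split_initial_segment[OF b, of 2]
    by (simp add: dirichlet_series_def b_def numeral_2_eq_2)
  also have "b 0 + b 1 = 1" using assms(1) by (simp add: b_def)
  finally have eq: "dirichlet_series a 3 = (\<Sum>n. b (n + 2)) + 1" .
  have "norm (\<Sum>n. b (n + 2)) \<le> (\<Sum>n. norm (b (n + 2)))" by (rule summable_norm[OF sn])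
  also have "\<dots> \<le> suminf t" by (rule suminf_le[OF le sn sums_summable[OF t]])
  also have "\<dots> = 1/2" using t by (simp add: sums_iff)
  finally have "norm (\<Sum>n. b (n + 2)) \<le> 1/2" .
  thus ?thesis using norm_triangle_ineq2[of 1 "- (\<Sum>n. b (n + 2))"] unfolding eq
    by (auto simp: add_eq_0_iff2)
qed

text \<open>Factor f as g(w) (w - z)^m with g(z) nonzero; the logarithmic derivative then has
  residue m at z. The order is delivered as a limit so that the positivity of a series can be
  applied to it.\<close>

lemma logderiv_tendsto_order:
  fixes f :: "complex \<Rightarrow> complex"
  assumes "f holomorphic_on S" "open S" "connected S" "z \<in> S" "\<exists>w\<in>S. f w \<noteq> 0"
  obtains m :: nat where "m = 0 \<longleftrightarrow> f z \<noteq> 0"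
    "((\<lambda>w. (w - z) * (deriv f w / f w)) \<longlongrightarrow> of_nat m) (at z)"
    "eventually (\<lambda>w. f w \<noteq> 0) (at z)"
proof -
  define m where "m = nat (zorder f z)"
  define g where "g = zor_poly f z"
  note * = zorder_exist_zero[OF assms, folded g_def m_def]
  have z: "if f z = 0 then zorder f z > 0 else zorder f z = 0" using * by (rule conjunct1)
  obtain r where r: "r > 0" "cball z r \<subseteq> S" "g holomorphic_on cball z r"
    and fg: "\<And>w. w \<in> cball z r \<Longrightarrow> f w = g w * (w - z) ^ m \<and> g w \<noteq> 0"
    using conjunct2[OF *] by (elim exE conjE) blast
  have g: "g holomorphic_on ball z r" using r(3) by (rule holomorphic_on_subset) auto
  have ev: "eventually (\<lambda>w. w \<in> ball z r - {z}) (at z)"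
    using eventually_at_ball'[of r z UNIV] r(1) by auto
  have "isCont g z" "isCont (deriv g) z"
    using g holomorphic_deriv[OF g open_ball] r(1)
    by (auto intro!: continuous_on_interior[of "ball z r"] holomorphic_on_imp_continuous_on simp: interior_open)
  hence "((\<lambda>w. (w - z) * (deriv g w / g w) + of_nat m) \<longlongrightarrow> (z - z) * (deriv g z / g z) + of_nat m) (at z)"
    using fg[of z] r(1) by (intro tendsto_intros) (auto simp: isCont_def)
  moreover have "eventually (\<lambda>w. (w - z) * (deriv g w / g w) + of_nat m = (w - z) * (deriv f w / f w)) (at z)"
    using ev
  proof eventually_elim
    case (elim w)
    have "(g has_field_derivative deriv g w) (at w)"
      using g elim by (intro holomorphic_derivI[of _ "ball z r"]) auto
    hence "((\<lambda>w. g w * (w - z) ^ m) has_field_derivative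
        (deriv g w * (w - z) ^ m + of_nat m * (w - z) ^ (m - 1) * g w)) (at w)"
      by (auto intro!: derivative_eq_intros simp: mult_ac)
    hence "(f has_field_derivative (deriv g w * (w - z) ^ m + of_nat m * (w - z) ^ (m - 1) * g w)) (at w)"
      by (rule has_field_derivative_transform_within_open[where S = "ball z r"]) (use fg elim in auto)
    hence 1: "deriv f w = deriv g w * (w - z) ^ m + of_nat m * (w - z) ^ (m - 1) * g w"
      by (rule DERIV_imp_deriv)
    have 2: "f w = g w * (w - z) ^ m" "g w \<noteq> 0" "w \<noteq> z" using fg[of w] elim by auto
    have "w - z \<noteq> 0" using 2(3) by simp
    thus ?case using 2(2) unfolding 1 2(1)
      by (cases m) (simp_all add: add_divide_distrib distrib_left)
  qed
  ultimately have lim: "((\<lambda>w. (w - z) * (deriv f w / f w)) \<longlongrightarrow> of_nat m) (at z)"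
    by (auto elim: Lim_transform_eventually)
  have nz: "eventually (\<lambda>w. f w \<noteq> 0) (at z)"
    using ev by eventually_elim (use fg in auto)
  have "m = 0 \<longleftrightarrow> f z \<noteq> 0" using z by (auto simp: m_def split: if_splits)
  thus ?thesis by (rule that[OF _ lim nz])
qed

subsection \<open>Dirichlet characters modulo a prime\<close>

text \<open>Only modulus 1 is demanded on units; together with multiplicativity this already forces
  the value 1 at 1.\<close>

locale dchar =
  fixes p :: nat and chi :: "nat \<Rightarrow> complex"
  assumes prime: "prime p"
    and mult: "\<And>m n. chi (m * n) = chi m * chi n"
    and periodic: "\<And>n. chi (n + p) = chi n"
    and zero: "\<And>n. p dvd n \<Longrightarrow> chi n = 0"
    and norm_unit: "\<And>n. \<not> p dvd n \<Longrightarrow> norm (chi n) = 1"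
begin

definition principal :: bool where
  "principal \<longleftrightarrow> (\<forall>n. \<not> p dvd n \<longrightarrow> chi n = 1)"

lemma p_gt_1: "p > 1" using prime by (rule prime_gt_1_nat)

lemma one [simp]: "chi (Suc 0) = 1"
proof -
  have "norm (chi (Suc 0)) = 1" using p_gt_1 by (intro norm_unit) auto
  moreover have "chi (Suc 0) = chi (Suc 0) * chi (Suc 0)" using mult[of 1 1] by simp
  ultimately show ?thesis by (cases "chi (Suc 0) = 0") auto
qed

lemma norm_le_1: "norm (chi n) \<le> 1"
  using zero[of n] norm_unit[of n] by (cases "p dvd n") auto

lemma mod_p: "chi (n mod p) = chi n"
proof -
  have "chi (m + k * p) = chi m" for m k
    by (induction k) (use periodic in \<open>auto simp: algebra_simps\<close>, metis add.assoc add.commute periodic)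
  from this[of "n mod p" "n div p"] show ?thesis by simp
qed

text \<open>Multiplication by a unit a permutes the residues and multiplies the sum by
  \<open>chi a\<close>, which can be chosen different from 1.\<close>

lemma sum_period_nonprincipal:
  assumes "\<not> principal" shows "(\<Sum>m<p. chi m) = 0"
proof -
  obtain a where a: "\<not> p dvd a" "chi a \<noteq> 1" using assms by (auto simp: principal_def)
  have cop: "coprime a p" using a(1) prime prime_imp_coprime coprime_commute by blast
  have inj: "inj_on (\<lambda>m. a * m mod p) {..<p}"
  proof (rule inj_onI)
    fix x y assume xy: "x \<in> {..<p}" "y \<in> {..<p}" "a * x mod p = a * y mod p"
    hence "[a * x = a * y] (mod p)" by (simp add: Cong.cong_def)
    hence "[x = y] (mod p)" using cop by (simp add: cong_mult_lcancel_nat)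
    thus "x = y" using xy by (simp add: Cong.cong_def)
  qed
  have "(\<lambda>m. a * m mod p) ` {..<p} = {..<p}"
    by (rule endo_inj_surj[OF _ _ inj]) (use p_gt_1 in auto)
  hence "(\<Sum>m<p. chi m) = (\<Sum>m<p. chi (a * m mod p))"
    using sum.reindex[OF inj, of chi] by simp
  also have "\<dots> = chi a * (\<Sum>m<p. chi m)"
    by (simp add: mod_p mult sum_distrib_left)
  finally show ?thesis using a(2) by (simp add: mult_cancel_right1)
qed

text \<open>Subtracting the mean value 1 - 1/p leaves a sequence with bounded partial sums, so that
  the pole of L comes from a multiple of zeta alone.\<close>

lemma sum_period_principal:
  assumes principal shows "(\<Sum>m<p. chi m - of_real (1 - 1 / real p)) = 0"
proof -
  have "(\<Sum>m<p. chi m) = (\<Sum>m\<in>{0<..<p}. chi m)"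
    using p_gt_1 zero[of 0] by (intro sum.mono_neutral_right) auto
  also have "\<dots> = (\<Sum>m\<in>{0<..<p}. 1)"
    using assms by (intro sum.cong refl) (auto simp: principal_def nat_dvd_not_less)
  finally have sum: "(\<Sum>m<p. chi m) = of_nat (p - 1)" by simp
  show ?thesis using p_gt_1 unfolding sum_subtractf sum by (simp add: field_simps of_nat_diff)
qed

lemma abs_summable: "x > 1 \<Longrightarrow> summable (\<lambda>n. norm (chi n) * real n powr (-x))"
  by (rule summable_comparison_test'[OF summable_nat_powr_minus, of x 0])
     (use norm_le_1 in \<open>auto simp: abs_mult intro!: mult_left_le_one_le\<close>)

abbreviation L :: "complex \<Rightarrow> complex" where "L \<equiv> dirichlet_series chi"

lemma L_nonprincipal_holomorphic:
  assumes "\<not> principal"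
  shows "L holomorphic_on {s. Re s > 0}"
    and "\<And>s. Re s > 0 \<Longrightarrow> summable (\<lambda>n. chi n * of_nat n powr (-s))"
  using dirichlet_series_bounded_partial_sums[of chi, OF norm_partial_sums_periodic_le]
    periodic sum_period_nonprincipal[OF assms] p_gt_1 by auto

text \<open>The order of the pole of the L-series at 1.\<close>
definition order1 :: nat where "order1 = (if principal then 1 else 0)"

text \<open>A principal character is its mean value c plus a periodic sequence of mean 0, so L is c
  times zeta plus a function holomorphic in Re s > 0. The extension takes at 1 the value c, the
  residue of L.\<close>

lemma L_extension_exists:
  "\<exists>F. F holomorphic_on {s. Re s > 0} \<and> (\<forall>s. Re s > 1 \<longrightarrow> F s = (s - 1) ^ order1 * L s) \<and>
       (principal \<longrightarrow> F 1 \<noteq> 0) \<and> (\<not> principal \<longrightarrow> F = L)"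
proof (cases principal)
  case False
  thus ?thesis using L_nonprincipal_holomorphic(1) by (intro exI[of _ L]) (auto simp: order1_def)
next
  case True
  define c where "c = complex_of_real (1 - 1 / real p)"
  define D where "D = dirichlet_series (\<lambda>n. chi n - c)"
  obtain Z where Z: "Z holomorphic_on {s. Re s > 0}" "Z 1 = 1"
    "\<And>s. Re s > 1 \<Longrightarrow> Z s = (s - 1) * dirichlet_series (\<lambda>_. 1) s"
    by (rule zeta_times_s_minus_1_holomorphic) blast
  have D: "D holomorphic_on {s. Re s > 0}" unfolding D_def
    by (rule dirichlet_series_bounded_partial_sums[OF norm_partial_sums_periodic_le[of _ p]])
       (use periodic sum_period_principal[OF True] p_gt_1 in \<open>auto simp: c_def\<close>)
  have eq: "c * dirichlet_series (\<lambda>_. 1) s + D s = L s" if s: "Re s > 1" for s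
  proof -
    have 1: "summable (\<lambda>n. of_nat n powr (-s) :: complex)"
      using dirichlet_series_holomorphic(2)[of 1 "\<lambda>_. 1" s] s summable_nat_powr_minus by simp
    have 2: "summable (\<lambda>n. chi n * of_nat n powr (-s) :: complex)"
      using dirichlet_series_holomorphic(2)[of 1 chi s] s abs_summable by simp
    have "D s = L s - c * dirichlet_series (\<lambda>_. 1) s"
      using suminf_diff[OF 2 summable_mult[OF 1, of c]] suminf_mult[OF 1, of c]
      by (simp add: D_def dirichlet_series_def ring_distribs)
    thus ?thesis by simp
  qed
  show ?thesis
  proof (intro exI[of _ "\<lambda>s. c * Z s + (s - 1) * D s"] conjI allI impI)
    show "(\<lambda>s. c * Z s + (s - 1) * D s) holomorphic_on {s. Re s > 0}"
      by (intro holomorphic_intros Z D)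
    show "c * Z 1 + (1 - 1) * D 1 \<noteq> 0"
      using p_gt_1 Z(2) by (simp add: c_def complex_eq_iff)
  next
    fix s :: complex assume s: "Re s > 1"
    show "c * Z s + (s - 1) * D s = (s - 1) ^ order1 * L s"
      unfolding eq[OF s, symmetric] Z(3)[OF s] using True by (simp add: order1_def algebra_simps)
  qed (use True in auto)
qed

text \<open>An extension of \<open>(s-1)^order1 L(s)\<close> to \<open>Re s > 0\<close>, where \<open>L\<close> itself may be a junk \<open>suminf\<close>.\<close>
definition F :: "complex \<Rightarrow> complex" where
  "F = (SOME F. F holomorphic_on {s. Re s > 0} \<and> (\<forall>s. Re s > 1 \<longrightarrow> F s = (s - 1) ^ order1 * L s) \<and>
       (principal \<longrightarrow> F 1 \<noteq> 0) \<and> (\<not> principal \<longrightarrow> F = L))"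

lemma F_holomorphic: "F holomorphic_on {s. Re s > 0}"
  and F_eq: "Re s > 1 \<Longrightarrow> F s = (s - 1) ^ order1 * L s"
  and F_1: "principal \<Longrightarrow> F 1 \<noteq> 0"
  and F_eq_L: "\<not> principal \<Longrightarrow> F = L"
  using someI_ex[OF L_extension_exists] unfolding F_def[symmetric] by auto

abbreviation P :: "complex \<Rightarrow> complex" where "P \<equiv> dirichlet_series (\<lambda>n. chi n * mangoldt n)"

lemma abs_summable_mangoldt:
  assumes "x > 1" shows "summable (\<lambda>n. norm (chi n * mangoldt n) * real n powr (-x))"
proof (rule summable_comparison_test_ev)
  define e where "e = (x - 1) / 2"
  have e: "e > 0" "x - e > 1" using assms by (auto simp: e_def field_simps)
  show "summable (\<lambda>n. real n powr (-(x - e)))" by (rule summable_nat_powr_minus) fact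
  have "\<forall>\<^sub>F n in sequentially. ln (real n) \<le> real n powr e"
    using e(1) by real_asymp
  thus "\<forall>\<^sub>F n in sequentially. norm (norm (chi n * mangoldt n) * real n powr (-x)) \<le> real n powr (-(x - e))"
    using eventually_gt_at_top[of 0]
  proof eventually_elim
    case (elim n)
    have "norm (chi n * mangoldt n) * real n powr (-x) \<le> (1 * ln (real n)) * real n powr (-x)"
      using norm_le_1[of n] mangoldt_le[of n] elim unfolding norm_mult
      by (intro mult_mono mult_right_mono) (auto simp: mangoldt_nonneg)
    also have "\<dots> \<le> real n powr e * real n powr (-x)"
      using elim by (intro mult_right_mono) auto
    also have "\<dots> = real n powr (-(x - e))"
      by (simp flip: powr_add)
    finally show ?case by simp
  qed
qed

text \<open>The divisor sum of the Mangoldt function is ln n. Complete multiplicativity pulls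
  \<open>chi n\<close> out of the twisted divisor sum, so the derivative series of L is a Dirichlet
  product.\<close>

lemma deriv_L:
  assumes s: "Re s > 1"
  shows "(L has_field_derivative - (P s * L s)) (at s)"
proof -
  have "P s * L s = dirichlet_series (\<lambda>n. chi n * ln (real n)) s"
  proof (rule dirichlet_series_mult)
    fix n :: nat assume n: "n > 0"
    have "(\<Sum>d | d dvd n. chi d * mangoldt d * chi (n div d)) = (\<Sum>d | d dvd n. chi n * mangoldt d)"
    proof (intro sum.cong refl)
      fix d assume "d \<in> {d. d dvd n}"
      hence "chi n = chi d * chi (n div d)" by (simp flip: mult)
      thus "chi d * mangoldt d * chi (n div d) = chi n * mangoldt d" by simp
    qed
    also have "\<dots> = chi n * ln (real n)"
      using mangoldt_sum[of n, where ?'a = complex] n by (simp flip: sum_distrib_left)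
    finally show "chi n * ln (real n) = (\<Sum>d | d dvd n. chi d * mangoldt d * chi (n div d))" ..
  qed (use abs_summable abs_summable_mangoldt s in auto)
  thus ?thesis using dirichlet_series_holomorphic(3)[of 1 chi s, OF abs_summable] s by simp
qed

lemma P_holomorphic: "P holomorphic_on {s. Re s > 1}"
  by (rule dirichlet_series_holomorphic) (rule abs_summable_mangoldt)

text \<open>At a zero of order m, (w - z) L'/L would tend to m. But L'/L = - P at the points w near
  z, and P is continuous at z, so the limit is 0.\<close>

lemma L_nonzero:
  assumes z: "Re z > 1" shows "L z \<noteq> 0"
proof -
  have op: "open {s. Re s > 1}" by (rule open_halfspace_Re_gt)
  have "L holomorphic_on {s. Re s > 1}"
    by (rule dirichlet_series_holomorphic) (rule abs_summable)
  \<comment> \<open>The value at 3 shows that L does not vanish identically, so the order of a zero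
    is finite.\<close>
  moreover have "\<exists>w\<in>{s. Re s > 1}. L w \<noteq> 0"
    by (rule bexI[of _ 3]) (use dirichlet_series_3_nonzero[of chi] norm_le_1 in auto)
  ultimately obtain m where m: "m = 0 \<longleftrightarrow> L z \<noteq> 0"
    "((\<lambda>w. (w - z) * (deriv L w / L w)) \<longlongrightarrow> of_nat m) (at z)"
    "eventually (\<lambda>w. L w \<noteq> 0) (at z)"
    using logderiv_tendsto_order[of L "{s. Re s > 1}" z, OF _ op connected_halfspace_Re_gt] z by blast
  have "isCont P z"
    using holomorphic_on_imp_continuous_on[OF P_holomorphic] op z
    by (auto simp: continuous_on_eq_continuous_at)
  hence "((\<lambda>w. (w - z) * (- P w)) \<longlongrightarrow> (z - z) * (- P z)) (at z)"
    by (intro tendsto_intros) (auto simp: isCont_def)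
  moreover have ev: "eventually (\<lambda>w. w \<in> {s. Re s > 1} - {z}) (at z)"
    using eventually_at_in_open[OF op] z by auto
  have "eventually (\<lambda>w. (w - z) * (- P w) = (w - z) * (deriv L w / L w)) (at z)"
    using m(3) ev
  proof eventually_elim
    case (elim w)
    thus ?case using DERIV_imp_deriv[OF deriv_L[of w]] by auto
  qed
  ultimately have "((\<lambda>w. (w - z) * (deriv L w / L w)) \<longlongrightarrow> 0) (at z)"
    by (auto elim: Lim_transform_eventually)
  with m(2) have "of_nat m = (0 :: complex)" by (intro tendsto_unique[OF _ m(2)]) auto
  thus ?thesis using m(1) by simp
qed

lemma F_nonzero: "Re s > 1 \<Longrightarrow> F s \<noteq> 0"
  using F_eq[of s] L_nonzero[of s] by auto

lemma P_eq:
  assumes s: "Re s > 1" shows "P s = of_nat order1 / (s - 1) - deriv F s / F s"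
proof -
  have [simp]: "s \<noteq> 1" using s by auto
  have "((\<lambda>s. (s - 1) ^ order1 * L s) has_field_derivative
      (of_nat order1 * L s - (s - 1) ^ order1 * (P s * L s))) (at s)"
    by (cases principal) (use deriv_L[OF s] in \<open>auto intro!: derivative_eq_intros simp: order1_def\<close>)
  hence "(F has_field_derivative (of_nat order1 * L s - (s - 1) ^ order1 * (P s * L s))) (at s)"
    by (rule has_field_derivative_transform_within_open[OF _ open_halfspace_Re_gt[of 1]])
       (use F_eq s in auto)
  hence deriv_F: "deriv F s = of_nat order1 * L s - (s - 1) ^ order1 * (P s * L s)"
    by (rule DERIV_imp_deriv)
  have "q = 1 / a - (l - a * (q * l)) / (a * l)" if "a \<noteq> 0" "l \<noteq> 0" for a l q :: complex
    using that by (simp add: field_simps)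
  from this[of "s - 1" "L s" "P s"] show ?thesis
    using L_nonzero[OF s] unfolding F_eq[OF s] deriv_F
    by (cases principal) (simp_all add: order1_def)
qed

text \<open>In the horizontal approach to the line, (x - 1) P picks up the order of the pole of L,
  present only at t = 0, minus the order m of the zero of F.\<close>

lemma P_tendsto:
  obtains m :: nat where "m = 0 \<longleftrightarrow> F (Complex 1 t) \<noteq> 0"
    "((\<lambda>x. of_real (x - 1) * P (Complex x t)) \<longlongrightarrow> (if t = 0 then of_nat order1 else 0) - of_nat m) (at_right 1)"
proof -
  let ?z = "Complex 1 t"
  have ex: "\<exists>w\<in>{s. Re s > 0}. F w \<noteq> 0" by (rule bexI[of _ 3]) (use F_nonzero[of 3] in auto)
  have z: "?z \<in> {s. Re s > 0}" by simp
  obtain m where m: "m = 0 \<longleftrightarrow> F ?z \<noteq> 0"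
    "((\<lambda>w. (w - ?z) * (deriv F w / F w)) \<longlongrightarrow> of_nat m) (at ?z)"
    by (rule logderiv_tendsto_order[OF F_holomorphic open_halfspace_Re_gt connected_halfspace_Re_gt z ex])
  have lim: "((\<lambda>x. Complex x t) \<longlongrightarrow> ?z) (at_right 1)"
    by (intro tendsto_Complex tendsto_intros)
  have "filterlim (\<lambda>x. Complex x t) (at ?z) (at_right 1)"
    using lim by (intro filterlim_atI) (auto simp: eventually_at_filter)
  moreover have "Complex x t - ?z = of_real (x - 1)" for x by (simp add: complex_eq_iff)
  ultimately
  have 1: "((\<lambda>x. of_real (x - 1) * (deriv F (Complex x t) / F (Complex x t))) \<longlongrightarrow> of_nat m) (at_right 1)"
    using filterlim_compose[OF m(2)] by force
  have 2: "((\<lambda>x. of_real (x - 1) * (of_nat order1 / (Complex x t - 1))) \<longlongrightarrow> (if t = 0 then of_nat order1 else 0)) (at_right 1)"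
  proof (cases "t = 0")
    case True
    have "eventually (\<lambda>x. of_nat order1 = of_real (x - 1) * (of_nat order1 / (Complex x t - 1))) (at_right 1)"
    proof -
      have eq: "Complex x t - 1 = of_real (x - 1)" for x using True by (simp add: complex_eq_iff)
      have "of_nat order1 = of_real (x - 1) * (of_nat order1 / (Complex x t - 1))" if "x \<noteq> 1" for x
        unfolding eq using that by simp
      thus ?thesis by (auto simp: eventually_at_filter intro!: always_eventually)
    qed
    thus ?thesis using True Lim_transform_eventually[OF tendsto_const] by simp
  next
    case False
    hence "?z - 1 \<noteq> 0" by (auto simp: complex_eq_iff)
    hence "((\<lambda>x. of_real (x - 1) * (of_nat order1 / (Complex x t - 1))) \<longlongrightarrow> of_real (1 - 1) * (of_nat order1 / (?z - 1))) (at_right 1)"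
      by (intro tendsto_intros lim)
    thus ?thesis using False by simp
  qed
  have "((\<lambda>x. of_real (x - 1) * P (Complex x t)) \<longlongrightarrow> (if t = 0 then of_nat order1 else 0) - of_nat m) (at_right 1)"
    by (rule Lim_transform_eventually[OF tendsto_diff[OF 2 1]])
       (auto simp: eventually_at_filter P_eq right_diff_distrib[of "of_real _ - 1"] intro!: always_eventually)
  thus ?thesis by (rule that[OF m(1)])
qed

end

subsection \<open>Non-vanishing on the line with real part 1\<close>

lemma dchar_principal:
  assumes "prime p"
  shows "dchar p (\<lambda>n. if p dvd n then 0 else 1)"
  using assms by unfold_locales (auto simp: prime_dvd_mult_iff)

context dchar
begin

lemma dchar_power: "k > 0 \<Longrightarrow> dchar p (\<lambda>n. chi n ^ k)"
  using prime by unfold_locales (auto simp: mult periodic zero norm_unit norm_power power_mult_distrib)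

text \<open>The combination with weights 3, 4, 1 of the P-series of the principal character at x, of
  chi at x + it and of its square at x + 2it has nonnegative real part. Multiplied by x - 1 it tends
  to 3 - 4 m1 - m2, which forces m1 = 0. The hypothesis keeps poles of chi and of its square out of
  this limit.\<close>

lemma F_nonzero_341:
  assumes t: "t \<noteq> 0 \<or> \<not> dchar.principal p (\<lambda>n. chi n ^ 2)"
  shows "F (Complex 1 t) \<noteq> 0"
proof -
  define chi0 where "chi0 = (\<lambda>n. if p dvd n then 0 else 1 :: complex)"
  interpret q: dchar p chi0 unfolding chi0_def by (rule dchar_principal[OF prime])
  interpret r: dchar p "\<lambda>n. chi n ^ 2" by (rule dchar_power) simp
  have q: "q.principal" unfolding q.principal_def by (simp add: chi0_def)
  obtain m0 where m0: "m0 = 0 \<longleftrightarrow> q.F (Complex 1 0) \<noteq> 0"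
    "((\<lambda>x. of_real (x - 1) * q.P (Complex x 0)) \<longlongrightarrow> (if (0::real) = 0 then of_nat q.order1 else 0) - of_nat m0) (at_right 1)"
    by (rule q.P_tendsto)
  have "Complex 1 0 = 1" by (simp add: complex_eq_iff)
  \<comment> \<open>The extension of the principal L-series has no zero at 1, so its term
    contributes the full 3.\<close>
  hence m0': "m0 = 0" using m0(1) q.F_1[OF q] by simp
  obtain m1 where m1: "m1 = 0 \<longleftrightarrow> F (Complex 1 t) \<noteq> 0"
    "((\<lambda>x. of_real (x - 1) * P (Complex x t)) \<longlongrightarrow> (if t = 0 then of_nat order1 else 0) - of_nat m1) (at_right 1)"
    by (rule P_tendsto)
  obtain m2 where m2: "m2 = 0 \<longleftrightarrow> r.F (Complex 1 (2 * t)) \<noteq> 0"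
    "((\<lambda>x. of_real (x - 1) * r.P (Complex x (2 * t))) \<longlongrightarrow> (if 2 * t = 0 then of_nat r.order1 else 0) - of_nat m2) (at_right 1)"
    by (rule r.P_tendsto)
  \<comment> \<open>If chi were principal, so would be its square; hence at t = 0 neither of them
    has a pole.\<close>
  have np: "\<not> principal" "\<not> r.principal" if "t = 0"
    using t that by (auto simp: principal_def r.principal_def)
  have ord: "(if t = 0 then of_nat order1 else 0) = (0 :: complex)" "(if 2 * t = 0 then of_nat r.order1 else 0) = (0 :: complex)"
    using np by (auto simp: order1_def r.order1_def)
  have lim: "((\<lambda>x. Re (3 * (of_real (x - 1) * q.P (Complex x 0)) + 4 * (of_real (x - 1) * P (Complex x t))
          + of_real (x - 1) * r.P (Complex x (2 * t))))
        \<longlongrightarrow> Re (3 * (of_nat q.order1 - 0) + 4 * (0 - of_nat m1) + (0 - of_nat m2))) (at_right 1)"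
    using m0(2) m1(2) m2(2) unfolding ord m0' by (intro tendsto_intros) simp_all
  have nonneg: "0 \<le> Re (3 * (of_real (x - 1) * q.P (Complex x 0)) + 4 * (of_real (x - 1) * P (Complex x t))
          + of_real (x - 1) * r.P (Complex x (2 * t)))" if x: "x > 1" for x
  proof -
    have sums: "(\<lambda>n. c n * mangoldt n * of_nat n powr (- Complex x y)) sums dirichlet_series (\<lambda>n. c n * mangoldt n) (Complex x y)"
      if "dchar p c" for c y
    proof -
      interpret c: dchar p c by fact
      show ?thesis unfolding dirichlet_series_def
        by (intro summable_sums dirichlet_series_holomorphic(2)[of 1]) (use c.abs_summable_mangoldt x in auto)
    qed
    define T where "T = (\<lambda>n. 3 * (chi0 n * mangoldt n * of_nat n powr (- Complex x 0)) + 4 * (chi n * mangoldt n * of_nat n powr (- Complex x t))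
        + chi n ^ 2 * mangoldt n * of_nat n powr (- Complex x (2 * t)))"
    have "T sums (3 * q.P (Complex x 0) + 4 * P (Complex x t) + r.P (Complex x (2 * t)))"
      unfolding T_def
      by (intro sums_add sums_mult sums) (rule q.dchar_axioms dchar_axioms r.dchar_axioms)+
    hence T_sums: "(\<lambda>n. Re (T n)) sums Re (3 * q.P (Complex x 0) + 4 * P (Complex x t) + r.P (Complex x (2 * t)))"
      by (rule sums_Re)
    have T_nonneg: "0 \<le> Re (T n)" for n
    proof (cases "p dvd n")
      case True
      thus ?thesis using zero[of n] by (simp add: T_def chi0_def)
    next
      case False
      hence n: "n > 0" by (auto intro: Nat.gr0I)
      \<comment> \<open>The number u = chi(n) n^(-it) has modulus 1, so Re (u^2) = 2 (Re u)^2 - 1,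
        which turns the combination into twice a square.\<close>
      define w where "w = of_nat n powr (- (\<i> * of_real t))"
      define u where "u = chi n * w"
      have pw: "of_nat n powr (- Complex x y) = of_real (real n powr (-x)) * of_nat n powr (- (\<i> * of_real y))" for y
      proof -
        have "- Complex x y = of_real (-x) + (- (\<i> * of_real y))" by (simp add: complex_eq_iff)
        hence "of_nat n powr (- Complex x y) = of_nat n powr (of_real (-x)) * of_nat n powr (- (\<i> * of_real y))"
          by (simp only: powr_add)
        also have "of_nat n powr (of_real (-x)) = complex_of_real (real n powr (-x))"
          using powr_of_real[of "real n" "-x"] by simp
        finally show ?thesis .
      qed
      have w2: "of_nat n powr (- (\<i> * of_real (2 * t))) = w ^ 2"
        unfolding w_def power2_eq_square by (simp add: powr_add[symmetric] algebra_simps)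
      have T: "T n = of_real (mangoldt n * real n powr (-x)) * (3 + 4 * u + u ^ 2)"
        unfolding T_def pw w2 w_def[symmetric] u_def using n False
        by (simp add: chi0_def algebra_simps power_mult_distrib)
      have "norm u = 1" using norm_unit[OF False] n by (simp add: u_def w_def norm_mult norm_nat_powr)
      hence "(Re u)\<^sup>2 + (Im u)\<^sup>2 = 1" by (simp add: cmod_def)
      hence "Re (3 + 4 * u + u ^ 2) = 2 * (1 + Re u)\<^sup>2"
        by (simp add: power2_eq_square algebra_simps)
      thus ?thesis unfolding T by (simp add: mangoldt_nonneg)
    qed
    have "0 \<le> Re (3 * q.P (Complex x 0) + 4 * P (Complex x t) + r.P (Complex x (2 * t)))"
      by (rule sums_le[OF T_nonneg sums_zero T_sums])
    hence "0 \<le> (x - 1) * Re (3 * q.P (Complex x 0) + 4 * P (Complex x t) + r.P (Complex x (2 * t)))"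
      using x by simp
    also have "\<dots> = Re (of_real (x - 1) * (3 * q.P (Complex x 0) + 4 * P (Complex x t) + r.P (Complex x (2 * t))))"
      by (simp del: of_real_diff)
    finally show ?thesis by (simp add: algebra_simps)
  qed
  have "0 \<le> Re (3 * (of_nat q.order1 - 0) + 4 * (0 - of_nat m1) + (0 - of_nat m2) :: complex)"
    by (rule tendsto_lowerbound[OF lim])
       (use nonneg in \<open>auto simp: eventually_at_filter intro!: always_eventually\<close>)
  hence "4 * real m1 \<le> 3" using q by (simp add: q.order1_def)
  hence "m1 = 0" by linarith
  thus ?thesis using m1(1) by simp
qed

text \<open>Here the square of chi has a pole at 1, so the limit in the preceding argument would be
  4 - 4 m1 - m2, which admits m1 = 1. The values of chi are real, and the Lambert series argument
  takes over.\<close>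

lemma L_1_nonzero_real:
  assumes "\<not> principal" "dchar.principal p (\<lambda>n. chi n ^ 2)"
  shows "L 1 \<noteq> 0"
proof
  assume L1: "L 1 = 0"
  interpret r: dchar p "\<lambda>n. chi n ^ 2" by (rule dchar_power) simp
  define x where "x = (\<lambda>n. Re (chi n))"
  have val: "chi n \<in> {-1, 0, 1}" for n
    using assms(2) zero[of n] by (cases "p dvd n") (auto simp: r.principal_def power2_eq_1_iff)
  have chi: "chi n = of_real (x n)" for n using val[of n] by (auto simp: x_def)
  have not_sums: "\<not> (\<lambda>n. x n / real n) sums 0"
  proof (rule real_character_sum_nonzero)
    show "x (m * n) = x m * x n" for m n
      using mult[of m n] unfolding chi by (metis of_real_eq_iff of_real_mult)
    show "x (Suc 0) = 1" "x 0 = 0" using zero[of 0] by (simp_all add: x_def)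
    show "x n \<in> {-1, 0, 1}" for n using val[of n] by (auto simp: x_def)
    show "\<bar>\<Sum>m\<le>n. x m\<bar> \<le> (\<Sum>m<p. norm (chi m))" for n
    proof -
      have "norm (\<Sum>m\<le>n. chi m) \<le> (\<Sum>m<p. norm (chi m))"
        by (rule norm_partial_sums_periodic_le)
           (use periodic sum_period_nonprincipal[OF assms(1)] p_gt_1 in auto)
      moreover have "(\<Sum>m\<le>n. chi m) = of_real (\<Sum>m\<le>n. x m)" by (simp add: chi)
      ultimately show ?thesis by (simp only: norm_of_real)
    qed
  qed
  have "(\<lambda>n. chi n * of_nat n powr (-1)) sums 0"
    using L_nonprincipal_holomorphic(2)[OF assms(1), of 1] L1
    by (simp add: dirichlet_series_def sums_iff)
  hence "(\<lambda>n. Re (chi n * of_nat n powr (-1))) sums Re 0" by (rule sums_Re)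
  moreover have "Re (chi n * of_nat n powr (-1)) = x n / real n" for n
  proof -
    have "of_nat n powr (-1) = complex_of_real (1 / real n)"
      by (cases "n = 0") (simp_all add: powr_minus divide_inverse)
    thus ?thesis by (simp add: x_def)
  qed
  ultimately have "(\<lambda>n. x n / real n) sums 0" by simp
  with not_sums show False by contradiction
qed

lemma F_nonzero_line:
  assumes "Re s \<ge> 1" shows "F s \<noteq> 0"
proof (cases "Re s = 1")
  case True
  hence s: "s = Complex 1 (Im s)" by (simp add: complex_eq_iff)
  consider "principal" "Im s = 0" | "\<not> principal" "dchar.principal p (\<lambda>n. chi n ^ 2)" "Im s = 0"
    | "Im s \<noteq> 0 \<or> \<not> dchar.principal p (\<lambda>n. chi n ^ 2)" by blast
  thus ?thesis
  proof cases
    case 1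
    have "s = 1" using True 1 by (simp add: complex_eq_iff)
    thus ?thesis using F_1 1 by simp
  next
    case 2
    have "s = 1" using True 2 by (simp add: complex_eq_iff)
    thus ?thesis using F_eq_L L_1_nonzero_real 2 by simp
  next
    case 3
    thus ?thesis using F_nonzero_341[of "Im s"] s by simp
  qed
qed (use F_nonzero assms in auto)

text \<open>Non-vanishing on the closed half-plane makes F'/F continuous up to the boundary line, in
  the form that the Tauberian theorem takes as input.\<close>

lemma P_minus_pole_continuous:
  obtains G where "continuous_on {s. Re s \<ge> 1} G"
    "\<And>s. Re s > 1 \<Longrightarrow> P s = of_nat order1 / (s - 1) + G s"
proof (rule that)
  have "continuous_on {s. Re s > 0} F" "continuous_on {s. Re s > 0} (deriv F)"
    by (auto intro!: holomorphic_on_imp_continuous_on holomorphic_deriv F_holomorphic open_halfspace_Re_gt)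
  thus "continuous_on {s. Re s \<ge> 1} (\<lambda>s. - (deriv F s / F s))"
    by (intro continuous_intros) (auto elim!: continuous_on_subset simp: F_nonzero_line)
qed (simp add: P_eq)

end

subsection \<open>A Tauberian theorem\<close>

text \<open>The Fourier transform of the triangle 1 - |t| on [-1, 1], equal to (sin (u/2) /
  (u/2))^2; the value at 0 is the continuous extension.\<close>

definition fejer :: "real \<Rightarrow> real" where
  "fejer u = (if u = 0 then 1 else 2 * (1 - cos u) / u\<^sup>2)"

lemma cis_has_vector_derivative:
  "((\<lambda>t. cis (u * t)) has_vector_derivative (\<i> * of_real u * cis (u * t))) (at t within S)"
proof -
  have "((\<lambda>t. exp (of_real t * (\<i> * of_real u))) has_vector_derivative (\<i> * of_real u * exp (of_real t * (\<i> * of_real u)))) (at t within S)"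
    by (rule exp_scaleR_has_vector_derivative_right[of "\<i> * of_real u" t S, unfolded scaleR_conv_of_real, THEN has_vector_derivative_eq_rhs])
       (simp add: mult_ac)
  thus ?thesis by (simp add: cis_conv_exp mult_ac)
qed

lemma fejer_has_integral:
  "((\<lambda>t. of_real (1 - \<bar>t\<bar>) * cis (u * t)) has_integral complex_of_real (fejer u)) {-1..1}"
proof (cases "u = 0")
  case True
  have "((\<lambda>t::real. 1 + t) has_integral (0 + 0^2/2) - (-1 + (-1)^2/2)) {-1..0}"
    by (rule fundamental_theorem_of_calculus)
       (auto intro!: derivative_eq_intros simp flip: has_real_derivative_iff_has_vector_derivative)
  hence 1: "((\<lambda>t::real. 1 - \<bar>t\<bar>) has_integral 1/2) {-1..0}"
    by (rule has_integral_eq_rhs[OF has_integral_eq[rotated]]) auto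
  have "((\<lambda>t::real. 1 - t) has_integral (1 - 1^2/2) - (0 - 0^2/2)) {0..1}"
    by (rule fundamental_theorem_of_calculus)
       (auto intro!: derivative_eq_intros simp flip: has_real_derivative_iff_has_vector_derivative)
  hence 2: "((\<lambda>t::real. 1 - \<bar>t\<bar>) has_integral 1/2) {0..1}"
    by (rule has_integral_eq_rhs[OF has_integral_eq[rotated]]) auto
  have "((\<lambda>t::real. 1 - \<bar>t\<bar>) has_integral 1/2 + 1/2) {-1..1}"
    by (rule has_integral_combine[OF _ _ 1 2]) auto
  from has_integral_linear[OF this bounded_linear_of_real[where ?'a = complex]] True
  show ?thesis by (simp add: o_def fejer_def)
next
  case False
  define w where "w = \<i> * complex_of_real u"
  have w: "w \<noteq> 0" using False by (simp add: w_def)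
  \<comment> \<open>Antiderivatives on the two halves, obtained by integration by parts. They divide
    by w = iu, which is why u = 0 is treated apart.\<close>
  define A where "A = (\<lambda>t::real. of_real (1 + t) * cis (u * t) / w - cis (u * t) / w\<^sup>2)"
  define B where "B = (\<lambda>t::real. of_real (1 - t) * cis (u * t) / w + cis (u * t) / w\<^sup>2)"
  have lin: "((\<lambda>t. complex_of_real (1 + t)) has_vector_derivative 1) (at t within S)"
            "((\<lambda>t. complex_of_real (1 - t)) has_vector_derivative -1) (at t within S)" for t S
    by (auto intro!: derivative_eq_intros simp: has_vector_derivative_def scaleR_conv_of_real)
  have "((\<lambda>t. of_real (1 + t) * cis (u * t)) has_integral (A 0 - A (-1))) {-1..0}"
  proof (rule fundamental_theorem_of_calculus)
    fix t :: real
    have "(A has_vector_derivative ((of_real (1 + t) * (w * cis (u * t)) + 1 * cis (u * t)) / w - (w * cis (u * t)) / w\<^sup>2)) (at t within {-1..0})"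
      unfolding A_def w_def divide_inverse
      by (intro has_vector_derivative_diff has_vector_derivative_mult_left has_vector_derivative_mult lin cis_has_vector_derivative)
    also have "((of_real (1 + t) * (w * cis (u * t)) + 1 * cis (u * t)) / w - (w * cis (u * t)) / w\<^sup>2) = of_real (1 + t) * cis (u * t)"
      using w by (simp add: field_simps power2_eq_square)
    finally show "(A has_vector_derivative of_real (1 + t) * cis (u * t)) (at t within {-1..0})" .
  qed auto
  hence 1: "((\<lambda>t. of_real (1 - \<bar>t\<bar>) * cis (u * t)) has_integral (A 0 - A (-1))) {-1..0}"
    by (rule has_integral_eq[rotated]) auto
  have "((\<lambda>t. of_real (1 - t) * cis (u * t)) has_integral (B 1 - B 0)) {0..1}"
  proof (rule fundamental_theorem_of_calculus)
    fix t :: real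
    have "(B has_vector_derivative ((of_real (1 - t) * (w * cis (u * t)) + (-1) * cis (u * t)) / w + (w * cis (u * t)) / w\<^sup>2)) (at t within {0..1})"
      unfolding B_def w_def divide_inverse
      by (intro has_vector_derivative_add has_vector_derivative_mult_left has_vector_derivative_mult lin cis_has_vector_derivative)
    also have "((of_real (1 - t) * (w * cis (u * t)) + (-1) * cis (u * t)) / w + (w * cis (u * t)) / w\<^sup>2) = of_real (1 - t) * cis (u * t)"
      using w by (simp add: field_simps power2_eq_square)
    finally show "(B has_vector_derivative of_real (1 - t) * cis (u * t)) (at t within {0..1})" .
  qed auto
  hence 2: "((\<lambda>t. of_real (1 - \<bar>t\<bar>) * cis (u * t)) has_integral (B 1 - B 0)) {0..1}"
    by (rule has_integral_eq[rotated]) auto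
  have "((\<lambda>t. of_real (1 - \<bar>t\<bar>) * cis (u * t)) has_integral ((A 0 - A (-1)) + (B 1 - B 0))) {-1..1}"
    by (rule has_integral_combine[OF _ _ 1 2]) auto
  also have "(A 0 - A (-1)) + (B 1 - B 0) = (cis u + cis (-u) - 2) / w\<^sup>2"
    by (simp add: A_def B_def diff_divide_distrib add_divide_distrib)
  also have "cis u + cis (-u) - 2 = of_real (2 * cos u - 2)" by (simp add: complex_eq_iff)
  also have "w\<^sup>2 = of_real (- u\<^sup>2)" by (simp add: w_def power_mult_distrib)
  also have "of_real (2 * cos u - 2) / of_real (- u\<^sup>2) = complex_of_real (fejer u)"
    using False by (simp add: fejer_def field_simps)
  finally show ?thesis .
qed

lemma fejer_nonneg: "fejer u \<ge> 0"
  by (simp add: fejer_def)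

lemma fejer_times_square_le: "fejer u * u\<^sup>2 \<le> 4"
  using cos_ge_minus_one[of u] by (auto simp: fejer_def simp del: cos_ge_minus_one)

lemma fejer_le_1: "fejer u \<le> 1"
proof (cases "u = 0")
  case False
  have "2 * (1 - cos u) = 4 * (sin (u / 2))\<^sup>2"
    using cos_double_sin[of "u / 2"] by simp
  also have "(sin (u / 2))\<^sup>2 \<le> (u / 2)\<^sup>2"
    using abs_sin_x_le_abs_x[of "u / 2"] by (simp only: abs_le_square_iff)
  finally show ?thesis using False by (simp add: fejer_def field_simps)
qed (simp add: fejer_def)

lemma fejer_ge_half_near_0:
  obtains r where "r > 0" "\<And>u. \<bar>u\<bar> \<le> r \<Longrightarrow> fejer u \<ge> 1/2"
proof -
  have "((\<lambda>u::real. 2 * (1 - cos u) / u\<^sup>2) \<longlongrightarrow> 1) (at 0)" by real_asymp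
  hence "eventually (\<lambda>u::real. 2 * (1 - cos u) / u\<^sup>2 > 1/2) (at 0)"
    by (rule order_tendstoD) simp
  then obtain d where d: "d > 0" "\<And>u::real. u \<noteq> 0 \<Longrightarrow> \<bar>u\<bar> < d \<Longrightarrow> 2 * (1 - cos u) / u\<^sup>2 > 1/2"
    unfolding eventually_at by (auto simp: dist_norm)
  have "fejer u \<ge> 1/2" if "\<bar>u\<bar> \<le> d / 2" for u
    using d(2)[of u] d(1) that by (cases "u = 0") (auto simp: fejer_def)
  with d(1) show ?thesis by (intro that[of "d/2"]) auto
qed

lemma nat_powr_complex:
  "n > 0 \<Longrightarrow> of_nat n powr (Complex x y) = of_real (real n powr x) * cis (y * ln (real n))"
proof -
  assume n: "n > 0"
  have "Ln (of_nat n) = complex_of_real (ln (real n))"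
    using n by (metis Ln_of_real of_nat_0_less_iff of_real_of_nat_eq)
  thus ?thesis using n
    by (simp add: powr_def exp_eq_polar mult.commute)
qed

text \<open>At s = x - ilt the factor n^(-s) is n^(-x) cis (l t ln n), and cis (- l y t) recentres
  the kernel at ln n = y. Absolute convergence on the line Re s = x gives uniform convergence in t,
  hence the exchange of sum and integral.\<close>

lemma fejer_smoothing:
  fixes a :: "nat \<Rightarrow> real"
  assumes "summable (\<lambda>n. \<bar>a n\<bar> * real n powr (-x))"
  shows "(\<lambda>n. a n * real n powr (-x) * fejer (l * (ln (real n) - y))) sums
     Re (integral {-1..1} (\<lambda>t. of_real (1 - \<bar>t\<bar>) * dirichlet_series (\<lambda>n. of_real (a n)) (Complex x (- l * t)) * cis (- l * y * t)))"
proof -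
  define f where "f = (\<lambda>n t. of_real (1 - \<bar>t\<bar>) * (of_real (a n) * of_nat n powr (- Complex x (- l * t))) * cis (- l * y * t))"
  define c where "c = (\<lambda>n. a n * real n powr (-x) * fejer (l * (ln (real n) - y)))"
  have uminus: "- Complex x (- l * t) = Complex (-x) (l * t)" for t by (simp add: complex_eq_iff)
  have f_eq: "f n t = of_real (a n * real n powr (-x)) * (of_real (1 - \<bar>t\<bar>) * cis (l * (ln (real n) - y) * t))" for n t
  proof (cases "n = 0")
    case False
    hence "f n t = of_real (a n * real n powr (-x)) * (of_real (1 - \<bar>t\<bar>) * (cis (l * t * ln (real n)) * cis (- l * y * t)))"
      unfolding f_def uminus by (simp add: nat_powr_complex)
    also have "cis (l * t * ln (real n)) * cis (- l * y * t) = cis (l * (ln (real n) - y) * t)"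
      by (simp add: cis_mult algebra_simps)
    finally show ?thesis .
  qed (simp add: f_def)
  have f_int: "(f n has_integral of_real (c n)) {-1..1}" for n
    using has_integral_mult_right[OF fejer_has_integral[of "l * (ln (real n) - y)"], of "of_real (a n * real n powr (-x))"]
    unfolding f_eq[abs_def] c_def by (simp add: mult.assoc)
  have f_cont: "continuous_on {-1..1} (f n)" for n
    unfolding f_eq[abs_def] cis_conv_exp by (intro continuous_intros)
  have "uniform_limit {-1..1} (\<lambda>N t. \<Sum>n<N. f n t) (\<lambda>t. \<Sum>n. f n t) sequentially"
  proof (rule Weierstrass_m_test[OF _ assms])
    fix n and t :: real assume t: "t \<in> {-1..1}"
    hence "norm (f n t) = \<bar>a n\<bar> * real n powr (-x) * (1 - \<bar>t\<bar>)"
      unfolding f_eq norm_mult norm_of_real by (auto simp: abs_mult abs_of_nonneg)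
    also have "\<dots> \<le> \<bar>a n\<bar> * real n powr (-x) * 1" using t by (intro mult_left_mono) auto
    finally show "norm (f n t) \<le> \<bar>a n\<bar> * real n powr (-x)" by simp
  qed
  then obtain I J where IJ: "\<And>N. ((\<lambda>t. \<Sum>n<N. f n t) has_integral I N) {-1..1}"
      "((\<lambda>t. \<Sum>n. f n t) has_integral J) {-1..1}" "I \<longlonglongrightarrow> J"
    by (rule uniform_limit_integral) (auto intro!: continuous_intros f_cont)
  have "I N = (\<Sum>n<N. of_real (c n))" for N
    by (rule has_integral_unique[OF IJ(1)]) (intro has_integral_sum f_int; simp)
  hence "I = (\<lambda>N. \<Sum>n<N. of_real (c n))" by (rule ext)
  with IJ(3) have "(\<lambda>n. complex_of_real (c n)) sums J" unfolding sums_def by (simp only:)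
  hence "(\<lambda>n. Re (complex_of_real (c n))) sums Re J" by (rule sums_Re)
  moreover have "(\<Sum>n. f n t) = of_real (1 - \<bar>t\<bar>) * dirichlet_series (\<lambda>n. of_real (a n)) (Complex x (- l * t)) * cis (- l * y * t)" for t
  proof -
    have "summable (\<lambda>n. of_real (a n) * of_nat n powr (- Complex x (- l * t)))"
      by (rule summable_norm_cancel, rule abs_summable_dirichlet[of _ x]) (use assms in auto)
    hence "(\<lambda>n. of_real (a n) * of_nat n powr (- Complex x (- l * t))) sums dirichlet_series (\<lambda>n. of_real (a n)) (Complex x (- l * t))"
      by (simp add: dirichlet_series_def summable_sums)
    hence "(\<lambda>n. f n t) sums (of_real (1 - \<bar>t\<bar>) * dirichlet_series (\<lambda>n. of_real (a n)) (Complex x (- l * t)) * cis (- l * y * t))"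
      unfolding f_def by (intro sums_mult sums_mult2)
    thus ?thesis by (simp add: sums_iff)
  qed
  ultimately show ?thesis using IJ(2) by (simp add: c_def integral_unique)
qed

text \<open>
  Shifting the variable by \<open>\<pi>/v\<close> changes the sign of the oscillating factor, so twice the integral
  is an integral of differences of \<open>g\<close> at distance \<open>\<pi>/v\<close>.
\<close>
lemma riemann_lebesgue_compact_support:
  fixes g :: "real \<Rightarrow> complex"
  assumes cont: "continuous_on UNIV g" and supp: "\<And>t. \<bar>t\<bar> \<ge> 1 \<Longrightarrow> g t = 0"
  shows "((\<lambda>v. integral {-1..1} (\<lambda>t. g t * cis (- v * t))) \<longlongrightarrow> 0) at_top"
proof (rule tendstoI)
  fix e :: real assume e: "e > 0"
  \<comment> \<open>This interval contains t and t + h for t in [-2, 2], as h < 1 below. The length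
    4 of [-2, 2] times e / 4 then bounds twice the integral by e.\<close>
  have "uniformly_continuous_on {-3..3} g"
    using cont by (intro compact_uniformly_continuous) (auto intro: continuous_on_subset)
  then obtain d where d: "d > 0" "\<And>s t. s \<in> {-3..3} \<Longrightarrow> t \<in> {-3..3} \<Longrightarrow> dist s t < d \<Longrightarrow> dist (g s) (g t) < e / 4"
    using e unfolding uniformly_continuous_on_def by (metis zero_less_divide_iff zero_less_numeral)
  \<comment> \<open>Makes the shift pi / v smaller than both 1 and d.\<close>
  have "eventually (\<lambda>v. v > max pi (pi / d)) at_top" by (rule eventually_gt_at_top)
  thus "eventually (\<lambda>v. dist (integral {-1..1} (\<lambda>t. g t * cis (- v * t))) 0 < e) at_top"
  proof eventually_elim
    case (elim v)
    define h where "h = pi / v"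
    have v: "v > 0" using elim pi_gt_zero by linarith
    have h: "0 < h" "h < 1" "h < d" using elim v d(1) by (auto simp: h_def field_simps)
    define f where "f = (\<lambda>t. g t * cis (- v * t))"
    have f_cont: "continuous_on S f" for S
      unfolding f_def cis_conv_exp by (intro continuous_intros continuous_on_subset[OF cont]) auto
    have f_int: "(f has_integral integral {-1..1} f) {a..b}" if "a \<le> -1" "b \<ge> 1" for a b
    proof (rule has_integral_on_superset)
      show "(f has_integral integral {-1..1} f) {-1..1}"
        by (intro integrable_integral integrable_continuous_real f_cont)
      show "f t = 0" if "t \<notin> {-1..1}" for t using supp[of t] that by (auto simp: f_def)
    qed (use that in auto)
    have "integral {-2..2} (f \<circ> (\<lambda>t. t + h)) = integral {-2 + h..2 + h} f"
      by (rule integral_shift) (rule f_cont)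
    also have "\<dots> = integral {-1..1} f" using f_int h by (intro integral_unique) auto
    finally have shift: "integral {-2..2} (\<lambda>t. f (t + h)) = integral {-1..1} f" by (simp add: o_def)
    have fh: "f (t + h) = - (g (t + h) * cis (- v * t))" for t
    proof -
      have "- v * (t + h) = - v * t - pi" using v by (simp add: h_def field_simps)
      moreover have "cis (- v * t - pi) = - cis (- v * t)" by (simp add: complex_eq_iff cos_diff sin_diff)
      ultimately show ?thesis by (simp add: f_def)
    qed
    have shift_cont: "continuous_on {-2..2} (\<lambda>t. f (t + h))"
      by (intro continuous_on_compose2[OF f_cont[of UNIV]] continuous_intros) auto
    have "2 * integral {-1..1} f = integral {-2..2} f + integral {-2..2} (\<lambda>t. f (t + h))"
      unfolding shift using f_int[of "-2" 2] by (simp add: integral_unique)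
    also have "\<dots> = integral {-2..2} (\<lambda>t. f t + f (t + h))"
      by (rule integral_add[symmetric]) (intro integrable_continuous_real f_cont shift_cont)+
    finally have "norm (2 * integral {-1..1} f) = norm (integral {-2..2} (\<lambda>t. f t + f (t + h)))" by simp
    also have "\<dots> \<le> e / 4 * (2 - (-2))"
    proof (rule integral_bound)
      fix t :: real assume t: "t \<in> {-2..2}"
      have "f t + f (t + h) = (g t - g (t + h)) * cis (- v * t)"
        unfolding fh by (simp add: f_def algebra_simps)
      hence "norm (f t + f (t + h)) = dist (g t) (g (t + h))" by (simp add: norm_mult dist_norm)
      also have "\<dots> \<le> e / 4" using t h by (intro less_imp_le d(2)) (auto simp: dist_norm)
      finally show "norm (f t + f (t + h)) \<le> e / 4" .
    qed (use f_cont shift_cont in \<open>auto intro!: continuous_intros\<close>)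
    finally show ?case using e by (simp add: f_def)
  qed
qed

section \<open>Mass of the kernel weights on the logarithmic scale\<close>

lemma ln_Suc_diff_bounds:
  assumes "n > 0"
  shows "1 / (2 * real n) \<le> ln (real (Suc n)) - ln (real n)"
    and "ln (real (Suc n)) - ln (real n) \<le> 1 / real n"
proof -
  have "ln (real (Suc n)) - ln (real n) = ln (real (Suc n) / real n)"
    using assms by (simp add: ln_div del: of_nat_Suc)
  also have "real (Suc n) / real n = 1 + 1 / real n" using assms by (simp add: field_simps)
  also have "ln (1 + 1 / real n) \<le> 1 / real n" by (rule ln_add_one_self_le_self) simp
  finally show "ln (real (Suc n)) - ln (real n) \<le> 1 / real n" .
  have "ln (real n) - ln (real (Suc n)) = ln (real n / real (Suc n))"
    using assms by (simp add: ln_div del: of_nat_Suc)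
  also have "real n / real (Suc n) = 1 + (- (1 / real (Suc n)))" by (simp add: field_simps)
  also have "ln (1 + (- (1 / real (Suc n)))) \<le> - (1 / real (Suc n))"
    using assms by (intro ln_add_one_self_le_self2) (simp add: field_simps)
  finally have "1 / real (Suc n) \<le> ln (real (Suc n)) - ln (real n)" by simp
  moreover have "1 / (2 * real n) \<le> 1 / real (Suc n)" using assms by (intro divide_left_mono) auto
  ultimately show "1 / (2 * real n) \<le> ln (real (Suc n)) - ln (real n)" by simp
qed

text \<open>The terms are compared with the increments of \<open>arctan((log n - y)/h)/h\<close>.\<close>
lemma sum_log_cauchy_kernel_bounded:
  assumes "h > 0"
  obtains D where "D > 0"
    "\<And>y. summable (\<lambda>n. 1 / (real n * (h\<^sup>2 + (ln (real n) - y)\<^sup>2)))"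
    "\<And>y. (\<Sum>n. 1 / (real n * (h\<^sup>2 + (ln (real n) - y)\<^sup>2))) \<le> D"
proof -
  \<comment> \<open>Chosen so that h^2 + z^2 <= C (h^2 + u^2) whenever z and u differ by at most 1,
    as consecutive logarithms do. The further factor 2 below comes from 1 / (2n) <= ln (n+1) - ln
    n.\<close>
  define C where "C = 2 + 2 / h\<^sup>2"
  define A where "A = (\<lambda>y n. arctan ((ln (real (Suc n)) - y) / h) / h)"
  have C: "C > 0" using assms by (simp add: C_def add_pos_pos)
  have step: "1 / (real (Suc n) * (h\<^sup>2 + (ln (real (Suc n)) - y)\<^sup>2)) \<le> 2 * C * (A y (Suc n) - A y n)" for n y
  proof -
    define u v where "u = ln (real (Suc n)) - y" and "v = ln (real (Suc (Suc n))) - y"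
    have vu_eq: "v - u = ln (real (Suc (Suc n))) - ln (real (Suc n))" by (simp add: u_def v_def)
    have vu_ge: "1 / (2 * real (Suc n)) \<le> v - u" and "v - u \<le> 1 / real (Suc n)"
      unfolding vu_eq by (rule ln_Suc_diff_bounds; simp)+
    note this(2)
    also have "1 / real (Suc n) \<le> 1" by simp
    finally have vu_le: "v - u \<le> 1" .
    have "0 < 1 / (2 * real (Suc n))" by simp
    with vu_ge have "u < v" by linarith
    have der: "((\<lambda>x. arctan (x / h) / h) has_real_derivative 1 / (h\<^sup>2 + x\<^sup>2)) (at x)" for x
    proof -
      have eq: "h\<^sup>2 + x\<^sup>2 = h * h * (1 + (x / h)\<^sup>2)"
        using assms by (simp add: field_simps power2_eq_square)
      show ?thesis unfolding eq using assms
        by (auto intro!: derivative_eq_intros simp: divide_inverse)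
    qed
    obtain z where z: "u < z" "z < v" "arctan (v / h) / h - arctan (u / h) / h = (v - u) * (1 / (h\<^sup>2 + z\<^sup>2))"
      using MVT2[OF \<open>u < v\<close>, of "\<lambda>x. arctan (x / h) / h" "\<lambda>x. 1 / (h\<^sup>2 + x\<^sup>2)"] der by blast
    have "z\<^sup>2 \<le> 2 * u\<^sup>2 + 2 * (z - u)\<^sup>2"
      using sum_squares_ge_zero[of "2 * u - z" 0] by (simp add: power2_eq_square algebra_simps)
    also have "(z - u)\<^sup>2 \<le> 1" using z vu_le by (simp add: abs_square_le_1)
    finally have "z\<^sup>2 \<le> 2 * u\<^sup>2 + 2" by simp
    moreover have "C * (h\<^sup>2 + u\<^sup>2) = 2 * h\<^sup>2 + 2 * u\<^sup>2 + 2 + 2 * (u\<^sup>2 / h\<^sup>2)"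
      using assms by (simp add: C_def field_simps)
    moreover have "u\<^sup>2 / h\<^sup>2 \<ge> 0" "h\<^sup>2 \<ge> 0" by simp_all
    ultimately have "h\<^sup>2 + z\<^sup>2 \<le> C * (h\<^sup>2 + u\<^sup>2)" by linarith
    hence "1 / (h\<^sup>2 + u\<^sup>2) \<le> C / (h\<^sup>2 + z\<^sup>2)"
      using assms C by (simp add: field_simps add_pos_nonneg)
    hence "1 / (2 * real (Suc n)) * (1 / (h\<^sup>2 + u\<^sup>2)) \<le> (v - u) * (C / (h\<^sup>2 + z\<^sup>2))"
      using vu_ge \<open>u < v\<close> by (intro mult_mono) auto
    hence "2 * (1 / (2 * real (Suc n)) * (1 / (h\<^sup>2 + u\<^sup>2))) \<le> 2 * ((v - u) * (C / (h\<^sup>2 + z\<^sup>2)))"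
      by (rule mult_left_mono) simp
    moreover have "A y (Suc n) - A y n = (v - u) * (1 / (h\<^sup>2 + z\<^sup>2))"
      using z(3) unfolding A_def u_def v_def by simp
    moreover have "1 / (real (Suc n) * (h\<^sup>2 + u\<^sup>2)) = 2 * (1 / (2 * real (Suc n)) * (1 / (h\<^sup>2 + u\<^sup>2)))"
      by (simp del: of_nat_Suc)
    moreover have "2 * C * ((v - u) * (1 / (h\<^sup>2 + z\<^sup>2))) = 2 * ((v - u) * (C / (h\<^sup>2 + z\<^sup>2)))"
      by simp
    ultimately have "1 / (real (Suc n) * (h\<^sup>2 + u\<^sup>2)) \<le> 2 * C * (A y (Suc n) - A y n)"
      by (simp only:)
    thus ?thesis by (simp only: u_def)
  qed
  have A_bound: "\<bar>A y n\<bar> \<le> pi / 2 / h" for y n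
    using arctan_bounded[of "(ln (real (Suc n)) - y) / h"] assms
    by (auto simp: A_def abs_le_iff field_simps)
  define t where "t = (\<lambda>y n. 1 / (real n * (h\<^sup>2 + (ln (real n) - y)\<^sup>2)))"
  have t_nonneg: "t y n \<ge> 0" for y n by (simp add: t_def)
  have partial: "(\<Sum>n<N. t y n) \<le> 2 * C * (pi / h)" for N y
  proof -
    have "(\<Sum>n<N. t y n) \<le> (\<Sum>n<Suc N. t y n)" by (simp add: t_nonneg)
    also have "\<dots> = t y 0 + (\<Sum>n<N. t y (Suc n))" by (rule sum.lessThan_Suc_shift)
    also have "t y 0 = 0" by (simp add: t_def)
    also have "(\<Sum>n<N. t y (Suc n)) \<le> (\<Sum>n<N. 2 * C * (A y (Suc n) - A y n))"
      unfolding t_def by (intro sum_mono step)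
    also have "\<dots> = 2 * C * (A y N - A y 0)"
      by (simp only: sum_distrib_left[symmetric] sum_lessThan_telescope)
    also have "\<dots> \<le> 2 * C * (pi / h)"
      using A_bound[of y N] A_bound[of y 0] C by (intro mult_left_mono) auto
    finally show ?thesis by simp
  qed
  have summ: "summable (t y)" for y
    by (rule summableI_nonneg_bounded[OF t_nonneg partial])
  show ?thesis
  proof (rule that[of "2 * C * (pi / h)"])
    show "(\<Sum>n. 1 / (real n * (h\<^sup>2 + (ln (real n) - y)\<^sup>2))) \<le> 2 * C * (pi / h)" for y
      using suminf_le_const[OF summ[of y] partial] by (simp add: t_def)
  qed (use C assms summ in \<open>auto simp: t_def\<close>)
qed

lemma fejer_weights_summable:
  assumes "l > 0" shows "summable (\<lambda>n. fejer (l * (ln (real n) - y)) / real n)"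
proof -
  have l: "1 / l > 0" using assms by simp
  obtain D where "D > 0" and D: "\<And>y. summable (\<lambda>n. 1 / (real n * ((1/l)\<^sup>2 + (ln (real n) - y)\<^sup>2)))"
    "\<And>y. (\<Sum>n. 1 / (real n * ((1/l)\<^sup>2 + (ln (real n) - y)\<^sup>2))) \<le> D"
    by (rule sum_log_cauchy_kernel_bounded[OF l]) (rule that)
  show ?thesis
  proof (rule summable_comparison_test'[OF summable_mult[OF D(1)[of y], of "5 / l\<^sup>2"], of 0])
    fix n :: nat
    define u where "u = ln (real n) - y"
    \<comment> \<open>Here 5 = 1 + 4, from \<open>fejer_le_1\<close> and
      \<open>fejer_times_square_le\<close>.\<close>
    have "fejer (l * u) * (1 + (l * u)\<^sup>2) \<le> 5"
      using fejer_le_1[of "l*u"] fejer_times_square_le[of "l*u"] by (simp add: algebra_simps)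
    moreover have "1 + (l * u)\<^sup>2 > 0" by (simp add: add_pos_nonneg)
    ultimately have "fejer (l * u) \<le> 5 / (1 + (l * u)\<^sup>2)" by (simp add: pos_le_divide_eq)
    also have "\<dots> = 5 / l\<^sup>2 / ((1/l)\<^sup>2 + u\<^sup>2)" using assms by (simp add: field_simps)
    finally have "fejer (l * u) / real n \<le> 5 / l\<^sup>2 / ((1/l)\<^sup>2 + u\<^sup>2) / real n"
      by (rule divide_right_mono) simp
    thus "norm (fejer (l * (ln (real n) - y)) / real n) \<le> 5 / l\<^sup>2 * (1 / (real n * ((1/l)\<^sup>2 + (ln (real n) - y)\<^sup>2)))"
      using fejer_nonneg[of "l * u"] by (simp add: u_def mult_ac)
  qed
qed

text \<open>Quadratic decay of the kernel makes the mass outside the window O(1 / l^2) uniformly in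
  y, whereas the total mass is at least of order 1 / l for large y. This is why the weights
  concentrate as l grows.\<close>

lemma fejer_weights_tail:
  assumes "h > 0"
  obtains D where "D > 0" "\<And>l y. l > 0 \<Longrightarrow>
    (\<Sum>n. if \<bar>ln (real n) - y\<bar> > h then fejer (l * (ln (real n) - y)) / real n else 0) \<le> D / l\<^sup>2"
proof -
  obtain D where D: "D > 0" "\<And>y. summable (\<lambda>n. 1 / (real n * (h\<^sup>2 + (ln (real n) - y)\<^sup>2)))"
    "\<And>y. (\<Sum>n. 1 / (real n * (h\<^sup>2 + (ln (real n) - y)\<^sup>2))) \<le> D"
    by (rule sum_log_cauchy_kernel_bounded[OF assms]) (rule that)
  show ?thesis
  proof (rule that[of "8 * D"])
    fix l y :: real assume l: "l > 0"
    have le: "(if \<bar>ln (real n) - y\<bar> > h then fejer (l * (ln (real n) - y)) / real n else 0)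
        \<le> 8 / l\<^sup>2 * (1 / (real n * (h\<^sup>2 + (ln (real n) - y)\<^sup>2)))" (is "?w n \<le> ?v n") for n
    proof (cases "\<bar>ln (real n) - y\<bar> > h")
      case True
      define u where "u = ln (real n) - y"
      have u: "u\<^sup>2 \<ge> h\<^sup>2" "u \<noteq> 0" using True assms unfolding u_def[symmetric] by (auto simp: abs_le_square_iff[symmetric])
      have "fejer (l * u) \<le> 4 / (l * u)\<^sup>2"
        using fejer_times_square_le[of "l * u"] u l by (simp add: pos_le_divide_eq)
      \<comment> \<open>Doubling u^2 allows one copy to be replaced by h^2, which gives the kernel
        already known to be summable; this turns 4 into 8.\<close>
      also have "\<dots> = 8 / l\<^sup>2 / (u\<^sup>2 + u\<^sup>2)" using u l by (simp add: field_simps)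
      also have "\<dots> \<le> 8 / l\<^sup>2 / (h\<^sup>2 + u\<^sup>2)" using u assms by (intro divide_left_mono) (auto simp: add_pos_nonneg)
      finally have "fejer (l * u) / real n \<le> 8 / l\<^sup>2 / (h\<^sup>2 + u\<^sup>2) / real n"
        by (rule divide_right_mono) simp
      thus ?thesis using True by (simp add: u_def mult_ac)
    qed simp
    have nn: "?w n \<ge> 0" for n using fejer_nonneg by simp
    have "suminf ?w \<le> suminf ?v"
    proof (rule suminf_le[OF le])
      show v: "summable ?v" by (rule summable_mult[OF D(2)])
      show "summable ?w"
        by (rule summable_comparison_test'[OF v, of 0]) (use le nn in \<open>simp only: real_norm_def abs_of_nonneg\<close>)
    qed
    also have "\<dots> = 8 / l\<^sup>2 * (\<Sum>n. 1 / (real n * (h\<^sup>2 + (ln (real n) - y)\<^sup>2)))"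
      by (rule suminf_mult[OF D(2)])
    also have "\<dots> \<le> 8 / l\<^sup>2 * D" by (intro mult_left_mono D) auto
    finally show "suminf ?w \<le> 8 * D / l\<^sup>2" by simp
  qed (use D(1) in auto)
qed

text \<open>For exp y <= n <= exp (y + r / l) the kernel is at least 1/2, and the sum of 1 / n over
  this range is close to r / l for large y.\<close>

lemma fejer_weights_lower_bound:
  obtains r where "r > 0" "\<And>l. l > 0 \<Longrightarrow>
    eventually (\<lambda>y. r / l \<le> (\<Sum>n. fejer (l * (ln (real n) - y)) / real n)) at_top"
proof -
  obtain r where r: "r > 0" "\<And>u. \<bar>u\<bar> \<le> r \<Longrightarrow> fejer u \<ge> 1/2" by (rule fejer_ge_half_near_0) (rule that)
  show ?thesis
  \<comment> \<open>One factor 1/2 is the kernel bound, the other allows for rounding the ends of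
    the range to integers.\<close>
  proof (rule that[of "r / 4"])
    fix l :: real assume l: "l > 0"
    have half_less: "q / 2 < q" if "q > 0" for q :: real using that by simp
    have "((\<lambda>y. y + r / l - ln (exp y + 1)) \<longlongrightarrow> r / l) at_top" using l r(1) by real_asymp
    hence "eventually (\<lambda>y. y + r / l - ln (exp y + 1) > r / l / 2) at_top"
    proof (rule order_tendstoD(1))
      have "r / l > 0" using l r(1) by simp
      thus "r / l / 2 < r / l" using half_less[of "r / l"] by blast
    qed
    thus "eventually (\<lambda>y. r / 4 / l \<le> (\<Sum>n. fejer (l * (ln (real n) - y)) / real n)) at_top"
    proof eventually_elim
      case (elim y)
      define a b where "a = nat \<lceil>exp y\<rceil>" and "b = nat \<lfloor>exp (y + r / l)\<rfloor>"
      have a: "exp y \<le> real a" "real a \<le> exp y + 1" unfolding a_def using exp_gt_zero[of y] by linarith+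
      have b: "real b \<le> exp (y + r / l)" "exp (y + r / l) \<le> real (Suc b)"
        unfolding b_def using exp_gt_zero[of "y + r / l"] by linarith+
      have "a > 0" using a(1) exp_gt_zero[of y] by (cases a) auto
      have "1 * (r / l / 2) \<le> y + r / l - ln (exp y + 1)" using elim by simp
      also have "\<dots> \<le> ln (real (Suc b)) - ln (real a)"
      proof (rule diff_mono)
        show "y + r / l \<le> ln (real (Suc b))" using b(2) by (subst ln_ge_iff) auto
        show "ln (real a) \<le> ln (exp y + 1)" using a \<open>a > 0\<close> by (subst ln_le_cancel_iff) (auto intro: add_pos_pos)
      qed
      also have "\<dots> \<le> (\<Sum>n=a..b. 1 / real n)"
      proof (cases "a \<le> Suc b")
        case True
        have "ln (real (Suc b)) - ln (real a) = (\<Sum>n=a..<Suc b. ln (real (Suc n)) - ln (real n))"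
          using sum_Suc_diff'[OF True, of "\<lambda>n. ln (real n)"] by simp
        also have "\<dots> \<le> (\<Sum>n=a..<Suc b. 1 / real n)"
        proof (rule sum_mono)
          fix n assume "n \<in> {a..<Suc b}"
          hence n: "n > 0" using \<open>a > 0\<close> by auto
          thus "ln (real (Suc n)) - ln (real n) \<le> 1 / real n" by (rule ln_Suc_diff_bounds)
        qed
        finally show ?thesis by (simp add: atLeastLessThanSuc_atLeastAtMost)
      next
        case False
        hence "ln (real (Suc b)) - ln (real a) \<le> 0" by simp
        thus ?thesis using False by simp
      qed
      finally have "r / l / 2 \<le> (\<Sum>n=a..b. 1 / real n)" by simp
      hence "1/2 * (r / l / 2) \<le> 1/2 * (\<Sum>n=a..b. 1 / real n)" by (rule mult_left_mono) simp
      also have "1/2 * (r / l / 2) = r / 4 / l" by simp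
      also have "1/2 * (\<Sum>n=a..b. 1 / real n) = (\<Sum>n=a..b. (1/2) / real n)"
        unfolding sum_distrib_left by simp
      also have "\<dots> \<le> (\<Sum>n=a..b. fejer (l * (ln (real n) - y)) / real n)"
      proof (intro sum_mono divide_right_mono r(2))
        fix n assume n: "n \<in> {a..b}"
        hence "n > 0" using \<open>a > 0\<close> by auto
        have "exp y \<le> real n" "real n \<le> exp (y + r / l)" using a b n by auto
        hence "y \<le> ln (real n)" "ln (real n) \<le> y + r / l"
          using \<open>n > 0\<close> by (simp_all add: ln_ge_iff) (metis exp_gt_zero ln_exp ln_le_cancel_iff of_nat_0_less_iff)
        thus "\<bar>l * (ln (real n) - y)\<bar> \<le> r" using l by (simp add: abs_mult field_simps)
      qed auto
      also have "\<dots> \<le> (\<Sum>n. fejer (l * (ln (real n) - y)) / real n)"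
        by (rule sum_le_suminf[OF fejer_weights_summable[OF l]]) (auto simp: fejer_nonneg)
      finally show ?case .
    qed
  qed (use r in auto)
qed

text \<open>
  The kernel weights \<open>W(n) = fejer(l (log n - y))/n\<close> concentrate near \<open>n = exp y\<close> as \<open>l\<close> grows. For fixed
  \<open>l\<close>, the sums of \<open>b(n) W(n)\<close> and of \<open>c W(n)\<close> differ by an oscillating integral of \<open>G\<close> on the line
  \<open>Re s = 1\<close>, which tends to 0 as \<open>y\<close> grows; monotonicity of \<open>n b(n)\<close> then removes the averaging.
\<close>
locale tauberian =
  fixes b :: "nat \<Rightarrow> real" and c :: real and G :: "complex \<Rightarrow> complex"
  assumes nonneg: "\<And>n. b n \<ge> 0"
    and mono: "\<And>m n. m \<le> n \<Longrightarrow> real m * b m \<le> real n * b n"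
    and c_nonneg: "c \<ge> 0"
    and summable_b: "\<And>x. x > 1 \<Longrightarrow> summable (\<lambda>n. b n * real n powr (-x))"
    and G_cont: "continuous_on {s. Re s \<ge> 1} G"
    and G_eq: "\<And>s. Re s > 1 \<Longrightarrow> G s = dirichlet_series (\<lambda>n. of_real (b n - c)) s"
begin

text \<open>At real part 1 + e the identity is \<open>fejer_smoothing\<close> for the coefficients b
  n - c. As e tends to 0 the integral converges because G is continuous up to the line; the two
  series are compared with their limits from one side at a time, using nonnegative terms and
  n^(-1-e) <= 1 / n.\<close>

lemma smoothed_sums:
  assumes l: "l > 0"
  obtains J where "(J \<longlongrightarrow> 0) at_top"
    "\<And>y. (\<lambda>n. b n * (fejer (l * (ln (real n) - y)) / real n)) sums
        (J y + c * (\<Sum>n. fejer (l * (ln (real n) - y)) / real n))"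
proof -
  define J where "J = (\<lambda>e y. Re (integral {-1..1} (\<lambda>t. of_real (1 - \<bar>t\<bar>) * G (Complex (1 + e) (- l * t)) * cis (- l * y * t))))"
  define f where "f = (\<lambda>y n. fejer (l * (ln (real n) - y)))"
  define S where "S = (\<lambda>y. \<Sum>n. f y n / real n)"
  have f_nonneg: "f y n \<ge> 0" for y n by (simp add: f_def fejer_nonneg)
  have S_sums: "(\<lambda>n. f y n / real n) sums S y" for y
    unfolding S_def f_def by (intro summable_sums fejer_weights_summable l)
  have J_cont: "((\<lambda>e. J e y) \<longlongrightarrow> J 0 y) (at_right 0)" for y
  proof -
    have "continuous_on {0..} (\<lambda>e. integral (cbox (-1) 1) (\<lambda>t::real. of_real (1 - \<bar>t\<bar>) * G (Complex (1 + e) (- l * t)) * cis (- l * y * t)))"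
    proof (rule integral_continuous_on_param)
      have "continuous_on ({0..} \<times> cbox (-1) 1) (\<lambda>(e, t). G (Complex (1 + e) (- l * t)))"
        unfolding case_prod_unfold Complex_eq
        by (intro continuous_on_compose2[OF G_cont] continuous_intros) auto
      thus "continuous_on ({0..} \<times> cbox (-1) 1) (\<lambda>(e, t). of_real (1 - \<bar>t\<bar>) * G (Complex (1 + e) (- l * t)) * cis (- l * y * t))"
        unfolding case_prod_unfold cis_conv_exp by (intro continuous_intros)
    qed
    hence "continuous_on {0..} (\<lambda>e. J e y)" unfolding J_def by (intro continuous_intros) simp
    hence "((\<lambda>e. J e y) \<longlongrightarrow> J 0 y) (at 0 within {0..})" by (simp add: continuous_on)
    thus ?thesis by (rule tendsto_within_subset) auto
  qed
  have powr_le: "real n powr (-(1 + e)) \<le> 1 / real n" if "e > 0" for e n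
  proof (cases "n = 0")
    case False
    have "real n powr (-(1 + e)) \<le> real n powr (-1)" using False that by (intro powr_mono) auto
    thus ?thesis using False by (simp add: powr_minus divide_inverse)
  qed simp
  have powr_tendsto: "((\<lambda>e. real n powr (-(1 + e))) \<longlongrightarrow> 1 / real n) (at_right 0)" for n
  proof (cases "n = 0")
    case False
    have "((\<lambda>e. real n powr (-(1 + e))) \<longlongrightarrow> real n powr (-(1 + 0))) (at_right 0)"
      using False by (intro tendsto_intros) auto
    thus ?thesis using False by (simp add: powr_minus divide_inverse)
  qed simp
  have summ1: "summable (\<lambda>n. real n powr (-(1 + e)) * f y n)"
    and summb: "summable (\<lambda>n. b n * real n powr (-(1 + e)) * f y n)"
    and eq: "(\<Sum>n. b n * real n powr (-(1 + e)) * f y n) = J e y + c * (\<Sum>n. real n powr (-(1 + e)) * f y n)"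
    if e: "e > 0" for e y
  proof -
    show 1: "summable (\<lambda>n. real n powr (-(1 + e)) * f y n)"
    proof (rule summable_comparison_test'[OF summable_nat_powr_minus[of "1 + e"], of 0])
      show "norm (real n powr (-(1 + e)) * f y n) \<le> real n powr (-(1 + e))" for n
        using fejer_le_1 f_nonneg[of y n] by (simp add: f_def mult_left_le)
    qed (use e in auto)
    show b: "summable (\<lambda>n. b n * real n powr (-(1 + e)) * f y n)"
    proof (rule summable_comparison_test'[OF summable_b[of "1 + e"], of 0])
      show "norm (b n * real n powr (-(1 + e)) * f y n) \<le> b n * real n powr (-(1 + e))" for n
        using fejer_le_1 f_nonneg[of y n] nonneg[of n] by (simp add: f_def mult_left_le abs_mult)
    qed (use e in auto)
    have "summable (\<lambda>n. \<bar>b n - c\<bar> * real n powr (-(1 + e)))"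
    proof (rule summable_comparison_test'[of "\<lambda>n. b n * real n powr (-(1 + e)) + c * real n powr (-(1 + e))" 0])
      show "summable (\<lambda>n. b n * real n powr (-(1 + e)) + c * real n powr (-(1 + e)))"
        using e by (intro summable_add summable_mult summable_b summable_nat_powr_minus) auto
      have "\<bar>b n - c\<bar> \<le> b n + c" for n using nonneg[of n] c_nonneg by linarith
      hence "\<bar>b n - c\<bar> * real n powr (-(1 + e)) \<le> (b n + c) * real n powr (-(1 + e))" for n
        by (intro mult_right_mono) auto
      thus "norm (\<bar>b n - c\<bar> * real n powr (-(1 + e))) \<le> b n * real n powr (-(1 + e)) + c * real n powr (-(1 + e))" for n
        by (simp add: abs_mult ring_distribs)
    qed
    from fejer_smoothing[OF this, of l y]
    have "(\<lambda>n. (b n - c) * real n powr (-(1 + e)) * f y n) sums J e y"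
      using e by (simp add: J_def f_def G_eq)
    from sums_add[OF this summable_sums[OF summable_mult[OF 1, of c]]]
    show "(\<Sum>n. b n * real n powr (-(1 + e)) * f y n) = J e y + c * (\<Sum>n. real n powr (-(1 + e)) * f y n)"
      unfolding suminf_mult[OF 1] by (simp add: sums_iff algebra_simps)
  qed
  have sum1_le: "(\<Sum>n. real n powr (-(1 + e)) * f y n) \<le> S y" if e: "e > 0" for e y
    unfolding S_def
  proof (rule suminf_le[OF _ summ1[OF e] sums_summable[OF S_sums]])
    show "real n powr (-(1 + e)) * f y n \<le> f y n / real n" for n
      using mult_right_mono[OF powr_le[OF e, of n] f_nonneg[of y n]] by simp
  qed
  \<comment> \<open>Finite partial sums come first: their bound, uniform in N, yields summability at
    e = 0, where the hypotheses on b say nothing.\<close>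
  have upper: "(\<Sum>n<N. b n * (f y n / real n)) \<le> J 0 y + c * S y" for y N
  proof (rule tendsto_le[of "at_right 0"])
    show "((\<lambda>e. \<Sum>n<N. b n * real n powr (-(1 + e)) * f y n) \<longlongrightarrow> (\<Sum>n<N. b n * (f y n / real n))) (at_right 0)"
      by (rule tendsto_eq_rhs[OF tendsto_sum[OF tendsto_mult[OF tendsto_mult[OF tendsto_const powr_tendsto] tendsto_const]]])
         simp
    show "((\<lambda>e. J e y + c * S y) \<longlongrightarrow> J 0 y + c * S y) (at_right 0)"
      by (intro tendsto_intros J_cont)
    have "(\<Sum>n<N. b n * real n powr (-(1 + e)) * f y n) \<le> J e y + c * S y" if e: "e > 0" for e
    proof -
      have "(\<Sum>n<N. b n * real n powr (-(1 + e)) * f y n) \<le> (\<Sum>n. b n * real n powr (-(1 + e)) * f y n)"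
        by (rule sum_le_suminf[OF summb[OF e]]) (auto simp: nonneg f_nonneg)
      also have "\<dots> \<le> J e y + c * S y"
        unfolding eq[OF e] by (intro add_left_mono mult_left_mono sum1_le e c_nonneg)
      finally show ?thesis .
    qed
    thus "eventually (\<lambda>e. (\<Sum>n<N. b n * real n powr (-(1 + e)) * f y n) \<le> J e y + c * S y) (at_right 0)"
      by (auto simp: eventually_at_filter)
  qed simp
  have summ: "summable (\<lambda>n. b n * (f y n / real n))" for y
    by (rule summableI_nonneg_bounded[OF _ upper]) (simp add: nonneg f_nonneg)
  \<comment> \<open>For the reverse inequality it is the comparison sum that is truncated before e
    tends to 0.\<close>
  have lower: "J 0 y + c * (\<Sum>n<N. f y n / real n) \<le> (\<Sum>n. b n * (f y n / real n))" for y N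
  proof (rule tendsto_upperbound)
    show "((\<lambda>e. J e y + c * (\<Sum>n<N. real n powr (-(1 + e)) * f y n)) \<longlongrightarrow> J 0 y + c * (\<Sum>n<N. f y n / real n)) (at_right 0)"
      by (rule tendsto_eq_rhs[OF tendsto_add[OF J_cont tendsto_mult[OF tendsto_const tendsto_sum[OF tendsto_mult[OF powr_tendsto tendsto_const]]]]])
         simp
    have "J e y + c * (\<Sum>n<N. real n powr (-(1 + e)) * f y n) \<le> (\<Sum>n. b n * (f y n / real n))" if e: "e > 0" for e
    proof -
      have "J e y + c * (\<Sum>n<N. real n powr (-(1 + e)) * f y n) \<le> J e y + c * (\<Sum>n. real n powr (-(1 + e)) * f y n)"
        by (intro add_left_mono mult_left_mono c_nonneg sum_le_suminf[OF summ1[OF e]]) (auto simp: f_nonneg)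
      also have "\<dots> = (\<Sum>n. b n * real n powr (-(1 + e)) * f y n)" by (rule eq[OF e, symmetric])
      also have "\<dots> \<le> (\<Sum>n. b n * (f y n / real n))"
      proof (rule suminf_le[OF _ summb[OF e] summ])
        show "b n * real n powr (-(1 + e)) * f y n \<le> b n * (f y n / real n)" for n
          using mult_left_mono[OF mult_right_mono[OF powr_le[OF e, of n] f_nonneg[of y n]] nonneg[of n]]
          by (simp add: mult.assoc)
      qed
      finally show ?thesis .
    qed
    thus "eventually (\<lambda>e. J e y + c * (\<Sum>n<N. real n powr (-(1 + e)) * f y n) \<le> (\<Sum>n. b n * (f y n / real n))) (at_right 0)"
      by (auto simp: eventually_at_filter)
  qed simp
  have "(\<Sum>n. b n * (f y n / real n)) = J 0 y + c * S y" for y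
  proof (rule antisym)
    show "(\<Sum>n. b n * (f y n / real n)) \<le> J 0 y + c * S y"
      by (rule suminf_le_const[OF summ upper])
    have "(\<lambda>N. J 0 y + c * (\<Sum>n<N. f y n / real n)) \<longlonglongrightarrow> J 0 y + c * S y"
      using S_sums[of y] by (intro tendsto_intros) (simp add: sums_def)
    thus "J 0 y + c * S y \<le> (\<Sum>n. b n * (f y n / real n))"
      by (rule LIMSEQ_le_const2) (use lower in auto)
  qed
  hence sums: "(\<lambda>n. b n * (f y n / real n)) sums (J 0 y + c * S y)" for y
    using summ[of y] by (simp add: sums_iff)
  \<comment> \<open>The maximum with 0 extends the triangle continuously to the whole line with
    support in [-1, 1], as the Riemann-Lebesgue lemma requires.\<close>
  define g where "g = (\<lambda>t. of_real (max 0 (1 - \<bar>t\<bar>)) * G (Complex 1 (- l * t)))"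
  have "continuous_on UNIV (\<lambda>t. G (Complex 1 (- l * t)))"
    unfolding Complex_eq by (intro continuous_on_compose2[OF G_cont] continuous_intros) auto
  hence "((\<lambda>v. integral {-1..1} (\<lambda>t. g t * cis (- v * t))) \<longlongrightarrow> 0) at_top"
    by (intro riemann_lebesgue_compact_support) (auto simp: g_def intro!: continuous_intros)
  moreover have "filterlim (\<lambda>y. l * y) at_top at_top"
    using l by (rule filterlim_tendsto_pos_mult_at_top[OF tendsto_const _ filterlim_ident])
  ultimately have "((\<lambda>y. integral {-1..1} (\<lambda>t. g t * cis (- (l * y) * t))) \<longlongrightarrow> 0) at_top"
    by (rule filterlim_compose)
  hence "((\<lambda>y. Re (integral {-1..1} (\<lambda>t. g t * cis (- (l * y) * t)))) \<longlongrightarrow> Re 0) at_top"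
    by (rule tendsto_Re)
  moreover have "Re (integral {-1..1} (\<lambda>t. g t * cis (- (l * y) * t))) = J 0 y" for y
    unfolding J_def by (intro arg_cong[of _ _ Re] integral_cong) (auto simp: g_def max_def)
  ultimately have "(J 0 \<longlongrightarrow> 0) at_top" by simp
  thus ?thesis using sums unfolding S_def f_def by (rule that)
qed

text \<open>Common input of the two one-sided estimates: S is the total mass, T the mass outside the
  window of radius h, J the oscillating error. Smallness is measured against S, because only a lower
  bound r / l for S is known and l must be large.\<close>

lemma concentration:
  assumes h: "h > 0" and e: "e > 0"
  obtains W :: "real \<Rightarrow> nat \<Rightarrow> real" and J S T :: "real \<Rightarrow> real"
  where "\<And>y n. W y n \<ge> 0" "\<And>y. W y 0 = 0" "\<And>y. W y sums S y"
    "\<And>y. (\<lambda>n. if \<bar>ln (real n) - y\<bar> > h then W y n else 0) sums T y"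
    "\<And>y. (\<lambda>n. b n * W y n) sums (J y + c * S y)"
    "eventually (\<lambda>y. S y > 0 \<and> T y \<le> e * S y \<and> \<bar>J y\<bar> \<le> e * S y) at_top"
proof -
  obtain D where D: "D > 0" "\<And>l y. l > 0 \<Longrightarrow>
    (\<Sum>n. if \<bar>ln (real n) - y\<bar> > h then fejer (l * (ln (real n) - y)) / real n else 0) \<le> D / l\<^sup>2"
    by (rule fejer_weights_tail[OF h]) (rule that)
  obtain r where r: "r > 0" "\<And>l. l > 0 \<Longrightarrow>
    eventually (\<lambda>y. r / l \<le> (\<Sum>n. fejer (l * (ln (real n) - y)) / real n)) at_top"
    by (rule fejer_weights_lower_bound) (rule that)
  \<comment> \<open>This value makes the tail bound D / l^2 equal to e times the lower bound r / l
    for the mass.\<close>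
  define l where "l = D / (e * r)"
  have l: "l > 0" using D(1) e r(1) by (simp add: l_def)
  have l_eq: "D / l\<^sup>2 = e * (r / l)" using D(1) e r(1) by (simp add: l_def power2_eq_square field_simps)
  obtain J where J: "(J \<longlongrightarrow> 0) at_top"
    "\<And>y. (\<lambda>n. b n * (fejer (l * (ln (real n) - y)) / real n)) sums
        (J y + c * (\<Sum>n. fejer (l * (ln (real n) - y)) / real n))"
    by (rule smoothed_sums[OF l]) (rule that)
  define W where "W = (\<lambda>y n. fejer (l * (ln (real n) - y)) / real n)"
  define S where "S = (\<lambda>y. suminf (W y))"
  define T where "T = (\<lambda>y. \<Sum>n. if \<bar>ln (real n) - y\<bar> > h then W y n else 0)"
  have W_nonneg: "W y n \<ge> 0" for y n by (simp add: W_def fejer_nonneg)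
  have W_summable: "summable (W y)" for y unfolding W_def by (rule fejer_weights_summable[OF l])
  have T_summable: "summable (\<lambda>n. if \<bar>ln (real n) - y\<bar> > h then W y n else 0)" for y
    by (rule summable_comparison_test'[OF W_summable[of y], of 0]) (simp add: W_nonneg)
  have T_le: "T y \<le> e * (r / l)" for y
    using D(2)[OF l, of y] unfolding T_def W_def l_eq .
  have pos: "e * (r / l) > 0" using e r(1) l by simp
  have "eventually (\<lambda>y. \<bar>J y\<bar> < e * (r / l)) at_top"
    using tendstoD[OF J(1) pos] by (simp add: dist_norm)
  with r(2)[OF l] have ev: "eventually (\<lambda>y. S y > 0 \<and> T y \<le> e * S y \<and> \<bar>J y\<bar> \<le> e * S y) at_top"
  proof eventually_elim
    case (elim y)
    have S: "r / l \<le> S y" using elim(1) by (simp add: S_def W_def)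
    hence "e * (r / l) \<le> e * S y" using e by (intro mult_left_mono) auto
    moreover have "r / l > 0" using r(1) l by simp
    ultimately show ?case using S elim(2) T_le[of y] by linarith
  qed
  show ?thesis
  proof (rule that[of W S T J])
    show "(\<lambda>n. b n * W y n) sums (J y + c * S y)" for y
      using J(2)[of y] by (simp add: W_def S_def)
  qed (use W_nonneg ev W_summable T_summable in \<open>auto simp: S_def T_def W_def intro!: summable_sums\<close>)
qed

text \<open>The kernel is centred at y = ln N + h, so its window is N <= n <= N exp (2h). There the
  monotonicity of n b(n) gives b(n) >= b(N) exp (-2h), while the weighted average of b is about
  c.\<close>

lemma eventually_le:
  assumes h: "h > 0" and e: "0 < e" "e < 1"
  shows "eventually (\<lambda>N. b N \<le> exp (2 * h) * (c + e) / (1 - e)) sequentially"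
proof -
  obtain W :: "real \<Rightarrow> nat \<Rightarrow> real" and J S T :: "real \<Rightarrow> real"
    where W: "\<And>y n. W y n \<ge> 0" "\<And>y. W y 0 = 0" "\<And>y. W y sums S y"
    "\<And>y. (\<lambda>n. if \<bar>ln (real n) - y\<bar> > h then W y n else 0) sums T y"
    "\<And>y. (\<lambda>n. b n * W y n) sums (J y + c * S y)"
    and ev: "eventually (\<lambda>y. S y > 0 \<and> T y \<le> e * S y \<and> \<bar>J y\<bar> \<le> e * S y) at_top"
    by (rule concentration[OF h e(1)]) (rule that)
  have "filterlim (\<lambda>N. ln (real N) + h) at_top sequentially" by real_asymp
  from eventually_compose_filterlim[OF ev this] eventually_gt_at_top[of 0]
  show ?thesis
  proof eventually_elim
    case (elim N)
    define y where "y = ln (real N) + h"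
    have S: "S y > 0" "T y \<le> e * S y" "\<bar>J y\<bar> \<le> e * S y" using elim by (auto simp: y_def)
    have "b N * exp (- 2 * h) * (W y n - (if \<bar>ln (real n) - y\<bar> > h then W y n else 0)) \<le> b n * W y n" for n
    proof (cases "n = 0 \<or> \<bar>ln (real n) - y\<bar> > h")
      case True
      thus ?thesis using W(1,2) nonneg by auto
    next
      case False
      hence n: "n > 0" "ln (real N) \<le> ln (real n)" "ln (real n) \<le> ln (real N) + 2 * h"
        by (auto simp: y_def)
      hence Nn: "N \<le> n" using elim(2) by simp
      have "real n = exp (ln (real n))" using n(1) by simp
      also have "\<dots> \<le> exp (ln (real N) + 2 * h)" using n(3) by simp
      also have "\<dots> = real N * exp (2 * h)" using elim(2) by (simp add: exp_add)
      finally have "exp (- 2 * h) * real n \<le> real N" by (simp add: exp_minus field_simps)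
      hence "b N * exp (- 2 * h) * real n \<le> real N * b N"
        using mult_left_mono[of "exp (- 2 * h) * real n" "real N" "b N"] nonneg by (simp add: mult_ac)
      also have "\<dots> \<le> b n * real n" using mono[OF Nn] by (simp add: mult.commute)
      finally have "b N * exp (- 2 * h) \<le> b n" using n(1) by simp
      thus ?thesis using False W(1)[of y n] by (auto intro: mult_right_mono)
    qed
    from sums_le[OF this sums_mult[OF sums_diff[OF W(3,4)]] W(5)]
    have "b N * exp (- 2 * h) * (S y - T y) \<le> J y + c * S y" .
    moreover have "b N * exp (- 2 * h) * ((1 - e) * S y) \<le> b N * exp (- 2 * h) * (S y - T y)"
      using S nonneg[of N] by (intro mult_left_mono) (auto simp: algebra_simps)
    ultimately have "(b N * exp (- 2 * h) * (1 - e)) * S y \<le> (c + e) * S y"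
      using S(3) by (simp add: algebra_simps)
    hence "b N * exp (- 2 * h) * (1 - e) \<le> c + e" using S(1) by simp
    thus ?case using e by (simp add: exp_minus field_simps)
  qed
qed

text \<open>A preliminary bound from one choice of parameters; the lower estimate uses it to control
  b outside the window.\<close>

lemma bounded: obtains M where "\<And>n. b n \<le> M" "M \<ge> 0"
proof -
  have "Bseq b"
    by (rule BfunI[of _ "exp (2 * 1) * (c + 1/2) / (1 - 1/2)"], rule eventually_mono[OF eventually_le[of 1 "1/2"]])
       (auto simp: nonneg)
  then obtain M where M: "\<And>n. norm (b n) \<le> M" using BseqD[OF \<open>Bseq b\<close>] by blast
  have "b n \<le> M" for n using M[of n] nonneg[of n] by simp
  moreover have "M \<ge> 0" using M[of 0] norm_ge_zero order_trans by blast
  ultimately show ?thesis by (rule that)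
qed

text \<open>The mirror image, with a window ending at N. The terms outside the window now work
  against the estimate, and M bounds them.\<close>

lemma eventually_ge:
  assumes M: "\<And>n. b n \<le> M" "M \<ge> 0" and h: "h > 0" and e: "0 < e"
  shows "eventually (\<lambda>N. b N \<ge> exp (- 2 * h) * (c - e - M * e)) sequentially"
proof -
  obtain W :: "real \<Rightarrow> nat \<Rightarrow> real" and J S T :: "real \<Rightarrow> real"
    where W: "\<And>y n. W y n \<ge> 0" "\<And>y. W y 0 = 0" "\<And>y. W y sums S y"
    "\<And>y. (\<lambda>n. if \<bar>ln (real n) - y\<bar> > h then W y n else 0) sums T y"
    "\<And>y. (\<lambda>n. b n * W y n) sums (J y + c * S y)"
    and ev: "eventually (\<lambda>y. S y > 0 \<and> T y \<le> e * S y \<and> \<bar>J y\<bar> \<le> e * S y) at_top"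
    by (rule concentration[OF h e]) (rule that)
  have "filterlim (\<lambda>N. ln (real N) - h) at_top sequentially" by real_asymp
  from eventually_compose_filterlim[OF ev this] eventually_gt_at_top[of 0]
  show ?thesis
  proof eventually_elim
    case (elim N)
    define y where "y = ln (real N) - h"
    have S: "S y > 0" "T y \<le> e * S y" "\<bar>J y\<bar> \<le> e * S y" using elim by (auto simp: y_def)
    have "b n * W y n \<le> b N * exp (2 * h) * W y n + M * (if \<bar>ln (real n) - y\<bar> > h then W y n else 0)" for n
    proof (cases "n = 0 \<or> \<bar>ln (real n) - y\<bar> > h")
      case True
      have "b n * W y n \<le> M * W y n" using M(1) W(1) by (intro mult_right_mono)
      moreover have "0 \<le> b N * exp (2 * h) * W y n" using W(1) nonneg by simp
      ultimately show ?thesis using True W(2) by auto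
    next
      case False
      hence n: "n > 0" "ln (real n) \<le> ln (real N)" "ln (real N) \<le> ln (real n) + 2 * h"
        by (auto simp: y_def)
      hence Nn: "n \<le> N" using elim(2) by simp
      have "real N = exp (ln (real N))" using elim(2) by simp
      also have "\<dots> \<le> exp (ln (real n) + 2 * h)" using n(3) by simp
      also have "\<dots> = real n * exp (2 * h)" using n(1) by (simp add: exp_add)
      finally have N: "real N \<le> real n * exp (2 * h)" .
      have "b n * real n \<le> real N * b N" using mono[OF Nn] by (simp add: mult.commute)
      also have "\<dots> \<le> (real n * exp (2 * h)) * b N" using N nonneg by (intro mult_right_mono)
      finally have "b n * real n \<le> (b N * exp (2 * h)) * real n" by (simp add: mult_ac)
      hence "b n \<le> b N * exp (2 * h)" using n(1) by simp
      thus ?thesis using False W(1)[of y n] by (auto intro: mult_right_mono)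
    qed
    from sums_le[OF this W(5) sums_add[OF sums_mult[OF W(3)] sums_mult[OF W(4)]]]
    have "J y + c * S y \<le> b N * exp (2 * h) * S y + M * T y" .
    moreover have "M * T y \<le> M * (e * S y)" using S(2) M(2) by (rule mult_left_mono)
    ultimately have "(c - e - M * e) * S y \<le> (b N * exp (2 * h)) * S y"
      using S(3) by (simp add: algebra_simps)
    hence "c - e - M * e \<le> b N * exp (2 * h)" using S(1) by simp
    thus ?case by (simp add: exp_minus field_simps)
  qed
qed

theorem tauberian_limit: "b \<longlonglongrightarrow> c"
proof (rule order_tendstoI)
  fix a assume a: "a > c"
  \<comment> \<open>A single parameter serves both as window radius and as tolerance.\<close>
  have "((\<lambda>e. exp (2 * e) * (c + e) / (1 - e)) \<longlongrightarrow> exp (2 * 0) * (c + 0) / (1 - 0)) (at_right 0)"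
    by (intro tendsto_intros) auto
  hence "eventually (\<lambda>e. exp (2 * e) * (c + e) / (1 - e) < a) (at_right 0)"
    using a by (intro order_tendstoD(2)) auto
  moreover have "eventually (\<lambda>e::real. e \<in> {0<..<1}) (at_right 0)"
    by (rule eventually_at_right_real) simp
  ultimately have "eventually (\<lambda>e. exp (2 * e) * (c + e) / (1 - e) < a \<and> e \<in> {0<..<1}) (at_right 0)"
    by (rule eventually_conj)
  then obtain e where e: "exp (2 * e) * (c + e) / (1 - e) < a" "0 < e" "e < 1"
    using eventually_happens'[of "at_right (0::real)"] by fastforce
  show "eventually (\<lambda>N. b N < a) sequentially"
    using eventually_le[OF e(2) e(2,3)] by eventually_elim (use e(1) in linarith)
next
  fix a assume a: "a < c"
  obtain M where M: "\<And>n. b n \<le> M" "M \<ge> 0" by (rule bounded) (rule that)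
  have "((\<lambda>e. exp (- 2 * e) * (c - e - M * e)) \<longlongrightarrow> exp (- 2 * 0) * (c - 0 - M * 0)) (at_right 0)"
    by (intro tendsto_intros)
  hence "eventually (\<lambda>e. exp (- 2 * e) * (c - e - M * e) > a) (at_right 0)"
    using a by (intro order_tendstoD(1)) auto
  moreover have "eventually (\<lambda>e::real. e \<in> {0<..<1}) (at_right 0)"
    by (rule eventually_at_right_real) simp
  ultimately have "eventually (\<lambda>e. exp (- 2 * e) * (c - e - M * e) > a \<and> e \<in> {0<..<1}) (at_right 0)"
    by (rule eventually_conj)
  then obtain e where e: "exp (- 2 * e) * (c - e - M * e) > a" "0 < e"
    using eventually_happens'[of "at_right (0::real)"] by fastforce
  show "eventually (\<lambda>N. b N > a) sequentially"
    using eventually_ge[OF M e(2) e(2)] by eventually_elim (use e(1) in linarith)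
qed

end

subsection \<open>Primes in unions of residue classes\<close>

text \<open>The discrete logarithm to a primitive root g identifies the units modulo p with the
  residues modulo p - 1; \<open>chi\<close> sends g to a root of unity of exact order p - 1.\<close>

lemma faithful_dchar_exists:
  assumes "prime p"
  obtains chi where "dchar p chi"
    "\<And>m n. \<not> p dvd m \<Longrightarrow> \<not> p dvd n \<Longrightarrow> chi m = chi n \<Longrightarrow> [m = n] (mod p)"
    "\<And>n. \<not> p dvd n \<Longrightarrow> chi n ^ (p - 1) = 1"
    "\<And>k. 0 < k \<Longrightarrow> k < p - 1 \<Longrightarrow> \<exists>n. \<not> p dvd n \<and> chi n ^ k \<noteq> 1"
proof -
  have p: "p > 1" using assms by (rule prime_gt_1_nat)
  obtain g where g: "residue_primroot p g" using prime_primitive_root_exists[of p] assms p by auto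
  have cop: "coprime p g" and ord: "ord p g = p - 1"
    using g assms by (auto simp: residue_primroot_def totient_prime)
  define e where "e = (\<lambda>i::nat. exp (2 * of_real pi * \<i> * of_nat i / of_nat (p - 1)))"
  have e_eq: "e i = e j \<longleftrightarrow> [i = j] (mod (p - 1))" for i j
    unfolding e_def Cong.cong_def by (rule complex_root_unity_eq) (use p in auto)
  have e_add: "e (i + j) = e i * e j" for i j
    by (simp add: e_def exp_add[symmetric] add_divide_distrib ring_distribs)
  have e_0: "e 0 = 1" by (simp add: e_def)
  have e_mult: "e (i * k) = e i ^ k" for i k
    by (induction k) (simp_all add: e_0 e_add)
  have norm_e: "norm (e i) = 1" for i by (simp add: e_def norm_exp_eq_Re)
  have g_eq: "[g ^ i = g ^ j] (mod p) \<longleftrightarrow> [i = j] (mod (p - 1))" for i j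
    using order_divides_expdiff[of p g i j] cop ord by (simp add: coprime_commute)
  have g_surj: "\<exists>i. [g ^ i = n] (mod p)" if "\<not> p dvd n" for n
  proof -
    have "n mod p \<in> totatives p"
      using that p assms by (auto simp: totatives_prime mod_greater_zero_iff_not_dvd)
    hence "n mod p \<in> (\<lambda>i. g ^ i mod p) ` {..<totient p}"
      using residue_primroot_is_generator[OF p g] by (simp add: bij_betw_def)
    thus ?thesis by (auto simp: Cong.cong_def)
  qed
  \<comment> \<open>Any choice gives the same \<open>chi\<close>, as \<open>e\<close> depends on the
    exponent modulo p - 1 only. The predicate sees only the residue of n, so \<open>ind\<close> is
    literally periodic.\<close>
  define ind where "ind = (\<lambda>n. SOME i. [g ^ i = n] (mod p))"
  have ind: "[g ^ ind n = n] (mod p)" if "\<not> p dvd n" for n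
    unfolding ind_def by (rule someI_ex) (rule g_surj[OF that])
  define chi where "chi = (\<lambda>n. if p dvd n then 0 else e (ind n))"
  have chi_eq: "chi n = e i" if "\<not> p dvd n" "[g ^ i = n] (mod p)" for n i
  proof -
    have "[g ^ ind n = g ^ i] (mod p)" using ind[OF that(1)] that(2) cong_sym cong_trans by blast
    thus ?thesis using that(1) by (simp add: chi_def e_eq g_eq)
  qed
  have g_unit: "\<not> p dvd g ^ i" for i
    using cop assms p by (metis coprime_absorb_left coprime_power_right_iff is_unit_power_iff nat_neq_iff prime_dvd_power not_prime_unit)
  show ?thesis
  proof (rule that)
    show "dchar p chi"
    proof
      fix m n
      show "chi (m * n) = chi m * chi n"
      proof (cases "p dvd m \<or> p dvd n")
        case False
        hence *: "\<not> p dvd m" "\<not> p dvd n" "\<not> p dvd m * n" using assms by (auto simp: prime_dvd_mult_iff)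
        have "[g ^ (ind m + ind n) = m * n] (mod p)"
          unfolding power_add by (intro cong_mult ind *)
        thus ?thesis using chi_eq[OF *(3)] * by (simp add: chi_def e_add)
      qed (auto simp: chi_def)
      show "chi (n + p) = chi n"
        by (simp add: chi_def ind_def Cong.cong_def)
    qed (auto simp: chi_def norm_e assms)
    show "[m = n] (mod p)" if "\<not> p dvd m" "\<not> p dvd n" "chi m = chi n" for m n
    proof -
      have "[g ^ ind m = g ^ ind n] (mod p)" using that by (simp add: chi_def e_eq g_eq)
      thus ?thesis using ind[OF that(1)] ind[OF that(2)] cong_sym cong_trans by meson
    qed
    show "chi n ^ (p - 1) = 1" if "\<not> p dvd n" for n
      using that e_eq[of "ind n * (p - 1)" 0] by (simp add: chi_def e_mult e_0 Cong.cong_def)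
    show "\<exists>n. \<not> p dvd n \<and> chi n ^ k \<noteq> 1" if k: "0 < k" "k < p - 1" for k
    proof (intro exI conjI)
      show "\<not> p dvd g ^ 1" by (rule g_unit)
      have "chi (g ^ 1) = e 1" by (rule chi_eq[OF g_unit]) simp
      moreover have "e k \<noteq> e 0" unfolding e_eq using k by (simp add: Cong.cong_def)
      ultimately show "chi (g ^ 1) ^ k \<noteq> 1" using e_mult[of 1 k] e_0 by simp
    qed
  qed
qed

lemma sum_powers_root_of_unity:
  fixes z :: complex
  assumes "z ^ N = 1" "N > 0"
  shows "(\<Sum>k=1..N. z ^ k) = (if z = 1 then of_nat N else 0)"
proof (cases "z = 1")
  case False
  have "(\<Sum>k=1..N. z ^ k) = z * (\<Sum>k<N. z ^ k)"
    unfolding sum_distrib_left by (rule sum.reindex_bij_witness[of _ Suc "\<lambda>k. k - 1"]) (auto simp: power_eq_if)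
  thus ?thesis using False assms by (simp add: geometric_sum)
qed simp

text \<open>Orthogonality for the powers of one faithful character. The exponents run from 1 to p -
  1 instead of from 0: every power then vanishes at multiples of p, where 0^0 would be 1, and the
  principal character appears as k = p - 1.\<close>

lemma residue_indicator_expansion:
  fixes Q :: "nat \<Rightarrow> bool"
  assumes "prime p" and Q: "\<And>n. Q (n mod p) = Q n" and Q0: "\<not> Q 0"
  obtains chi C where "dchar p chi"
    "\<And>k. k \<in> {1..p-1} \<Longrightarrow> dchar.principal p (\<lambda>n. chi n ^ k) \<longleftrightarrow> k = p - 1"
    "\<And>n. (if Q n then 1 else 0) = (\<Sum>k=1..p-1. C k * chi n ^ k)"
    "C (p - 1) = of_real (real (card {a\<in>{1..p-1}. Q a}) / real (p - 1))"
proof -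
  have p: "p > 1" using assms(1) by (rule prime_gt_1_nat)
  obtain chi where chi: "dchar p chi"
    "\<And>m n. \<not> p dvd m \<Longrightarrow> \<not> p dvd n \<Longrightarrow> chi m = chi n \<Longrightarrow> [m = n] (mod p)"
    "\<And>n. \<not> p dvd n \<Longrightarrow> chi n ^ (p - 1) = 1"
    "\<And>k. 0 < k \<Longrightarrow> k < p - 1 \<Longrightarrow> \<exists>n. \<not> p dvd n \<and> chi n ^ k \<noteq> 1"
    by (rule faithful_dchar_exists[OF assms(1)]) (rule that)
  interpret dchar p chi by fact
  define A where "A = {a\<in>{1..p-1}. Q a}"
  have A: "\<not> p dvd a" if "a \<in> A" for a using that by (auto simp: A_def nat_dvd_not_less)
  \<comment> \<open>Finite Fourier coefficients of the indicator. At k = p - 1 all summands are 1,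
    so this coefficient is a density.\<close>
  define C where "C = (\<lambda>k. (\<Sum>a\<in>A. cnj (chi a) ^ k) / of_nat (p - 1))"
  show ?thesis
  proof (rule that[OF chi(1), of C])
    fix k assume k: "k \<in> {1..p-1}"
    interpret c: dchar p "\<lambda>n. chi n ^ k" by (rule dchar_power) (use k in auto)
    show "dchar.principal p (\<lambda>n. chi n ^ k) \<longleftrightarrow> k = p - 1"
      using chi(3,4) k unfolding c.principal_def by (metis atLeastAtMost_iff le_neq_implies_less less_le_trans zero_less_one)
  next
    fix n
    show "(if Q n then 1 else 0) = (\<Sum>k=1..p-1. C k * chi n ^ k)"
    proof (cases "p dvd n")
      case True
      hence "n mod p = 0" by simp
      hence "\<not> Q n" using Q[of n] Q0 by simp
      thus ?thesis using True zero by (simp add: power_0_left)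
    next
      case False
      have "(\<Sum>k=1..p-1. C k * chi n ^ k) = (\<Sum>a\<in>A. \<Sum>k=1..p-1. (cnj (chi a) * chi n) ^ k) / of_nat (p - 1)"
        unfolding C_def by (subst sum.swap) (simp add: sum_divide_distrib sum_distrib_right power_mult_distrib)
      also have "(\<Sum>a\<in>A. \<Sum>k=1..p-1. (cnj (chi a) * chi n) ^ k) = (\<Sum>a\<in>A. if a = n mod p then of_nat (p - 1) else 0)"
      proof (rule sum.cong[OF refl])
        fix a assume a: "a \<in> A"
        have eq1: "cnj (chi a) * chi a = 1"
          using norm_unit[OF A[OF a]] complex_norm_square[of "chi a"] by (simp add: mult.commute)
        have "(cnj (chi a) * chi n) ^ (p - 1) = 1"
          using chi(3)[OF A[OF a]] chi(3)[OF False] by (simp add: power_mult_distrib flip: complex_cnj_power)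
        hence "(\<Sum>k=1..p-1. (cnj (chi a) * chi n) ^ k) = (if cnj (chi a) * chi n = 1 then of_nat (p - 1) else 0)"
          by (rule sum_powers_root_of_unity) (use p in simp)
        moreover have "cnj (chi a) * chi n = 1 \<longleftrightarrow> a = n mod p"
        proof
          assume "cnj (chi a) * chi n = 1"
          hence "chi a = chi a * (cnj (chi a) * chi n)" by simp
          also have "\<dots> = chi n" using eq1 by (metis mult.assoc mult.commute mult.left_neutral)
          finally have "[a = n] (mod p)" by (rule chi(2)[OF A[OF a] False])
          thus "a = n mod p" using a p by (auto simp: A_def Cong.cong_def)
        next
          assume "a = n mod p"
          thus "cnj (chi a) * chi n = 1" using eq1 mod_p[of n] by simp
        qed
        ultimately show "(\<Sum>k=1..p-1. (cnj (chi a) * chi n) ^ k) = (if a = n mod p then of_nat (p - 1) else 0)" by simp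
      qed
      also have "\<dots> = (if n mod p \<in> A then of_nat (p - 1) else 0)" by (simp add: A_def)
      also have "n mod p \<in> A \<longleftrightarrow> Q n"
      proof -
        have "0 < n mod p" "n mod p < p" using False p by (auto simp: mod_greater_zero_iff_not_dvd)
        thus ?thesis using Q[of n] by (auto simp: A_def)
      qed
      finally show ?thesis using p by simp
    qed
  next
    have "(\<Sum>a\<in>A. cnj (chi a) ^ (p - 1)) = (\<Sum>a\<in>A. 1)"
      by (rule sum.cong) (use chi(3) A in \<open>simp_all flip: complex_cnj_power\<close>)
    thus "C (p - 1) = of_real (real (card {a\<in>{1..p-1}. Q a}) / real (p - 1))"
      by (simp add: C_def A_def)
  qed
qed

text \<open>Among the powers only k = p - 1 is principal, so the residue at 1 is its coefficient,
  the proportion of units that satisfy Q.\<close>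

lemma mangoldt_residue_series:
  fixes Q :: "nat \<Rightarrow> bool"
  assumes "prime p" and Q: "\<And>n. Q (n mod p) = Q n" and Q0: "\<not> Q 0"
  obtains G where "continuous_on {s. Re s \<ge> 1} G"
    "\<And>s. Re s > 1 \<Longrightarrow> dirichlet_series (\<lambda>n. if Q n then mangoldt n else 0) s =
        of_real (real (card {a\<in>{1..p-1}. Q a}) / real (p - 1)) / (s - 1) + G s"
proof -
  have p: "p > 1" using assms(1) by (rule prime_gt_1_nat)
  obtain chi C where chi: "dchar p chi"
    "\<And>k. k \<in> {1..p-1} \<Longrightarrow> dchar.principal p (\<lambda>n. chi n ^ k) \<longleftrightarrow> k = p - 1"
    "\<And>n. (if Q n then 1 else 0) = (\<Sum>k=1..p-1. C k * chi n ^ k)"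
    "C (p - 1) = of_real (real (card {a\<in>{1..p-1}. Q a}) / real (p - 1))"
    by (rule residue_indicator_expansion[OF assms]) (rule that)
  define R where "R = (\<lambda>k G. continuous_on {s. Re s \<ge> 1} G \<and> (\<forall>s. Re s > 1 \<longrightarrow>
      (\<lambda>n. chi n ^ k * mangoldt n * of_nat n powr (-s)) sums ((if k = p - 1 then 1 else 0) / (s - 1) + G s)))"
  have "\<forall>k\<in>{1..p-1}. \<exists>G. R k G"
  proof
    fix k assume k: "k \<in> {1..p-1}"
    interpret dchar p "\<lambda>n. chi n ^ k" by (rule dchar.dchar_power[OF chi(1)]) (use k in auto)
    obtain G where G: "continuous_on {s. Re s \<ge> 1} G"
      "\<And>s. Re s > 1 \<Longrightarrow> dirichlet_series (\<lambda>n. chi n ^ k * mangoldt n) s = of_nat order1 / (s - 1) + G s"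
      by (rule P_minus_pole_continuous) (rule that)
    have "(\<lambda>n. chi n ^ k * mangoldt n * of_nat n powr (-s)) sums ((if k = p - 1 then 1 else 0) / (s - 1) + G s)"
      if s: "Re s > 1" for s
    proof -
      have "summable (\<lambda>n. chi n ^ k * mangoldt n * of_nat n powr (-s))"
        by (rule dirichlet_series_holomorphic(2)[of 1, OF _ s]) (rule abs_summable_mangoldt)
      thus ?thesis using G(2)[OF s] chi(2)[OF k]
        by (simp add: dirichlet_series_def sums_iff order1_def)
    qed
    thus "\<exists>G. R k G" unfolding R_def using G(1) by (intro exI[of _ G] conjI allI impI)
  qed
  then obtain G where "\<forall>k\<in>{1..p-1}. R k (G k)" using bchoice[of "{1..p-1}" R] by blast
  hence G: "\<And>k. k \<in> {1..p-1} \<Longrightarrow> continuous_on {s. Re s \<ge> 1} (G k)"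
    "\<And>k s. k \<in> {1..p-1} \<Longrightarrow> Re s > 1 \<Longrightarrow>
      (\<lambda>n. chi n ^ k * mangoldt n * of_nat n powr (-s)) sums ((if k = p - 1 then 1 else 0) / (s - 1) + G k s)"
    unfolding R_def by simp_all
  show ?thesis
  proof (rule that[of "\<lambda>s. \<Sum>k=1..p-1. C k * G k s"])
    show "continuous_on {s. Re s \<ge> 1} (\<lambda>s. \<Sum>k=1..p-1. C k * G k s)"
      by (intro continuous_intros G)
    fix s :: complex assume s: "Re s > 1"
    have "(\<lambda>n. \<Sum>k=1..p-1. C k * (chi n ^ k * mangoldt n * of_nat n powr (-s))) sums
        (\<Sum>k=1..p-1. C k * ((if k = p - 1 then 1 else 0) / (s - 1) + G k s))"
      by (intro sums_sum sums_mult G(2) s)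
    also have "(\<lambda>n. \<Sum>k=1..p-1. C k * (chi n ^ k * mangoldt n * of_nat n powr (-s))) =
        (\<lambda>n. (if Q n then mangoldt n else 0) * of_nat n powr (-s))"
    proof
      fix n
      have "(\<Sum>k=1..p-1. C k * (chi n ^ k * mangoldt n * of_nat n powr (-s))) =
          (\<Sum>k=1..p-1. C k * chi n ^ k) * (mangoldt n * of_nat n powr (-s))"
        unfolding sum_distrib_right by (intro sum.cong refl) simp
      also have "(\<Sum>k=1..p-1. C k * chi n ^ k) = (if Q n then 1 else 0)" by (rule chi(3)[symmetric])
      finally have eq: "(\<Sum>k=1..p-1. C k * (chi n ^ k * mangoldt n * of_nat n powr (-s))) =
          (if Q n then 1 else 0) * (mangoldt n * of_nat n powr (-s))" .
      show "(\<Sum>k=1..p-1. C k * (chi n ^ k * mangoldt n * of_nat n powr (-s))) =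
          (if Q n then mangoldt n else 0) * of_nat n powr (-s)"
        unfolding eq by simp
    qed
    also have "(\<Sum>k=1..p-1. C k * ((if k = p - 1 then 1 else 0) / (s - 1) + G k s)) =
        C (p - 1) / (s - 1) + (\<Sum>k=1..p-1. C k * G k s)"
    proof -
      have "(\<Sum>k=1..p-1. C k * ((if k = p - 1 then 1 else 0) / (s - 1))) =
          (\<Sum>k=1..p-1. if k = p - 1 then C k / (s - 1) else 0)"
        by (intro sum.cong) auto
      also have "\<dots> = C (p - 1) / (s - 1)" using p by simp
      finally show ?thesis by (simp add: distrib_left sum.distrib)
    qed
    finally show "dirichlet_series (\<lambda>n. if Q n then mangoldt n else 0) s =
        of_real (real (card {a\<in>{1..p-1}. Q a}) / real (p - 1)) / (s - 1) + (\<Sum>k=1..p-1. C k * G k s)"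
      unfolding chi(4) by (simp add: dirichlet_series_def sums_iff)
  qed
qed

text \<open>A crude bound from ln n <= n^e / e, sufficient for the convergence of all series with Re
  s > 1.\<close>

lemma sum_mangoldt_le:
  assumes e: "e > 0"
  shows "(\<Sum>m\<le>n. if Q m then mangoldt m else 0) \<le> real n powr (1 + e) / e"
proof (cases "n = 0")
  case False
  have "(\<Sum>m\<le>n. if Q m then mangoldt m else 0) \<le> (\<Sum>m\<in>{1..n}. (if Q m then mangoldt m else 0 :: real))"
    by (rule eq_refl, rule sum.mono_neutral_right) (auto simp: not_less_eq_eq)
  also have "\<dots> \<le> (\<Sum>m\<in>{1..n}. ln (real n))"
  proof (rule sum_mono)
    fix m assume "m \<in> {1..n}"
    hence m: "m > 0" "m \<le> n" by auto
    have "(if Q m then mangoldt m else 0) \<le> (mangoldt m :: real)" by (simp add: mangoldt_nonneg)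
    also have "\<dots> \<le> ln (real m)" using m by (intro mangoldt_le)
    also have "\<dots> \<le> ln (real n)" using m by simp
    finally show "(if Q m then mangoldt m else 0) \<le> ln (real n)" .
  qed
  also have "\<dots> = real n * ln (real n)" by simp
  also have "\<dots> \<le> real n * (real n powr e / e)"
    using ln_powr_bound[of "real n" e] False e by (intro mult_left_mono) auto
  also have "\<dots> = real n powr (1 + e) / e" using False by (simp add: powr_add)
  finally show ?thesis .
next
  case True
  show ?thesis unfolding True atMost_0 by simp
qed

text \<open>
  Partial summation turns \<open>\<Sum> a(n) n^{-s}\<close> into \<open>s \<Sum> (\<psi>(n)/n) n^{-s}\<close>, up to an error series
  that converges absolutely for \<open>Re s > 1/2\<close>. The coefficients \<open>b(n) = \<psi>(n)/n\<close> satisfy the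
  monotonicity hypothesis of the Tauberian theorem, which the \<open>a(n)\<close> themselves do not.
\<close>
lemma mangoldt_residue_mean:
  fixes Q :: "nat \<Rightarrow> bool"
  assumes "prime p" and Q: "\<And>n. Q (n mod p) = Q n" and Q0: "\<not> Q 0"
  shows "(\<lambda>n. (\<Sum>m\<le>n. if Q m then mangoldt m else 0) / real n)
    \<longlonglongrightarrow> real (card {a\<in>{1..p-1}. Q a}) / real (p - 1)"
proof -
  define c where "c = real (card {a\<in>{1..p-1}. Q a}) / real (p - 1)"
  define psi where "psi = (\<lambda>n. \<Sum>m\<le>n. if Q m then mangoldt m else 0 :: real)"
  define b where "b = (\<lambda>n. psi n / real n)"
  obtain G where G: "continuous_on {s. Re s \<ge> 1} G"
    "\<And>s. Re s > 1 \<Longrightarrow> dirichlet_series (\<lambda>n. if Q n then mangoldt n else 0) s = of_real c / (s - 1) + G s"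
    by (rule mangoldt_residue_series[OF assms, folded c_def]) (rule that)
  obtain R where R: "R holomorphic_on {s. Re s > 0}"
    "\<And>s. Re s > 1 \<Longrightarrow> dirichlet_series (\<lambda>_. 1) s = 1 / (s - 1) + R s"
    by (rule zeta_minus_pole_holomorphic) (rule that)
  have psi_0: "psi 0 = 0" unfolding psi_def atMost_0 by simp
  have psi_nonneg: "psi n \<ge> 0" for n unfolding psi_def by (intro sum_nonneg) (simp add: mangoldt_nonneg)
  have b_nonneg: "b n \<ge> 0" for n using psi_nonneg[of n] by (simp add: b_def)
  have psi_le: "psi n \<le> real n powr (1 + e) / e" if "e > 0" for n e
    unfolding psi_def using that by (rule sum_mangoldt_le)
  have psi_mono: "psi m \<le> psi n" if "m \<le> n" for m n
    unfolding psi_def using that by (intro sum_mono2) (auto simp: mangoldt_nonneg)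
  define f where "f = (\<lambda>n s. of_real (psi n) * (s * of_nat n powr (-s-1) - (of_nat n powr (-s) - of_nat (Suc n) powr (-s))) :: complex)"
  have f_holo: "f n holomorphic_on {s. Re s > 1/2}" for n
  proof (cases "n = 0")
    case False
    thus ?thesis unfolding f_def by (intro holomorphic_intros) auto
  qed (simp add: f_def psi_0)
  have f_bound: "\<exists>h. summable h \<and> (\<forall>n s. Re s \<ge> y \<longrightarrow> norm s \<le> R \<longrightarrow> norm (f n s) \<le> h n)"
    if y: "y > 1/2" for y R
  \<comment> \<open>With psi(n) <= 2 n^(3/2), the case e = 1/2 of the crude bound, the second-order
    remainder leaves n^(-y-1/2), which is summable for y > 1/2.\<close>
  proof (intro exI[of _ "\<lambda>n. 2 * R * (R + 1) * real n powr (-(y + 1/2))"] conjI allI impI)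
    show "summable (\<lambda>n. 2 * R * (R + 1) * real n powr (-(y + 1/2)))"
      using y by (intro summable_mult summable_nat_powr_minus) auto
  next
    fix n s assume s: "Re s \<ge> y" "norm s \<le> R"
    have R0: "R \<ge> 0" using s(2) norm_ge_zero order_trans by blast
    show "norm (f n s) \<le> 2 * R * (R + 1) * real n powr (-(y + 1/2))"
    proof (cases "n = 0")
      case False
      have "norm (f n s) \<le> psi n * (norm s * norm (s + 1) * real n powr (- Re s - 2))"
        unfolding f_def norm_mult[of "of_real _"] using norm_powr_diff_deriv_le[of n s] s y False psi_nonneg[of n]
        by (simp add: mult_left_mono)
      also have "\<dots> \<le> (2 * real n powr (3/2)) * (R * (R + 1) * real n powr (- y - 2))"
        using s False R0 psi_le[of "1/2" n] psi_nonneg norm_triangle_ineq[of s 1]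
        by (intro mult_mono powr_mono mult_nonneg_nonneg) auto
      also have "\<dots> = 2 * R * (R + 1) * (real n powr (3/2) * real n powr (- y - 2))" by simp
      also have "real n powr (3/2) * real n powr (- y - 2) = real n powr (-(y + 1/2))"
        unfolding powr_add[symmetric] by (rule arg_cong[of _ _ "\<lambda>t. real n powr t"]) simp
      finally show ?thesis .
    qed (use R0 in \<open>simp add: f_def psi_0\<close>)
  qed
  define E where "E = (\<lambda>s. \<Sum>n. f n s)"
  have E_holo: "E holomorphic_on {s. Re s > 1/2}"
    unfolding E_def by (rule holomorphic_on_suminf_halfplane[OF f_holo f_bound])
  have b_pw: "of_real (b n) * of_nat n powr (-s) = of_real (psi n) * (of_nat n powr (-s-1) :: complex)" for n s
    by (cases "n = 0") (simp_all add: b_def psi_0 powr_diff powr_minus field_simps)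
  have sum_b: "summable (\<lambda>n. b n * real n powr (-x))" if x: "x > 1" for x
  proof -
    define e where "e = (x - 1) / 2"
    have e: "e > 0" "x - e > 1" using x by (simp_all add: e_def field_simps)
    show ?thesis
    proof (rule summable_comparison_test'[OF summable_divide[OF summable_nat_powr_minus[OF e(2)], of e], of 0])
      fix n :: nat
      show "norm (b n * real n powr (-x)) \<le> real n powr (-(x - e)) / e"
      proof (cases "n = 0")
        case False
        have "norm (b n * real n powr (-x)) = psi n * (real n powr (-1) * real n powr (-x))"
          using False psi_nonneg[of n] by (simp add: b_def powr_minus divide_inverse abs_mult)
        also have "\<dots> \<le> (real n powr (1 + e) / e) * (real n powr (-1) * real n powr (-x))"
          by (intro mult_right_mono psi_le e) auto
        also have "\<dots> = (real n powr (1 + e) * (real n powr (-1) * real n powr (-x))) / e" by simp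
        also have "real n powr (1 + e) * (real n powr (-1) * real n powr (-x)) = real n powr (-(x - e))"
          by (simp only: powr_add[symmetric]) simp
        finally show ?thesis .
      qed simp
    qed
  qed
  define B where "B = dirichlet_series (\<lambda>n. of_real (b n))"
  have B_sums: "(\<lambda>n. of_real (b n) * of_nat n powr (-s)) sums B s" if s: "Re s > 1" for s
  proof -
    have "summable (\<lambda>n. of_real (b n) * of_nat n powr (-s))"
    proof (rule dirichlet_series_holomorphic(2)[of 1, OF _ s])
      fix y :: real assume "y > 1"
      thus "summable (\<lambda>n. norm (complex_of_real (b n)) * real n powr (-y))"
        using sum_b[of y] b_nonneg by (simp only: norm_of_real abs_of_nonneg)
    qed
    thus ?thesis by (simp add: B_def dirichlet_series_def summable_sums)
  qed
  have B_eq: "s * B s = of_real c / (s - 1) + G s + E s" if s: "Re s > 1" for s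
  proof -
    define g where "g = (\<lambda>n. of_nat n powr (-s) :: complex)"
    define a where "a = (\<lambda>n. if Q n then mangoldt n else 0 :: complex)"
    have psi_c: "of_real (psi n) = (\<Sum>m\<le>n. a m)" for n
      unfolding psi_def a_def of_real_sum by (intro sum.cong) auto
    have "(\<lambda>n. f n s) sums E s"
      unfolding E_def using holomorphic_on_suminf_halfplane(2)[OF f_holo f_bound, of s] s
      by (intro summable_sums) auto
    from sums_diff[OF sums_mult[OF B_sums[OF s], of s] this]
    have *: "(\<lambda>n. (\<Sum>m\<le>n. a m) * (g n - g (Suc n))) sums (s * B s - E s)"
      unfolding b_pw psi_c[symmetric] by (simp add: f_def g_def algebra_simps)
    have lim: "(\<lambda>N. (\<Sum>m\<le>N. a m) * g (Suc N)) \<longlonglongrightarrow> 0"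
    proof (rule Lim_null_comparison)
      define e where "e = (Re s - 1) / 2"
      have e: "e > 0" using s by (simp add: e_def)
      have "norm ((\<Sum>m\<le>N. a m) * g (Suc N)) \<le> real (Suc N) powr (1 + e - Re s) / e" for N
      proof -
        have "norm ((\<Sum>m\<le>N. a m) * g (Suc N)) = psi N * real (Suc N) powr (- Re s)"
          unfolding psi_c[symmetric] g_def norm_mult norm_nat_powr using psi_nonneg[of N] by simp
        also have "\<dots> \<le> psi (Suc N) * real (Suc N) powr (- Re s)"
          by (intro mult_right_mono psi_mono) auto
        also have "\<dots> \<le> real (Suc N) powr (1 + e) / e * real (Suc N) powr (- Re s)"
          by (intro mult_right_mono psi_le e) auto
        also have "\<dots> = (real (Suc N) powr (1 + e) * real (Suc N) powr (- Re s)) / e" by simp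
        also have "real (Suc N) powr (1 + e) * real (Suc N) powr (- Re s) = real (Suc N) powr (1 + e - Re s)"
          by (simp only: powr_add[symmetric]) simp
        finally show ?thesis .
      qed
      thus "eventually (\<lambda>N. norm ((\<Sum>m\<le>N. a m) * g (Suc N)) \<le> real (Suc N) powr (1 + e - Re s) / e) sequentially"
        by (intro always_eventually allI)
      have "1 + e - Re s < 0" using s by (simp add: e_def field_simps)
      thus "(\<lambda>N. real (Suc N) powr (1 + e - Re s) / e) \<longlonglongrightarrow> 0"
        using e by real_asymp
    qed
    have "(\<lambda>n. a n * g n) sums (s * B s - E s)"
      using sums_by_parts[OF lim sums_summable[OF *]] * by (simp add: sums_iff)
    hence "dirichlet_series a s = s * B s - E s"
      by (simp add: dirichlet_series_def g_def sums_iff)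
    thus ?thesis using G(2)[OF s] unfolding a_def by (simp add: algebra_simps)
  qed
  \<comment> \<open>From s B = c / (s - 1) + G + E and c / (s (s - 1)) = c / (s - 1) - c / s,
    subtracting c times zeta from B cancels the pole and leaves this function.\<close>
  interpret tauberian b c "\<lambda>s. (G s + E s - of_real c) / s - of_real c * R s"
  proof
    show "b n \<ge> 0" for n by (rule b_nonneg)
    have "real n * b n = psi n" for n by (cases "n = 0") (simp_all add: b_def psi_0)
    thus "real m * b m \<le> real n * b n" if "m \<le> n" for m n using psi_mono[OF that] by simp
    show "c \<ge> 0" by (simp add: c_def)
    show "summable (\<lambda>n. b n * real n powr (-x))" if "x > 1" for x using that by (rule sum_b)
    have "continuous_on {s. Re s \<ge> 1} E" "continuous_on {s. Re s \<ge> 1} R"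
      using holomorphic_on_imp_continuous_on[OF E_holo] holomorphic_on_imp_continuous_on[OF R(1)]
      by (auto elim!: continuous_on_subset)
    thus "continuous_on {s. Re s \<ge> 1} (\<lambda>s. (G s + E s - of_real c) / s - of_real c * R s)"
      by (intro continuous_intros G) auto
    fix s :: complex assume s: "Re s > 1"
    have "summable (\<lambda>n. of_nat n powr (-s) :: complex)"
      using dirichlet_series_holomorphic(2)[of 1 "\<lambda>_. 1" s] s summable_nat_powr_minus by simp
    hence "(\<lambda>n. of_nat n powr (-s) :: complex) sums dirichlet_series (\<lambda>_. 1) s"
      by (simp add: dirichlet_series_def summable_sums)
    from sums_diff[OF B_sums[OF s] sums_mult[OF this, of "of_real c"]]
    have 1: "dirichlet_series (\<lambda>n. of_real (b n - c)) s = B s - of_real c * (1 / (s - 1) + R s)"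
      unfolding R(2)[OF s] by (simp add: dirichlet_series_def sums_iff algebra_simps)
    have [simp]: "s \<noteq> 0" "s \<noteq> 1" using s by auto
    have "B s = (of_real c / (s - 1) + G s + E s) / s" using B_eq[OF s] by (simp add: field_simps)
    moreover have "of_real c / (s - 1) / s - of_real c * (1 / (s - 1)) = - (of_real c / s)"
    proof -
      have "z / d / (d + 1) - z * (1 / d) = - (z / (d + 1))" if "d \<noteq> 0" "d + 1 \<noteq> 0" for z d :: complex
        using that by (simp add: divide_simps) (simp add: algebra_simps)
      from this[of "s - 1" "of_real c"] show ?thesis by simp
    qed
    ultimately show "(G s + E s - of_real c) / s - of_real c * R s = dirichlet_series (\<lambda>n. of_real (b n - c)) s"
      unfolding 1 by (simp add: add_divide_distrib diff_divide_distrib ring_distribs)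
  qed
  show ?thesis using tauberian_limit by (simp add: b_def[abs_def] psi_def c_def)
qed

text \<open>If q^k <= n with k >= 2, then q <= sqrt n and k <= ln n / ln 2; the right side counts
  such pairs.\<close>

lemma card_proper_prime_powers_le:
  assumes "n > 0"
  shows "real (card {m. m \<le> n \<and> primepow m \<and> \<not> prime m}) \<le> (sqrt (real n) + 1) * (ln (real n) / ln 2 + 1)"
proof -
  define a b where "a = nat \<lfloor>sqrt (real n)\<rfloor>" and "b = nat \<lfloor>ln (real n) / ln 2\<rfloor>"
  have "{m. m \<le> n \<and> primepow m \<and> \<not> prime m} \<subseteq> (\<lambda>(q, k). q ^ k) ` ({..a} \<times> {..b})"
  proof
    fix m assume "m \<in> {m. m \<le> n \<and> primepow m \<and> \<not> prime m}"
    then obtain q k where m: "m \<le> n" "prime q" "k > 0" "m = q ^ k" "\<not> prime m"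
      by (auto simp: primepow_def)
    have "k \<noteq> 1" using m by (intro notI) simp
    hence "k \<ge> 2" using m(3) by simp
    have q: "q \<ge> 2" using m(2) by (rule prime_ge_2_nat)
    have "q ^ 2 \<le> q ^ k" using \<open>k \<ge> 2\<close> q by (intro power_increasing) auto
    hence "real q ^ 2 \<le> real n" using m(1,4) by (metis of_nat_le_iff of_nat_power order_trans)
    hence "real q \<le> sqrt (real n)" by (rule real_le_rsqrt)
    hence qa: "q \<le> a" unfolding a_def by linarith
    have "2 ^ k \<le> q ^ k" using q by (rule power_mono) simp
    hence "(2::real) ^ k \<le> real n" using m(1,4) by (metis of_nat_le_iff of_nat_numeral of_nat_power order_trans)
    hence "ln ((2::real) ^ k) \<le> ln (real n)" using assms by (subst ln_le_cancel_iff) auto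
    hence "real k \<le> ln (real n) / ln 2" by (simp add: ln_realpow field_simps)
    hence kb: "k \<le> b" unfolding b_def by linarith
    show "m \<in> (\<lambda>(q, k). q ^ k) ` ({..a} \<times> {..b})" using qa kb m(4) by auto
  qed
  hence "card {m. m \<le> n \<and> primepow m \<and> \<not> prime m} \<le> card ((\<lambda>(q, k). q ^ k) ` ({..a} \<times> {..b}))"
    by (intro card_mono) auto
  also have "\<dots> \<le> card ({..a} \<times> {..b})" by (rule card_image_le) auto
  also have "\<dots> = (a + 1) * (b + 1)" by (simp add: card_cartesian_product)
  finally have "real (card {m. m \<le> n \<and> primepow m \<and> \<not> prime m}) \<le> real ((a + 1) * (b + 1))"
    by (rule of_nat_mono)
  also have "\<dots> = (real a + 1) * (real b + 1)" by (simp add: algebra_simps)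
  also have "\<dots> \<le> (sqrt (real n) + 1) * (ln (real n) / ln 2 + 1)"
    using assms by (intro mult_mono add_mono) (auto simp: a_def b_def)
  finally show ?thesis .
qed

text \<open>Proper prime powers contribute O(sqrt n (ln n)^2) to psi, which is negligible against
  n.\<close>

lemma prime_residue_mean:
  fixes Q :: "nat \<Rightarrow> bool"
  assumes "prime p" and Q: "\<And>n. Q (n mod p) = Q n" and Q0: "\<not> Q 0"
  shows "(\<lambda>n. (\<Sum>q | q \<le> n \<and> prime q \<and> Q q. ln (real q)) / real n)
    \<longlonglongrightarrow> real (card {a\<in>{1..p-1}. Q a}) / real (p - 1)"
proof -
  define psi where "psi = (\<lambda>n. \<Sum>m\<le>n. if Q m then mangoldt m else 0 :: real)"
  define theta where "theta = (\<lambda>n. \<Sum>q | q \<le> n \<and> prime q \<and> Q q. ln (real q))"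
  have diff: "psi n - theta n = (\<Sum>m | m \<le> n \<and> primepow m \<and> \<not> prime m. if Q m then mangoldt m else 0)" for n
  proof -
    have "psi n = (\<Sum>m | m \<le> n \<and> primepow m. if Q m then mangoldt m else 0)"
      unfolding psi_def by (rule sum.mono_neutral_right) (auto simp: mangoldt_def)
    also have "{m. m \<le> n \<and> primepow m} = {m. m \<le> n \<and> prime m} \<union> {m. m \<le> n \<and> primepow m \<and> \<not> prime m}"
      by auto
    also have "(\<Sum>m\<in>\<dots>. if Q m then mangoldt m else 0) = (\<Sum>m | m \<le> n \<and> prime m. if Q m then mangoldt m else 0)
        + (\<Sum>m | m \<le> n \<and> primepow m \<and> \<not> prime m. if Q m then mangoldt m else (0::real))"
      by (rule sum.union_disjoint) auto
    also have "(\<Sum>m | m \<le> n \<and> prime m. if Q m then mangoldt m else 0) = theta n"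
      unfolding theta_def by (rule sum.mono_neutral_cong_right) auto
    finally show ?thesis by simp
  qed
  have "(\<lambda>n. (psi n - theta n) / real n) \<longlonglongrightarrow> 0"
  proof (rule Lim_null_comparison)
    show "(\<lambda>n. (sqrt (real n) + 1) * (ln (real n) / ln 2 + 1) * ln (real n) / real n) \<longlonglongrightarrow> 0"
      by real_asymp
    show "eventually (\<lambda>n. norm ((psi n - theta n) / real n) \<le>
        (sqrt (real n) + 1) * (ln (real n) / ln 2 + 1) * ln (real n) / real n) sequentially"
      using eventually_gt_at_top[of 0]
    proof eventually_elim
      case (elim n)
      let ?A = "{m. m \<le> n \<and> primepow m \<and> \<not> prime m}"
      have "psi n - theta n \<le> (\<Sum>m\<in>?A. ln (real n))"
        unfolding diff
      proof (rule sum_mono)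
        fix m assume "m \<in> ?A"
        hence m: "m \<le> n" "m > 0" by (auto simp: primepow_gt_0_nat)
        have "(if Q m then mangoldt m else 0) \<le> (mangoldt m :: real)" by (simp add: mangoldt_nonneg)
        also have "\<dots> \<le> ln (real m)" using m(2) by (rule mangoldt_le)
        also have "\<dots> \<le> ln (real n)" using m by simp
        finally show "(if Q m then mangoldt m else 0) \<le> ln (real n)" .
      qed
      also have "\<dots> = real (card ?A) * ln (real n)" by simp
      also have "\<dots> \<le> (sqrt (real n) + 1) * (ln (real n) / ln 2 + 1) * ln (real n)"
        using elim by (intro mult_right_mono card_proper_prime_powers_le) auto
      finally have "psi n - theta n \<le> (sqrt (real n) + 1) * (ln (real n) / ln 2 + 1) * ln (real n)" .
      moreover have "psi n - theta n \<ge> 0" unfolding diff by (intro sum_nonneg) (simp add: mangoldt_nonneg)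
      ultimately show ?case by (simp add: divide_right_mono)
    qed
  qed
  from tendsto_diff[OF mangoldt_residue_mean[OF assms] this]
  show ?thesis by (simp add: psi_def theta_def diff_divide_distrib)
qed

subsection \<open>The least prime primitive root not dividing N\<close>

theorem theorem3p1:
  fixes p :: nat
  assumes "prime p" and "p \<ge> 5"
  shows "limsup (\<lambda>N::nat. ereal (real (gstar p N) / ln (real N)))
           = ereal (real (p - 1) / real (totient (p - 1)))"
proof -
  define theta where "theta = (\<lambda>n. \<Sum>q | q \<le> n \<and> prime_primroot p q. ln (real q))"
  define c where "c = real (totient (p - 1)) / real (p - 1)"
  have c: "c > 0" using assms(2) by (simp add: c_def)
  have card: "card {a\<in>{1..p-1}. residue_primroot p a} = totient (p - 1)"
  proof -
    have "{a\<in>{1..p-1}. residue_primroot p a} = {x\<in>totatives p. ord p x = p - 1}"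
      using assms by (auto simp: residue_primroot_def totatives_prime totient_prime coprime_commute
          intro: prime_imp_coprime dest: nat_dvd_not_less)
    thus ?thesis using prime_card_primitive_roots(1)[OF _ assms(1)] assms(2) by simp
  qed
  have "(\<lambda>n. (\<Sum>q | q \<le> n \<and> prime q \<and> residue_primroot p q. ln (real q)) / real n)
      \<longlonglongrightarrow> real (card {a\<in>{1..p-1}. residue_primroot p a}) / real (p - 1)"
    by (rule prime_residue_mean[OF assms(1)]) (use assms(2) in \<open>auto simp: residue_primroot_def\<close>)
  hence lim: "(\<lambda>n. theta n / real n) \<longlonglongrightarrow> c"
    unfolding card by (simp add: theta_def c_def prime_primroot_def)
  \<comment> \<open>The least positive integer divisible by every prime primitive root up to n,
    hence the extremal case for the limsup.\<close>
  define N where "N = (\<lambda>n. \<Prod>q | q \<le> n \<and> prime_primroot p q. q)"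
  have N_pos: "N n > 0" for n
    unfolding N_def by (rule prod_pos) (auto simp: prime_primroot_def prime_gt_0_nat)
  have ln_N: "ln (real (N n)) = theta n" for n
  proof -
    have eq: "real (N n) = (\<Prod>q | q \<le> n \<and> prime_primroot p q. real q)" by (simp add: N_def)
    show ?thesis unfolding theta_def eq
      by (rule ln_prod) (auto simp: prime_primroot_def prime_gt_0_nat)
  qed
  have N_dvd: "N n dvd M" if "\<And>q. q \<le> n \<Longrightarrow> prime_primroot p q \<Longrightarrow> q dvd M" for n M
  proof -
    have prod_dvd: "(\<Prod>q\<in>A. q) dvd M" if "finite A" "A \<subseteq> {q. prime q \<and> q dvd M}" for A
      using that
    proof (induction A rule: finite_induct)
      case (insert q A)
      have "coprime q (\<Prod>A)"
        using insert by (intro prod_coprime_right) (auto intro!: primes_coprime)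
      thus ?case using insert by (simp add: divides_mult)
    qed simp
    show ?thesis unfolding N_def
    proof (rule prod_dvd)
      show "{q. q \<le> n \<and> prime_primroot p q} \<subseteq> {q. prime q \<and> q dvd M}"
      proof
        fix q assume "q \<in> {q. q \<le> n \<and> prime_primroot p q}"
        thus "q \<in> {q. prime q \<and> q dvd M}" using that[of q] by (simp add: prime_primroot_def)
      qed
    qed simp
  qed
  have theta_top: "filterlim theta at_top sequentially"
  proof -
    have "filterlim (\<lambda>n. theta n / real n * real n) at_top sequentially"
      by (rule filterlim_tendsto_pos_mult_at_top[OF lim c filterlim_real_sequentially])
    thus ?thesis
      by (rule filterlim_cong[THEN iffD1, OF refl refl, rotated]) (rule eventually_mono[OF eventually_gt_at_top[of 0]], simp)
  qed
  have N_top: "filterlim N at_top sequentially"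
  proof -
    have "filterlim (\<lambda>n. exp (theta n)) at_top sequentially"
      by (rule filterlim_compose[OF exp_at_top theta_top])
    also have "(\<lambda>n. exp (theta n)) = (\<lambda>n. real (N n))"
      using N_pos by (simp add: ln_N[symmetric])
    finally show ?thesis by (simp add: filterlim_sequentially_iff_filterlim_real)
  qed
  \<comment> \<open>Existence of the minimum in \<open>gstar\<close> also comes from the asymptotics
    of theta: otherwise every \<open>N n\<close> would divide M, although they tend to
    infinity.\<close>
  have ex: "\<exists>q. prime_primroot p q \<and> \<not> q dvd M" if "M > 0" for M
  proof (rule ccontr)
    assume "\<not> ?thesis"
    hence "N n dvd M" for n by (intro N_dvd) blast
    hence "N n \<le> M" for n using that by (intro dvd_imp_le)
    hence "eventually (\<lambda>n. N n \<le> M) sequentially" by simp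
    moreover have "eventually (\<lambda>n. Suc M \<le> N n) sequentially"
      using N_top unfolding filterlim_at_top by blast
    ultimately have "eventually (\<lambda>n. False) sequentially" by eventually_elim simp
    thus False by simp
  qed
  have theta_le: "theta (gstar p M - 1) \<le> ln (real M)" if "M > 0" for M
  proof -
    have "N (gstar p M - 1) dvd M"
    proof (rule N_dvd)
      fix q assume q: "q \<le> gstar p M - 1" "prime_primroot p q"
      show "q dvd M"
      proof (rule ccontr)
        assume "\<not> q dvd M"
        hence "gstar p M \<le> q" unfolding gstar_def using q by (intro Least_le) auto
        \<comment> \<open>Excludes the truncated subtraction 0 - 1 = 0.\<close>
        moreover have "q > 0" using q(2) by (simp add: prime_primroot_def prime_gt_0_nat)
        ultimately show False using q(1) by linarith
      qed
    qed
    hence "N (gstar p M - 1) \<le> M" using that by (intro dvd_imp_le)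
    hence "ln (real (N (gstar p M - 1))) \<le> ln (real M)" using N_pos by (subst ln_le_cancel_iff) (use that in auto)
    thus ?thesis by (simp add: ln_N)
  qed
  have gstar_gt: "gstar p (N n) > n" for n
  proof (rule ccontr)
    assume *: "\<not> gstar p (N n) > n"
    have g: "prime_primroot p (gstar p (N n)) \<and> \<not> gstar p (N n) dvd N n"
      unfolding gstar_def by (rule LeastI_ex) (rule ex[OF N_pos])
    hence "gstar p (N n) dvd N n"
      using * unfolding N_def by (intro dvd_prodI) auto
    thus False using g by blast
  qed
  have "limsup (\<lambda>M. ereal (real (gstar p M) / ln (real M))) = ereal (1 / c)"
  proof (rule antisym)
    show "limsup (\<lambda>M. ereal (real (gstar p M) / ln (real M))) \<le> ereal (1 / c)"
    proof (rule dense_ge)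
      fix z assume z: "ereal (1 / c) < z"
      obtain y where y: "1 / c < y" "ereal y < z" using ereal_dense2[OF z] by auto
      have "y > 0" using y(1) c by (meson less_trans zero_less_divide_1_iff)
      hence "1 / y < c" using y(1) c by (simp add: field_simps)
      then obtain d where d: "1 / y < d" "d < c" using dense by blast
      have "d > 0" using d(1) \<open>y > 0\<close> by (meson less_trans zero_less_divide_1_iff)
      have "eventually (\<lambda>n. theta n / real n > d) sequentially" by (rule order_tendstoD(1)[OF lim d(2)])
      then obtain n0 where n0: "\<And>n. n \<ge> n0 \<Longrightarrow> theta n / real n > d"
        unfolding eventually_sequentially by blast
      \<comment> \<open>Small values of \<open>gstar\<close> are absorbed by n0 + 1; the maximum
        with 1 keeps the denominator \<open>gstar p M - 1\<close> positive.\<close>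
      have bound: "real (gstar p M) \<le> ln (real M) / d + real n0 + 1" if M: "M > 0" for M
      proof (cases "gstar p M - 1 \<ge> max n0 1")
        case True
        hence "real (gstar p M - 1) > 0" "d < theta (gstar p M - 1) / real (gstar p M - 1)"
          using n0[of "gstar p M - 1"] by auto
        hence "d * real (gstar p M - 1) \<le> theta (gstar p M - 1)"
          by (simp only: pos_less_divide_eq less_imp_le)
        also have "\<dots> \<le> ln (real M)" by (rule theta_le[OF M])
        finally have "real (gstar p M - 1) \<le> ln (real M) / d" using \<open>d > 0\<close> by (simp add: field_simps)
        thus ?thesis using True by (simp add: of_nat_diff)
      next
        case False
        have "ln (real M) / d \<ge> 0" using M \<open>d > 0\<close> by simp
        thus ?thesis using False by simp linarith
      qed
      have "((\<lambda>M. (ln (real M) / d + real n0 + 1) / ln (real M)) \<longlongrightarrow> inverse d) sequentially"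
        using \<open>d > 0\<close> by real_asymp
      moreover have "inverse d < y" using d(1) \<open>d > 0\<close> \<open>y > 0\<close> by (simp add: field_simps)
      ultimately have "eventually (\<lambda>M. (ln (real M) / d + real n0 + 1) / ln (real M) < y) sequentially"
        by (rule order_tendstoD(2))
      hence "eventually (\<lambda>M. ereal (real (gstar p M) / ln (real M)) \<le> ereal y) sequentially"
        using eventually_gt_at_top[of 1]
      proof eventually_elim
        case (elim M)
        have "real (gstar p M) / ln (real M) \<le> (ln (real M) / d + real n0 + 1) / ln (real M)"
          using elim(2) by (intro divide_right_mono bound) auto
        thus ?case using elim(1) by simp
      qed
      hence "limsup (\<lambda>M. ereal (real (gstar p M) / ln (real M))) \<le> ereal y" by (rule Limsup_bounded)
      thus "limsup (\<lambda>M. ereal (real (gstar p M) / ln (real M))) \<le> z" using y(2) by simp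
    qed
  next
    have "(\<lambda>n. inverse (theta n / real n)) \<longlonglongrightarrow> inverse c"
      using c by (intro tendsto_inverse lim) auto
    hence lim': "(\<lambda>n. ereal (real n / theta n)) \<longlonglongrightarrow> ereal (1 / c)"
      by (simp add: divide_inverse mult.commute)
    show "ereal (1 / c) \<le> limsup (\<lambda>M. ereal (real (gstar p M) / ln (real M)))"
    proof (rule ccontr)
      assume "\<not> ?thesis"
      then obtain y where y: "limsup (\<lambda>M. ereal (real (gstar p M) / ln (real M))) < y" "y < ereal (1 / c)"
        using dense[of _ "ereal (1 / c)"] by (auto simp: not_le)
      have "eventually (\<lambda>n. y < ereal (real n / theta n)) sequentially"
        by (rule order_tendstoD(1)[OF lim' y(2)])
      moreover have "eventually (\<lambda>n. theta n > 0) sequentially"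
        using theta_top by (simp add: filterlim_at_top_dense)
      ultimately have ev: "eventually (\<lambda>n. y < ereal (real (gstar p (N n)) / ln (real (N n)))) sequentially"
      proof eventually_elim
        case (elim n)
        have "real n / theta n \<le> real (gstar p (N n)) / theta n"
          using elim(2) gstar_gt[of n] by (intro divide_right_mono) auto
        thus ?case using elim(1) unfolding ln_N by (metis ereal_less_eq(3) less_le_trans)
      qed
      \<comment> \<open>A bound valid for all large M applies to M = \<open>N n\<close>, because
        \<open>N n\<close> tends to infinity, and there it contradicts \<open>ev\<close>.\<close>
      have "eventually (\<lambda>M. y > ereal (real (gstar p M) / ln (real M))) sequentially"
        using Limsup_le_iff[THEN iffD1, OF order_refl] y(1) by blast
      from eventually_compose_filterlim[OF this N_top] ev
      have "eventually (\<lambda>n. False) sequentially" by eventually_elim (meson less_asym)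
      thus False by simp
    qed
  qed
  thus ?thesis by (simp add: c_def)
qed

end
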